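(* Let $n$ be a positive integer or $n=\infty$, and let $T=(T_1,\ldots,T_n)$ be an $n$-tuple of non-zero bounded operators on a Hilbert space $\mathcal H$ such that $\sum_{i=1}^n T_iT_i^*\le I_{\mathcal H}$. Let $\mathcal P=\{P_k\}_{k\in\mathcal J}$ be a countable family of projections on $\mathcal H$ which stabilizes $T$, and such that for every $k\in\mathcal J$ there is some $i$ with $T_iP_k\neq 0$. Then there is a minimal partially isometric dilation $S=(S_1,\ldots,S_n)$ of $T$ on a Hilbert space $\mathcal K\supseteq\mathcal H$ with $\mathcal P=\{S_i^*S_i|_{\mathcal H}:1\le i\le n\}$. This dilation is unique up to joint unitary equivalence which fixes $\mathcal H$; that is, if $S'=(S_1',\ldots,S_n')$ on $\mathcal K'\supseteq\mathcal H$ is another minimal partially isometric dilation of $T$ with $\mathcal P=\{S_i'^*S_i'|_{\mathcal H}:1\le i\le n\}$, then there is a unitary $U:\mathcal K\to\mathcal K'$ such that $U|_{\mathcal H}=I_{\mathcal H}$ and $U^*S_i'U=S_i$ for $1\le i\le n$.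
   Context: Projections are orthogonal projections; infinite sums of operators are in the strong operator topology. Stabilizing family: a countable family $\mathcal P=\{P_k:k\in\mathcal J\}$ of projections on $\mathcal H$ stabilizes $T$ if $P_kT_i\in\{T_i,0\}$ and $T_iP_k\in\{T_i,0\}$ for all $k\in\mathcal J$ and $1\le i\le n$, and $\sum_{k\in\mathcal J}P_k=I_{\mathcal H}$. Relations $(\dagger)$: an $n$-tuple $S=(S_1,\ldots,S_n)$ of non-zero operators on a Hilbert space $\mathcal K$ satisfies $(\dagger)$ if (1) $(S_i^*S_i)^2=S_i^*S_i$ for all $i$; (2) $\sum_{i=1}^nS_iS_i^*\le I$; (3) for all $i,j$, either $(S_i^*S_i)(S_j^*S_j)=0$ or $S_i^*S_i=S_j^*S_j$; (4) for every $i$ there is $j$ with $S_iS_i^*\le S_j^*S_j$; (5) if $\{Q_k\}$ are the distinct elements of $\{S_i^*S_i\}$, then $\sum_kQ_k=I$. Minimal partially isometric dilation: an $n$-tuple $S=(S_1,\ldots,S_n)$ on a Hilbert space $\mathcal K\supseteq\mathcal H$ is a minimal partially isometric dilation of $T$ if (i) $S$ satisfies $(\dagger)$; (ii) $\mathcal H$ reduces each $S_i^*S_i$, and $\mathcal H$ is invariant for each $S_i^*$ with $S_i^*|_{\mathcal H}=T_i^*$, $1\le i\le n$; (iii) $\mathcal K=\mathcal H\vee\bigl(\bigvee_{i_1,\ldots,i_k;\,k\ge1}S_{i_1}\cdots S_{i_k}\mathcal H\bigr)$, where $\vee$ denotes closed linear span. *)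

theory Defs
  imports "HOL-Analysis.Analysis" "HOL-Library.Extended_Nat" "HOL-Library.FuncSet"
begin

section \<open>Complex Hilbert spaces\<close>

text \<open>
  A complex inner product space is a real inner product space with a compatible complex structure.
  The complex inner product is conjugate-linear in its first argument, and the real inner product
  (hence the norm and the topology) is its real part.
\<close>

class complex_inner = real_inner +
  fixes scaleC :: "complex \<Rightarrow> 'a \<Rightarrow> 'a"  (infixr "*\<^sub>C" 75)
    and cinner :: "'a \<Rightarrow> 'a \<Rightarrow> complex"
  assumes scaleC_add_right: "a *\<^sub>C (x + y) = a *\<^sub>C x + a *\<^sub>C y"
    and scaleC_add_left: "(a + b) *\<^sub>C x = a *\<^sub>C x + b *\<^sub>C x"
    and scaleC_scaleC: "a *\<^sub>C (b *\<^sub>C x) = (a * b) *\<^sub>C x"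
    and scaleC_of_real: "complex_of_real r *\<^sub>C x = r *\<^sub>R x"
    and cinner_commute: "cinner x y = cnj (cinner y x)"
    and cinner_add_left: "cinner (x + y) z = cinner x z + cinner y z"
    and cinner_scaleC_left: "cinner (a *\<^sub>C x) y = cnj a * cinner x y"
    and Re_cinner: "Re (cinner x y) = inner x y"

class complex_hilbert = complex_inner + complete_space

lemma scaleC_one: "1 *\<^sub>C x = (x :: 'a::complex_inner)"
  using scaleC_of_real[of 1 x] by simp

interpretation complex_vector: vector_space "scaleC :: complex \<Rightarrow> 'a \<Rightarrow> 'a::complex_inner"
  by unfold_locales (simp_all add: scaleC_add_right scaleC_add_left scaleC_scaleC scaleC_one)

lemma cinner_self: "cinner x x = complex_of_real ((norm x)\<^sup>2)"
proof -
  have "Im (cinner x x) = 0"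
    using cinner_commute[of x x] by (metis Reals_cnj_iff complex_is_Real_iff)
  then show ?thesis
    by (simp add: complex_eq_iff Re_cinner power2_norm_eq_inner)
qed

lemma norm_scaleC: "norm (a *\<^sub>C x) = cmod a * norm (x :: 'a::complex_inner)"
proof -
  have "cinner (a *\<^sub>C x) (a *\<^sub>C x) = cnj a * cnj (cnj a * cinner x x)"
    by (metis cinner_commute cinner_scaleC_left)
  also have "\<dots> = complex_of_real ((cmod a * norm x)\<^sup>2)"
    by (simp add: cinner_self complex_norm_square[symmetric] power_mult_distrib mult_ac
        del: of_real_power)
  finally have "(norm (a *\<^sub>C x))\<^sup>2 = (cmod a * norm x)\<^sup>2"
    unfolding cinner_self of_real_eq_iff .
  then show ?thesis
    by (simp add: power2_eq_iff_nonneg)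
qed

lemma Im_cinner: "Im (cinner x y) = inner (\<i> *\<^sub>C x) (y :: 'a::complex_inner)"
  by (simp add: Re_cinner[symmetric] cinner_scaleC_left)

lemma cmod_cinner_le: "cmod (cinner x y) \<le> (norm x)\<^sup>2 + (norm (y :: 'a::complex_inner))\<^sup>2"
proof -
  have "cmod (cinner x y) \<le> \<bar>Re (cinner x y)\<bar> + \<bar>Im (cinner x y)\<bar>"
    by (rule cmod_le)
  also have "\<dots> \<le> norm x * norm y + norm (\<i> *\<^sub>C x) * norm y"
    unfolding Re_cinner Im_cinner by (intro add_mono Cauchy_Schwarz_ineq2)
  also have "\<dots> = 2 * norm x * norm y"
    by (simp add: norm_scaleC)
  also have "\<dots> \<le> (norm x)\<^sup>2 + (norm y)\<^sup>2"
    by (rule sum_squares_bound)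
  finally show ?thesis .
qed


section \<open>Direct sums of copies of a Hilbert space\<close>

text \<open>
  Hilbert direct sum of copies of a space, indexed by a type. It is the ambient space in
  which the dilation space is found: an existential quantifier cannot range over types.
\<close>

typedef (overloaded) ('i, 'a) ell2 =
  "{f :: 'i \<Rightarrow> 'a::complex_inner. (\<lambda>i. (norm (f i))\<^sup>2) summable_on UNIV}"
  morphisms ell2_nth Abs_ell2
  by (rule exI[of _ "\<lambda>_. 0"]) simp

setup_lifting type_definition_ell2

lemma summable_sq_add:
  fixes f g :: "'i \<Rightarrow> 'a::complex_inner"
  assumes "(\<lambda>i. (norm (f i))\<^sup>2) summable_on UNIV" "(\<lambda>i. (norm (g i))\<^sup>2) summable_on UNIV"
  shows "(\<lambda>i. (norm (f i + g i))\<^sup>2) summable_on UNIV"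
proof (rule summable_on_comparison_test)
  show "(\<lambda>i. 2 * ((norm (f i))\<^sup>2 + (norm (g i))\<^sup>2)) summable_on UNIV"
    by (intro summable_on_cmult_right summable_on_add assms)
  fix i
  have "(norm (f i + g i))\<^sup>2 \<le> (norm (f i) + norm (g i))\<^sup>2"
    by (intro power_mono norm_triangle_ineq norm_ge_zero)
  also have "\<dots> \<le> 2 * ((norm (f i))\<^sup>2 + (norm (g i))\<^sup>2)"
    using sum_squares_bound[of "norm (f i)" "norm (g i)"] by (simp add: power2_sum)
  finally show "(norm (f i + g i))\<^sup>2 \<le> 2 * ((norm (f i))\<^sup>2 + (norm (g i))\<^sup>2)" .
qed simp

lemma summable_sq_scaleC:
  fixes f :: "'i \<Rightarrow> 'a::complex_inner"
  assumes "(\<lambda>i. (norm (f i))\<^sup>2) summable_on UNIV"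
  shows "(\<lambda>i. (norm (a *\<^sub>C f i))\<^sup>2) summable_on UNIV"
  using summable_on_cmult_right[OF assms, of "(cmod a)\<^sup>2"]
  by (simp add: norm_scaleC power_mult_distrib)

lemma summable_cinner:
  fixes f g :: "'i \<Rightarrow> 'a::complex_inner"
  assumes "(\<lambda>i. (norm (f i))\<^sup>2) summable_on UNIV" "(\<lambda>i. (norm (g i))\<^sup>2) summable_on UNIV"
  shows "(\<lambda>i. cinner (f i) (g i)) summable_on UNIV"
  by (rule abs_summable_summable, rule Infinite_Sum.abs_summable_on_comparison_test'[OF summable_on_add[OF assms]])
     (rule cmod_cinner_le)

lemma summable_inner:
  fixes f g :: "'i \<Rightarrow> 'a::complex_inner"
  assumes "(\<lambda>i. (norm (f i))\<^sup>2) summable_on UNIV" "(\<lambda>i. (norm (g i))\<^sup>2) summable_on UNIV"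
  shows "(\<lambda>i. inner (f i) (g i)) summable_on UNIV"
  using summable_on_bounded_linear[OF bounded_linear_Re summable_cinner[OF assms]]
  by (simp add: Re_cinner)

instantiation ell2 :: (type, complex_inner) complex_inner
begin

lift_definition zero_ell2 :: "('a, 'b) ell2" is "\<lambda>_. 0" by simp
lift_definition plus_ell2 :: "('a, 'b) ell2 \<Rightarrow> ('a, 'b) ell2 \<Rightarrow> ('a, 'b) ell2"
  is "\<lambda>f g i. f i + g i" by (rule summable_sq_add)
lift_definition uminus_ell2 :: "('a, 'b) ell2 \<Rightarrow> ('a, 'b) ell2"
  is "\<lambda>f i. - f i" by simp
lift_definition minus_ell2 :: "('a, 'b) ell2 \<Rightarrow> ('a, 'b) ell2 \<Rightarrow> ('a, 'b) ell2"
  is "\<lambda>f g i. f i - g i"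
  subgoal for f g using summable_sq_add[of f "\<lambda>i. - g i"] by simp
  done
lift_definition scaleR_ell2 :: "real \<Rightarrow> ('a, 'b) ell2 \<Rightarrow> ('a, 'b) ell2"
  is "\<lambda>r f i. r *\<^sub>R f i"
  subgoal for r f using summable_sq_scaleC[of f "complex_of_real r"] by (simp add: scaleC_of_real)
  done
lift_definition scaleC_ell2 :: "complex \<Rightarrow> ('a, 'b) ell2 \<Rightarrow> ('a, 'b) ell2"
  is "\<lambda>a f i. a *\<^sub>C f i" by (rule summable_sq_scaleC)
lift_definition inner_ell2 :: "('a, 'b) ell2 \<Rightarrow> ('a, 'b) ell2 \<Rightarrow> real"
  is "\<lambda>f g. \<Sum>\<^sub>\<infinity>i. inner (f i) (g i)" .
lift_definition cinner_ell2 :: "('a, 'b) ell2 \<Rightarrow> ('a, 'b) ell2 \<Rightarrow> complex"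
  is "\<lambda>f g. \<Sum>\<^sub>\<infinity>i. cinner (f i) (g i)" .

definition norm_ell2 :: "('a, 'b) ell2 \<Rightarrow> real" where "norm_ell2 x = sqrt (inner x x)"
definition dist_ell2 :: "('a, 'b) ell2 \<Rightarrow> ('a, 'b) ell2 \<Rightarrow> real"
  where "dist_ell2 x y = norm (x - y)"
definition sgn_ell2 :: "('a, 'b) ell2 \<Rightarrow> ('a, 'b) ell2" where "sgn_ell2 x = inverse (norm x) *\<^sub>R x"
definition uniformity_ell2 :: "(('a, 'b) ell2 \<times> ('a, 'b) ell2) filter"
  where "uniformity_ell2 = (INF e\<in>{0 <..}. principal {(x, y). dist x y < e})"
definition open_ell2 :: "('a, 'b) ell2 set \<Rightarrow> bool"
  where "open_ell2 U = (\<forall>x\<in>U. eventually (\<lambda>(x', y). x' = x \<longrightarrow> y \<in> U) uniformity)"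

instance
proof
  fix x y z :: "('a, 'b) ell2" and r s :: real and a b :: complex
  show "x + y + z = x + (y + z)" "x + y = y + x" "0 + x = x" "- x + x = 0" "x - y = x + - y"
    by (transfer; simp add: fun_eq_iff)+
  show "r *\<^sub>R (x + y) = r *\<^sub>R x + r *\<^sub>R y" "(r + s) *\<^sub>R x = r *\<^sub>R x + s *\<^sub>R x"
    "r *\<^sub>R s *\<^sub>R x = (r * s) *\<^sub>R x" "1 *\<^sub>R x = x"
    by (transfer; simp add: scaleR_add_right scaleR_add_left)+
  show "sgn x = inverse (norm x) *\<^sub>R x" by (rule sgn_ell2_def)
  show "dist x y = norm (x - y)" by (rule dist_ell2_def)
  show "uniformity = (INF e\<in>{0 <..}. principal {(x, y::('a, 'b) ell2). dist x y < e})"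
    by (rule uniformity_ell2_def)
  show "open U = (\<forall>x\<in>U. \<forall>\<^sub>F (x', y) in uniformity. x' = x \<longrightarrow> y \<in> U)"
    for U :: "('a, 'b) ell2 set"
    by (rule open_ell2_def)
  show "inner x y = inner y x" by transfer (simp add: inner_commute)
  show "inner (x + y) z = inner x z + inner y z"
    by transfer (simp add: inner_add_left infsum_add summable_inner)
  show "inner (r *\<^sub>R x) y = r * inner x y"
    by transfer (simp add: infsum_cmult_right')
  show "0 \<le> inner x x" by transfer (simp add: infsum_nonneg)
  show "inner x x = 0 \<longleftrightarrow> x = 0"
  proof
    assume "inner x x = 0"
    then show "x = 0"
    proof transfer
      fix f :: "'a \<Rightarrow> 'b"
      assume f: "(\<lambda>i. (norm (f i))\<^sup>2) summable_on UNIV" and z: "(\<Sum>\<^sub>\<infinity>i. inner (f i) (f i)) = 0"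
      have "inner (f i) (f i) = 0" for i
        by (rule nonneg_infsum_le_0D[of "\<lambda>i. inner (f i) (f i)" UNIV])
           (use z summable_inner[OF f f] in auto)
      then show "f = (\<lambda>_. 0)" by auto
    qed
  qed (transfer, simp)
  show "norm x = sqrt (inner x x)" by (rule norm_ell2_def)
  show "a *\<^sub>C (x + y) = a *\<^sub>C x + a *\<^sub>C y" "(a + b) *\<^sub>C x = a *\<^sub>C x + b *\<^sub>C x"
    "a *\<^sub>C (b *\<^sub>C x) = (a * b) *\<^sub>C x"
    by (transfer; simp add: scaleC_add_right scaleC_add_left scaleC_scaleC)+
  show "complex_of_real r *\<^sub>C x = r *\<^sub>R x"
    by transfer (simp add: scaleC_of_real)
  show "cinner x y = cnj (cinner y x)"
    by transfer (simp add: infsum_cnj[symmetric] cinner_commute[symmetric] del: infsum_cnj)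
  show "cinner (x + y) z = cinner x z + cinner y z"
    by transfer (simp add: cinner_add_left infsum_add summable_cinner)
  show "cinner (a *\<^sub>C x) y = cnj a * cinner x y"
    by transfer (simp add: cinner_scaleC_left infsum_cmult_right')
  show "Re (cinner x y) = inner x y"
    by transfer (simp add: infsum_Re[OF summable_cinner, symmetric] Re_cinner)
qed

end

lemma norm_ell2_sq: "(norm x)\<^sup>2 = (\<Sum>\<^sub>\<infinity>i. (norm (ell2_nth x i))\<^sup>2)"
  by (simp add: power2_norm_eq_inner inner_ell2.rep_eq)

lemma sum_norm_ell2_le: "finite F \<Longrightarrow> (\<Sum>i\<in>F. (norm (ell2_nth x i))\<^sup>2) \<le> (norm x)\<^sup>2"
  unfolding norm_ell2_sq using ell2_nth[of x] by (intro finite_sum_le_infsum) auto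

lemma norm_ell2_nth_le: "norm (ell2_nth x i) \<le> norm x"
  using sum_norm_ell2_le[of "{i}" x] by (simp add: power2_le_iff_abs_le)

instance ell2 :: (type, complex_hilbert) complex_hilbert
proof
  fix X :: "nat \<Rightarrow> ('a, 'b) ell2"
  assume X: "Cauchy X"
  have "Cauchy (\<lambda>n. ell2_nth (X n) i)" for i
  proof (rule metric_CauchyI)
    fix e :: real assume "0 < e"
    then obtain N where N: "\<And>m n. m \<ge> N \<Longrightarrow> n \<ge> N \<Longrightarrow> dist (X m) (X n) < e"
      using metric_CauchyD[OF X] by metis
    have "dist (ell2_nth (X m) i) (ell2_nth (X n) i) \<le> dist (X m) (X n)" for m n
      using norm_ell2_nth_le[of "X m - X n" i] by (simp add: dist_norm minus_ell2.rep_eq)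
    then show "\<exists>N. \<forall>m\<ge>N. \<forall>n\<ge>N. dist (ell2_nth (X m) i) (ell2_nth (X n) i) < e"
      using N by (meson le_less_trans)
  qed
  then have "\<exists>l. (\<lambda>n. ell2_nth (X n) i) \<longlonglongrightarrow> l" for i
    using Cauchy_convergent convergent_def by blast
  then obtain g where g: "\<And>i. (\<lambda>n. ell2_nth (X n) i) \<longlonglongrightarrow> g i"
    by metis
  have bound: "\<exists>N. \<forall>m\<ge>N. \<forall>F. finite F \<longrightarrow> (\<Sum>i\<in>F. (norm (ell2_nth (X m) i - g i))\<^sup>2) \<le> e\<^sup>2"
    if e: "0 < e" for e :: real
  proof -
    obtain N where N: "\<And>m n. m \<ge> N \<Longrightarrow> n \<ge> N \<Longrightarrow> dist (X m) (X n) < e"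
      using metric_CauchyD[OF X e] by metis
    have "(\<Sum>i\<in>F. (norm (ell2_nth (X m) i - g i))\<^sup>2) \<le> e\<^sup>2" if "m \<ge> N" "finite F" for m F
    proof (rule tendsto_upperbound)
      show "(\<lambda>n. \<Sum>i\<in>F. (norm (ell2_nth (X m) i - ell2_nth (X n) i))\<^sup>2) \<longlonglongrightarrow>
          (\<Sum>i\<in>F. (norm (ell2_nth (X m) i - g i))\<^sup>2)"
        by (intro tendsto_intros g)
      have "(\<Sum>i\<in>F. (norm (ell2_nth (X m) i - ell2_nth (X n) i))\<^sup>2) \<le> e\<^sup>2" if "n \<ge> N" for n
      proof -
        have "(\<Sum>i\<in>F. (norm (ell2_nth (X m) i - ell2_nth (X n) i))\<^sup>2) \<le> (norm (X m - X n))\<^sup>2"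
          using sum_norm_ell2_le[OF \<open>finite F\<close>, of "X m - X n"] by (simp add: minus_ell2.rep_eq)
        also have "\<dots> \<le> e\<^sup>2"
          using N[OF \<open>m \<ge> N\<close> that] by (intro power_mono) (auto simp: dist_norm)
        finally show ?thesis .
      qed
      then show "\<forall>\<^sub>F n in sequentially.
          (\<Sum>i\<in>F. (norm (ell2_nth (X m) i - ell2_nth (X n) i))\<^sup>2) \<le> e\<^sup>2"
        using eventually_sequentially by auto
    qed simp
    then show ?thesis by auto
  qed
  have sm: "(\<lambda>i. (norm (ell2_nth (X m) i - g i))\<^sup>2) summable_on UNIV"
    if "\<forall>F. finite F \<longrightarrow> (\<Sum>i\<in>F. (norm (ell2_nth (X m) i - g i))\<^sup>2) \<le> e\<^sup>2" for m and e :: real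
    by (rule nonneg_bdd_above_summable_on) (use that in \<open>auto intro!: bdd_aboveI2\<close>)
  obtain N where N: "\<forall>F. finite F \<longrightarrow> (\<Sum>i\<in>F. (norm (ell2_nth (X N) i - g i))\<^sup>2) \<le> 1\<^sup>2"
    using bound[of 1] by auto
  have gs: "(\<lambda>i. (norm (g i))\<^sup>2) summable_on UNIV"
    using summable_sq_add[OF sm[OF N], of "\<lambda>i. - ell2_nth (X N) i"] ell2_nth[of "X N"] by simp
  define G where "G = Abs_ell2 g"
  have G: "ell2_nth G = g"
    unfolding G_def using gs by (intro Abs_ell2_inverse) simp
  have "X \<longlonglongrightarrow> G"
  proof (rule metric_LIMSEQ_I)
    fix e :: real assume e: "0 < e"
    obtain N where N: "\<And>m F. m \<ge> N \<Longrightarrow> finite F \<Longrightarrow>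
        (\<Sum>i\<in>F. (norm (ell2_nth (X m) i - g i))\<^sup>2) \<le> (e/2)\<^sup>2"
      using bound[of "e/2"] e by auto
    have "dist (X m) G < e" if "m \<ge> N" for m
    proof -
      have "(norm (X m - G))\<^sup>2 \<le> (e/2)\<^sup>2"
        unfolding norm_ell2_sq minus_ell2.rep_eq G
        by (rule infsum_le_finite_sums[OF sm[of m "e/2"]]) (use N that in auto)
      then have "norm (X m - G) \<le> e/2"
        using e by (simp add: power2_le_iff_abs_le)
      then show ?thesis using e by (simp add: dist_norm)
    qed
    then show "\<exists>no. \<forall>n\<ge>no. dist (X n) G < e" by blast
  qed
  then show "convergent X" by (auto simp: convergent_def)
qed


section \<open>Operators between Hilbert spaces\<close>

text \<open>
  Since the dilation space depends on the given operators, a Hilbert space is represented by a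
  closed complex subspace of a type of class \<open>complex_hilbert\<close>.
\<close>

definition hilbert_space :: "'a::complex_hilbert set \<Rightarrow> bool" where
  "hilbert_space M \<longleftrightarrow> complex_vector.subspace M \<and> closed M"

text \<open>
  Operators are extensional functions, so that equality of functions is equality of operators.
  Composition is \<^const>\<open>compose\<close>, whose first argument is the domain.
\<close>

definition operators :: "'a::complex_hilbert set \<Rightarrow> 'b::complex_hilbert set \<Rightarrow> ('a \<Rightarrow> 'b) set" where
  "operators M N = {A \<in> M \<rightarrow>\<^sub>E N.
     (\<forall>x\<in>M. \<forall>y\<in>M. A (x + y) = A x + A y) \<and>
     (\<forall>c. \<forall>x\<in>M. A (c *\<^sub>C x) = c *\<^sub>C A x) \<and>
     (\<exists>C. \<forall>x\<in>M. norm (A x) \<le> C * norm x)}"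

definition id_op :: "'a set \<Rightarrow> 'a \<Rightarrow> 'a" where
  "id_op M = (\<lambda>x\<in>M. x)"

definition zero_op :: "'a set \<Rightarrow> 'a \<Rightarrow> 'b::zero" where
  "zero_op M = (\<lambda>x\<in>M. 0)"

text \<open>The adjoint in \<open>operators N M\<close> of \<open>A \<in> operators M N\<close>; the element described exists
  and is unique by the Riesz representation theorem.\<close>

definition adjoint_op ::
    "'a::complex_hilbert set \<Rightarrow> 'b::complex_hilbert set \<Rightarrow> ('a \<Rightarrow> 'b) \<Rightarrow> 'b \<Rightarrow> 'a" where
  "adjoint_op M N A = (\<lambda>y\<in>N. THE z. z \<in> M \<and> (\<forall>x\<in>M. cinner (A x) y = cinner x z))"

text \<open>\<open>star_left M A\<close> is \<open>A\<^sup>* A\<close> and \<open>star_right M A\<close> is \<open>A A\<^sup>*\<close>.\<close>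

definition star_left :: "'a::complex_hilbert set \<Rightarrow> ('a \<Rightarrow> 'a) \<Rightarrow> 'a \<Rightarrow> 'a" where
  "star_left M A = compose M (adjoint_op M M A) A"

definition star_right :: "'a::complex_hilbert set \<Rightarrow> ('a \<Rightarrow> 'a) \<Rightarrow> 'a \<Rightarrow> 'a" where
  "star_right M A = compose M A (adjoint_op M M A)"

definition op_le :: "'a::complex_hilbert set \<Rightarrow> ('a \<Rightarrow> 'a) \<Rightarrow> ('a \<Rightarrow> 'a) \<Rightarrow> bool" where
  "op_le M A B \<longleftrightarrow> (\<forall>x\<in>M. cinner x (B x - A x) \<in> \<real>\<^sub>\<ge>\<^sub>0)"

text \<open>Convergence in the strong operator topology. All sums below have positive terms, so
  unconditional convergence agrees with convergence of the sequence of partial sums.\<close>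

definition sot_sum :: "'a::complex_hilbert set \<Rightarrow> ('i \<Rightarrow> 'a \<Rightarrow> 'a) \<Rightarrow> 'i set \<Rightarrow> ('a \<Rightarrow> 'a) \<Rightarrow> bool" where
  "sot_sum M F I A \<longleftrightarrow> A \<in> operators M M \<and> (\<forall>x\<in>M. ((\<lambda>i. F i x) has_sum A x) I)"

definition projection :: "'a::complex_hilbert set \<Rightarrow> ('a \<Rightarrow> 'a) \<Rightarrow> bool" where
  "projection M P \<longleftrightarrow> P \<in> operators M M \<and> compose M P P = P \<and> adjoint_op M M P = P"

definition isometric_embedding ::
    "'a::complex_hilbert set \<Rightarrow> 'b::complex_hilbert set \<Rightarrow> ('a \<Rightarrow> 'b) \<Rightarrow> bool" where
  "isometric_embedding M N V \<longleftrightarrow>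
     V \<in> operators M N \<and> (\<forall>x\<in>M. \<forall>y\<in>M. cinner (V x) (V y) = cinner x y)"

definition unitary_op ::
    "'a::complex_hilbert set \<Rightarrow> 'b::complex_hilbert set \<Rightarrow> ('a \<Rightarrow> 'b) \<Rightarrow> bool" where
  "unitary_op M N U \<longleftrightarrow> U \<in> operators M N \<and>
     compose M (adjoint_op M N U) U = id_op M \<and> compose N U (adjoint_op M N U) = id_op N"

definition orthocomplement_in :: "'a::complex_hilbert set \<Rightarrow> 'a set \<Rightarrow> 'a set" where
  "orthocomplement_in M L = {x\<in>M. \<forall>y\<in>L. cinner y x = 0}"

definition reduces :: "'a::complex_hilbert set \<Rightarrow> 'a set \<Rightarrow> ('a \<Rightarrow> 'a) \<Rightarrow> bool" where
  "reduces M L A \<longleftrightarrow> A ` L \<subseteq> L \<and> A ` orthocomplement_in M L \<subseteq> orthocomplement_in M L"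


section \<open>Stabilizing families and partially isometric dilations\<close>

definition tuple_index :: "enat \<Rightarrow> nat set" where
  "tuple_index n = {i. 1 \<le> i \<and> enat i \<le> n}"

definition operator_tuple :: "enat \<Rightarrow> 'a::complex_hilbert set \<Rightarrow> (nat \<Rightarrow> 'a \<Rightarrow> 'a) \<Rightarrow> bool" where
  "operator_tuple n M T \<longleftrightarrow> (\<forall>i\<in>tuple_index n. T i \<in> operators M M \<and> T i \<noteq> zero_op M)"

definition row_contraction :: "enat \<Rightarrow> 'a::complex_hilbert set \<Rightarrow> (nat \<Rightarrow> 'a \<Rightarrow> 'a) \<Rightarrow> bool" where
  "row_contraction n M T \<longleftrightarrow>
     (\<exists>A. sot_sum M (\<lambda>i. star_right M (T i)) (tuple_index n) A \<and> op_le M A (id_op M))"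

definition stabilizes ::
    "enat \<Rightarrow> 'a::complex_hilbert set \<Rightarrow> (nat \<Rightarrow> 'a \<Rightarrow> 'a) \<Rightarrow> 'k set \<Rightarrow> ('k \<Rightarrow> 'a \<Rightarrow> 'a) \<Rightarrow> bool" where
  "stabilizes n H T J P \<longleftrightarrow>
     countable J \<and> (\<forall>k\<in>J. projection H (P k)) \<and>
     (\<forall>k\<in>J. \<forall>i\<in>tuple_index n.
        compose H (P k) (T i) \<in> {T i, zero_op H} \<and> compose H (T i) (P k) \<in> {T i, zero_op H}) \<and>
     sot_sum H P J (id_op H)"

definition dagger_relations :: "enat \<Rightarrow> 'a::complex_hilbert set \<Rightarrow> (nat \<Rightarrow> 'a \<Rightarrow> 'a) \<Rightarrow> bool" where
  "dagger_relations n K S \<longleftrightarrow>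
     operator_tuple n K S \<and>
     (\<forall>i\<in>tuple_index n. compose K (star_left K (S i)) (star_left K (S i)) = star_left K (S i)) \<and>
     row_contraction n K S \<and>
     (\<forall>i\<in>tuple_index n. \<forall>j\<in>tuple_index n.
        compose K (star_left K (S i)) (star_left K (S j)) = zero_op K \<or>
        star_left K (S i) = star_left K (S j)) \<and>
     (\<forall>i\<in>tuple_index n. \<exists>j\<in>tuple_index n. op_le K (star_right K (S i)) (star_left K (S j))) \<and>
     sot_sum K (\<lambda>Q. Q) ((\<lambda>i. star_left K (S i)) ` tuple_index n) (id_op K)"

text \<open>
  \<open>H\<close> is regarded as a subspace of \<open>K\<close> via the isometric embedding \<open>V\<close>. For a word
  \<open>w = [i\<^sub>1, \<dots>, i\<^sub>k]\<close>, \<open>foldr S w x\<close> is \<open>S\<^bsub>i\<^sub>1\<^esub> (\<dots> (S\<^bsub>i\<^sub>k\<^esub> x))\<close>.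
\<close>

definition minimal_pi_dilation ::
    "enat \<Rightarrow> 'a::complex_hilbert set \<Rightarrow> (nat \<Rightarrow> 'a \<Rightarrow> 'a) \<Rightarrow>
     'b::complex_hilbert set \<Rightarrow> ('a \<Rightarrow> 'b) \<Rightarrow> (nat \<Rightarrow> 'b \<Rightarrow> 'b) \<Rightarrow> bool" where
  "minimal_pi_dilation n H T K V S \<longleftrightarrow>
     hilbert_space K \<and> isometric_embedding H K V \<and>
     dagger_relations n K S \<and>
     (\<forall>i\<in>tuple_index n.
        reduces K (V ` H) (star_left K (S i)) \<and>
        adjoint_op K K (S i) ` V ` H \<subseteq> V ` H \<and>
        (\<forall>h\<in>H. adjoint_op K K (S i) (V h) = V (adjoint_op H H (T i) h))) \<and>
     K = closure (complex_vector.span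
           (V ` H \<union> {foldr S w (V h) | w h. w \<noteq> [] \<and> set w \<subseteq> tuple_index n \<and> h \<in> H}))"

text \<open>
  \<open>\<P> = {S\<^sub>i\<^sup>* S\<^sub>i|\<^sub>H}\<close>, as an equality of sets of operators from \<open>H\<close> to \<open>K\<close>.
\<close>

definition induces_family ::
    "enat \<Rightarrow> 'a::complex_hilbert set \<Rightarrow> 'k set \<Rightarrow> ('k \<Rightarrow> 'a \<Rightarrow> 'a) \<Rightarrow>
     'b::complex_hilbert set \<Rightarrow> ('a \<Rightarrow> 'b) \<Rightarrow> (nat \<Rightarrow> 'b \<Rightarrow> 'b) \<Rightarrow> bool" where
  "induces_family n H J P K V S \<longleftrightarrow>
     (\<lambda>k. compose H V (P k)) ` J = (\<lambda>i. compose H (star_left K (S i)) V) ` tuple_index n"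

end

theory Submission
  imports Defs
begin

text \<open>
  \<^emph>\<open>The combinatorics.\<close> The projections \<open>P\<^sub>k\<close> are mutually orthogonal and add up to the
  identity, so each \<open>T\<^sub>i\<close> lives on a single pair of them: \<open>T\<^sub>i = T\<^sub>i P\<^sub>k\<close> for exactly one
  \<open>k = src i\<close>, and \<open>T\<^sub>i = P\<^sub>k T\<^sub>i\<close> for exactly one \<open>k = tgt i\<close>. Every \<open>k\<close> is a source. In this
  way the family is the vertex set of a directed graph whose edges are the indices \<open>i\<close>.

  \<^emph>\<open>Uniqueness.\<close> In every minimal dilation \<open>S\<close> that induces the family, with
  \<open>Q\<^sub>i = S\<^sub>i\<^sup>* S\<^sub>i\<close>, one has
  \<open>S\<^sub>i\<^sup>* V h = V T\<^sub>i\<^sup>* h\<close>, \<open>Q\<^sub>i V h = V P\<^bsub>src i\<^esub> h\<close>, \<open>S\<^sub>i\<^sup>* S\<^sub>j = 0\<close> for \<open>i \<noteq> j\<close>, and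
  \<open>Q\<^sub>i S\<^sub>j\<close> is \<open>S\<^sub>j\<close> or \<open>0\<close> according to whether \<open>tgt j = src i\<close> (\<open>Sadj_V\<close>, \<open>Q_V\<close>,
  \<open>Sadj_S_distinct\<close>, \<open>Q_S\<close>). These relations evaluate all the inner products
  \<open>\<langle>S\<^sub>w V g, S\<^sub>v V h\<rangle>\<close> of words in terms of \<open>T\<close> and the graph alone (\<open>gram_unique\<close>). By minimality
  the words span the dilation space, and two spanning families with the same Gram matrix are
  related by a unitary (\<open>unitary_of_equal_gram\<close>). It intertwines the two dilations because
  \<open>S\<^sub>i\<close> maps words to words.

  \<^emph>\<open>Existence.\<close> Conversely, operators on any Hilbert space that satisfy these relations yield a
  minimal dilation on the closed span of the words (\<open>dilation_of_relations\<close>). They are produced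
  by a construction of Schaeffer type. The matrix with entries
  \<open>\<delta>\<^sub>i\<^sub>j P\<^bsub>src i\<^esub> - T\<^sub>i\<^sup>* T\<^sub>j\<close>, acting on the direct sum of copies of \<open>H\<close>, is positive since \<open>T\<close> is a
  row contraction supported on the projections \<open>P\<^bsub>src i\<^esub>\<close>. Its square root \<open>D\<close> is the defect
  operator, and \<open>h \<mapsto> T\<^sub>i h \<oplus> D (\<delta>\<^sub>i \<otimes> h)\<close> is a partial isometry with initial projection
  \<open>P\<^bsub>src i\<^esub>\<close>; the ranges for different \<open>i\<close> are orthogonal. Defect vectors are then moved by
  shifts along the paths of the graph. This is consistent with the
  vertices because the entry \<open>(i, j)\<close> vanishes unless \<open>tgt i = tgt j\<close>, so that \<open>D\<close> commutes with
  the projection onto the coordinates of a given target (\<open>defect_exists\<close>, \<open>dilation_exists\<close>).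

  The tools from operator theory that this takes are proved first: the Riesz theorem and adjoints,
  square roots of positive operators, and sums of orthogonal projections.
\<close>

section \<open>Complex inner products and closed subspaces\<close>

lemma cinner_add_right: "cinner x (y + z) = cinner x y + cinner x (z::'a::complex_inner)"
  by (metis cinner_add_left cinner_commute complex_cnj_add)

lemma cinner_scaleC_right: "cinner x (a *\<^sub>C y) = a * cinner x (y::'a::complex_inner)"
  by (metis cinner_commute cinner_scaleC_left complex_cnj_cnj complex_cnj_mult)

lemma cinner_zero_left [simp]: "cinner 0 (x::'a::complex_inner) = 0"
  using cinner_add_left[of 0 0 x] by simp

lemma cinner_zero_right [simp]: "cinner (x::'a::complex_inner) 0 = 0"
  using cinner_add_right[of x 0 0] by simp

lemma cinner_minus_left [simp]: "cinner (- x) (y::'a::complex_inner) = - cinner x y"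
  using cinner_add_left[of x "- x" y] by (simp add: add_eq_0_iff)

lemma cinner_minus_right [simp]: "cinner (x::'a::complex_inner) (- y) = - cinner x y"
  using cinner_add_right[of x y "- y"] by (simp add: add_eq_0_iff)

lemma cinner_diff_left: "cinner (x - y) (z::'a::complex_inner) = cinner x z - cinner y z"
  using cinner_add_left[of x "- y" z] by simp

lemma cinner_diff_right: "cinner (x::'a::complex_inner) (y - z) = cinner x y - cinner x z"
  using cinner_add_right[of x y "- z"] by simp

lemma cinner_self_eq_zero: "cinner x x = 0 \<longleftrightarrow> x = (0::'a::complex_inner)"
  by (simp add: cinner_self)

lemma scaleC_minus_one: "(-1) *\<^sub>C x = - (x::'a::complex_inner)"
  using scaleC_of_real[of "-1" x] by simp

lemma cinner_eqI:
  assumes "\<And>x. cinner x y = cinner x (z::'a::complex_inner)"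
  shows "y = z"
  using assms[of "y - z"] cinner_self_eq_zero[of "y - z"] by (simp add: cinner_diff_right)

lemma cinner_eq_Complex: "cinner x y = Complex (inner x y) (inner (\<i> *\<^sub>C x) (y::'a::complex_inner))"
  by (simp add: complex_eq_iff Re_cinner Im_cinner)

lemma bounded_linear_scaleC: "bounded_linear (\<lambda>x::'a::complex_inner. c *\<^sub>C x)"
proof (rule bounded_linear_intro[where K = "cmod c"])
  show "c *\<^sub>C (r *\<^sub>R x) = r *\<^sub>R (c *\<^sub>C x)" for r and x :: 'a
    by (simp add: scaleC_of_real[symmetric] scaleC_scaleC mult.commute)
qed (simp_all add: scaleC_add_right norm_scaleC mult.commute)

lemma bounded_linear_cinner_right: "bounded_linear (cinner (x::'a::complex_inner))"
proof -
  have "bounded_linear (\<lambda>y. inner x y *\<^sub>R 1 + inner (\<i> *\<^sub>C x) y *\<^sub>R \<i>)"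
    by (intro bounded_linear_add bounded_linear_compose[OF bounded_linear_scaleR_left]
        bounded_linear_inner_right)
  moreover have "(\<lambda>y. inner x y *\<^sub>R 1 + inner (\<i> *\<^sub>C x) y *\<^sub>R \<i>) = cinner x"
    by (simp add: fun_eq_iff cinner_eq_Complex complex_eq_iff)
  ultimately show ?thesis by simp
qed

instance complex_hilbert \<subseteq> banach ..

lemma complex_subspace_imp_subspace: "complex_vector.subspace M \<Longrightarrow> subspace (M::'a::complex_inner set)"
  unfolding subspace_def complex_vector.subspace_def by (metis scaleC_of_real)

lemma complex_subspace_diff:
  "complex_vector.subspace M \<Longrightarrow> x \<in> M \<Longrightarrow> y \<in> M \<Longrightarrow> x - y \<in> (M::'a::complex_inner set)"
  using subspace_diff[OF complex_subspace_imp_subspace] .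

lemma hilbert_spaceD:
  assumes "hilbert_space M"
  shows "0 \<in> M" "\<And>x y. x \<in> M \<Longrightarrow> y \<in> M \<Longrightarrow> x + y \<in> M" "\<And>x y. x \<in> M \<Longrightarrow> y \<in> M \<Longrightarrow> x - y \<in> M"
    "\<And>c x. x \<in> M \<Longrightarrow> c *\<^sub>C x \<in> M" "closed M" "complex_vector.subspace M" "subspace M"
  using assms complex_subspace_diff complex_subspace_imp_subspace
  unfolding hilbert_space_def complex_vector.subspace_def by metis+

lemma hilbert_space_UNIV: "hilbert_space UNIV"
  by (simp add: hilbert_space_def)

lemma hilbert_space_zero: "hilbert_space {0}"
  by (simp add: hilbert_space_def)

lemma hilbert_space_orth: "hilbert_space {x. cinner y x = 0}"
proof -
  have "closed {x. cinner y x = 0}"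
    by (intro closed_Collect_eq linear_continuous_on bounded_linear_cinner_right continuous_on_const)
  then show ?thesis
    by (simp add: hilbert_space_def complex_vector.subspace_def cinner_add_right cinner_scaleC_right)
qed

lemma hilbert_space_closed_span: "hilbert_space (closure (complex_vector.span B))"
proof -
  let ?C = "closure (complex_vector.span B)"
  have "0 \<in> ?C"
    using closure_subset complex_vector.span_zero by blast
  moreover have "x + y \<in> ?C" if xy: "x \<in> ?C" "y \<in> ?C" for x y
  proof -
    obtain f g where "\<forall>n. f n \<in> complex_vector.span B" "f \<longlonglongrightarrow> x"
      "\<forall>n. g n \<in> complex_vector.span B" "g \<longlonglongrightarrow> y"
      using xy unfolding closure_sequential by blast
    then show ?thesis
      unfolding closure_sequential
      by (intro exI[of _ "\<lambda>n. f n + g n"]) (auto intro: tendsto_add complex_vector.span_add)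
  qed
  moreover have "c *\<^sub>C x \<in> ?C" if x: "x \<in> ?C" for c x
  proof -
    obtain f where "\<forall>n. f n \<in> complex_vector.span B" "f \<longlonglongrightarrow> x"
      using x unfolding closure_sequential by blast
    then show ?thesis
      unfolding closure_sequential
      by (intro exI[of _ "\<lambda>n. c *\<^sub>C f n"])
         (auto intro: bounded_linear.tendsto[OF bounded_linear_scaleC] complex_vector.span_scale)
  qed
  ultimately show ?thesis
    unfolding hilbert_space_def complex_vector.subspace_def by auto
qed

lemma closed_span_minimal:
  assumes "B \<subseteq> M" "hilbert_space M"
  shows "closure (complex_vector.span B) \<subseteq> M"
  using assms hilbert_spaceD(5,6) closure_minimal complex_vector.span_minimal by metis

lemma subset_closed_span: "B \<subseteq> closure (complex_vector.span B)"
  using closure_subset complex_vector.span_superset by blast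

section \<open>The Riesz representation theorem and adjoints\<close>

text \<open>
  The representing vector is the minimizer over \<open>M\<close> of the quadratic functional
  \<open>\<parallel>x\<parallel>\<^sup>2 - 2 f x\<close>: by the parallelogram law a minimizing sequence is Cauchy, and
  the vanishing of the first variation at the minimizer says that it represents \<open>f\<close>.
\<close>

lemma riesz_representation_real:
  fixes M :: "'a::{real_inner, banach} set" and f :: "'a \<Rightarrow> real"
  assumes M: "subspace M" "closed M"
    and add: "\<And>x y. x \<in> M \<Longrightarrow> y \<in> M \<Longrightarrow> f (x + y) = f x + f y"
    and scale: "\<And>r x. x \<in> M \<Longrightarrow> f (r *\<^sub>R x) = r * f x"
    and bound: "\<And>x. x \<in> M \<Longrightarrow> \<bar>f x\<bar> \<le> C * norm x"
  obtains z where "z \<in> M" "\<And>x. x \<in> M \<Longrightarrow> f x = inner z x"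
proof -
  define q where "q x = (norm x)\<^sup>2 - 2 * f x" for x
  have lower: "- (C\<^sup>2) \<le> q x" if "x \<in> M" for x
  proof -
    have "0 \<le> (norm x - C)\<^sup>2" by simp
    then show ?thesis
      using bound[OF that] by (simp add: q_def power2_diff mult.commute)
  qed
  have "0 \<in> M" using M(1) subspace_0 by blast
  define m where "m = (INF x\<in>M. q x)"
  have bdd: "bdd_below (q ` M)"
    using lower by (intro bdd_belowI2[of _ "- (C\<^sup>2)"])
  have mle: "m \<le> q x" if "x \<in> M" for x
    unfolding m_def using bdd that by (rule cINF_lower)
  have "\<exists>x\<in>M. q x < m + 1 / Suc k" for k
    using cINF_less_iff[OF _ bdd, of "m + 1 / Suc k"] \<open>0 \<in> M\<close> unfolding m_def[symmetric] by auto
  then obtain X where X: "\<And>k. X k \<in> M" "\<And>k. q (X k) < m + 1 / Suc k"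
    by metis
  have par: "(norm (x - y))\<^sup>2 = 2 * q x + 2 * q y - 4 * q ((1/2) *\<^sub>R (x + y))"
    if "x \<in> M" "y \<in> M" for x y
  proof -
    have "(norm (x - y))\<^sup>2 = 2 * (norm x)\<^sup>2 + 2 * (norm y)\<^sup>2 - 4 * (norm ((1/2) *\<^sub>R (x + y)))\<^sup>2"
      by (simp add: power2_norm_eq_inner inner_add_left inner_add_right inner_diff_left
          inner_diff_right inner_commute[of y x] algebra_simps)
    moreover have "f ((1/2) *\<^sub>R (x + y)) = (f x + f y) / 2"
      using that M(1) by (simp add: scale subspace_add add)
    ultimately show ?thesis unfolding q_def by (simp add: algebra_simps)
  qed
  have close: "(norm (X k - X l))\<^sup>2 \<le> 2 / Suc k + 2 / Suc l" for k l
  proof -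
    have "(1/2) *\<^sub>R (X k + X l) \<in> M"
      using X(1) M(1) by (simp add: subspace_add subspace_scale)
    then have "m \<le> q ((1/2) *\<^sub>R (X k + X l))" by (rule mle)
    then show ?thesis
      using par[OF X(1) X(1), of k l] X(2)[of k] X(2)[of l] by simp
  qed
  have "Cauchy X"
  proof (rule metric_CauchyI)
    fix e :: real assume e: "0 < e"
    obtain N :: nat where N: "4 / e\<^sup>2 < real N" using reals_Archimedean2 by blast
    have "dist (X k) (X l) < e" if "k \<ge> N" "l \<ge> N" for k l
    proof -
      have *: "2 / Suc j < e\<^sup>2 / 2" if "j \<ge> N" for j
      proof -
        have "4 / e\<^sup>2 < Suc j" using N that by linarith
        then show ?thesis using e by (simp add: field_simps)
      qed
      have "(norm (X k - X l))\<^sup>2 < e\<^sup>2"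
        using close[of k l] *[OF that(1)] *[OF that(2)] by linarith
      then show ?thesis using e by (simp add: dist_norm power2_less_imp_less)
    qed
    then show "\<exists>N. \<forall>m\<ge>N. \<forall>n\<ge>N. dist (X m) (X n) < e" by blast
  qed
  then obtain z where z: "X \<longlonglongrightarrow> z" using Cauchy_convergent convergent_def by blast
  have zM: "z \<in> M" using closed_sequentially[OF M(2) _ z] X(1) by blast
  have fdiff: "f (x - y) = f x - f y" if "x \<in> M" "y \<in> M" for x y
    using add[of x "- y"] scale[of y "-1"] that M(1) by (simp add: subspace_neg)
  have "(\<lambda>k. f (X k) - f z) \<longlonglongrightarrow> 0"
  proof (rule Lim_null_comparison)
    show "\<forall>\<^sub>F k in sequentially. norm (f (X k) - f z) \<le> C * norm (X k - z)"
      using bound X(1) zM M(1) by (simp add: fdiff[symmetric] subspace_diff)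
    show "(\<lambda>k. C * norm (X k - z)) \<longlonglongrightarrow> 0"
      using tendsto_mult_right_zero[OF tendsto_norm_zero[OF LIM_zero[OF z]]] .
  qed
  then have "(\<lambda>k. f (X k)) \<longlonglongrightarrow> f z" by (rule LIM_zero_cancel)
  then have "(\<lambda>k. q (X k)) \<longlonglongrightarrow> q z"
    unfolding q_def by (intro tendsto_intros z)
  moreover have "(\<lambda>k. m + inverse (real (Suc k))) \<longlonglongrightarrow> m"
    using tendsto_add[OF tendsto_const LIMSEQ_inverse_real_of_nat] by simp
  moreover have "\<forall>k. q (X k) \<le> m + inverse (real (Suc k))"
    using X(2) by (simp add: inverse_eq_divide less_imp_le)
  ultimately have qz: "q z \<le> m"
    by (intro LIMSEQ_le) auto
  have "f x = inner z x" if x: "x \<in> M" for x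
  proof (rule ccontr)
    assume ne: "f x \<noteq> inner z x"
    define d where "d = f x - inner z x"
    have ineq: "0 \<le> t\<^sup>2 * (norm x)\<^sup>2 - 2 * t * d" for t
    proof -
      have "q z \<le> q (z + t *\<^sub>R x)"
        using qz mle[of "z + t *\<^sub>R x"] x zM M(1) by (simp add: subspace_add subspace_scale)
      also have "q (z + t *\<^sub>R x) = q z + t\<^sup>2 * (norm x)\<^sup>2 - 2 * t * d"
      proof -
        have "(norm (z + t *\<^sub>R x))\<^sup>2 = (norm z)\<^sup>2 + t\<^sup>2 * (norm x)\<^sup>2 + 2 * t * inner z x"
          unfolding power2_norm_eq_inner
          by (simp add: inner_add_left inner_add_right inner_commute[of x z] algebra_simps power2_eq_square)
        then show ?thesis
          unfolding q_def d_def using x zM M(1)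
          by (simp add: add scale subspace_scale algebra_simps)
      qed
      finally show ?thesis by simp
    qed
    have "d \<noteq> 0" using ne d_def by simp
    have xnz: "norm x \<noteq> 0"
    proof
      assume "norm x = 0"
      then show False using ineq[of d] \<open>d \<noteq> 0\<close> by (auto simp: mult_le_0_iff)
    qed
    have "0 \<le> (d / (norm x)\<^sup>2)\<^sup>2 * (norm x)\<^sup>2 - 2 * (d / (norm x)\<^sup>2) * d" by (rule ineq)
    also have "\<dots> = - (d\<^sup>2 / (norm x)\<^sup>2)"
      using xnz by (simp add: field_simps power2_eq_square)
    finally show False using \<open>d \<noteq> 0\<close> xnz by (simp add: divide_le_0_iff)
  qed
  with zM show ?thesis by (rule that)
qed

lemma operatorsD:
  assumes "A \<in> operators M N"
  shows "\<And>x. x \<in> M \<Longrightarrow> A x \<in> N" "\<And>x y. x \<in> M \<Longrightarrow> y \<in> M \<Longrightarrow> A (x + y) = A x + A y"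
    "\<And>c x. x \<in> M \<Longrightarrow> A (c *\<^sub>C x) = c *\<^sub>C A x" "A \<in> extensional M"
  using assms by (auto simp: operators_def PiE_iff)

lemma operators_bound:
  assumes "A \<in> operators M N"
  obtains C where "C \<ge> 0" "\<And>x. x \<in> M \<Longrightarrow> norm (A x) \<le> C * norm x"
proof -
  obtain C where C: "\<And>x. x \<in> M \<Longrightarrow> norm (A x) \<le> C * norm x"
    using assms unfolding operators_def by blast
  have "norm (A x) \<le> max C 0 * norm x" if "x \<in> M" for x
    using C[OF that] by (meson max.cobounded1 mult_right_mono norm_ge_zero order_trans)
  then show ?thesis using that[of "max C 0"] by simp
qed

lemma operators_diff:
  assumes "A \<in> operators M N" "hilbert_space M" "x \<in> M" "y \<in> M"
  shows "A (x - y) = A x - A y"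
proof -
  have "A (x + (-1) *\<^sub>C y) = A x + (-1) *\<^sub>C A y"
    using operatorsD(2,3)[OF assms(1)] hilbert_spaceD(4)[OF assms(2,4)] assms(3,4) by metis
  then show ?thesis by (simp add: scaleC_minus_one)
qed

lemma operators_zero: "A \<in> operators M N \<Longrightarrow> hilbert_space M \<Longrightarrow> A 0 = 0"
  using operators_diff[of A M N 0 0] hilbert_spaceD(1)[of M] by simp

lemma restrict_operator:
  assumes "\<And>x. x \<in> M \<Longrightarrow> A x \<in> N" "\<And>x y. A (x + y) = A x + A y" "\<And>c x. A (c *\<^sub>C x) = c *\<^sub>C A x"
    "\<And>x. norm (A x) \<le> C * norm x" "hilbert_space M"
  shows "restrict A M \<in> operators M N"
proof -
  have "\<exists>C. \<forall>x\<in>M. norm (restrict A M x) \<le> C * norm x"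
    using assms(4) by (intro exI[of _ C]) simp
  then show ?thesis
    using assms(1-3) hilbert_spaceD(2,4)[OF assms(5)] by (simp add: operators_def)
qed

lemma operator_sequential_continuous:
  assumes A: "A \<in> operators M N" and M: "hilbert_space M"
    and f: "\<And>n. f n \<in> M" "f \<longlonglongrightarrow> x" "x \<in> M"
  shows "(\<lambda>n. A (f n)) \<longlonglongrightarrow> A x"
proof -
  obtain C where C: "C \<ge> 0" "\<And>x. x \<in> M \<Longrightarrow> norm (A x) \<le> C * norm x"
    using operators_bound[OF A] by metis
  have "(\<lambda>n. A (f n) - A x) \<longlonglongrightarrow> 0"
  proof (rule Lim_null_comparison)
    show "\<forall>\<^sub>F n in sequentially. norm (A (f n) - A x) \<le> C * norm (f n - x)"
      using C(2)[OF hilbert_spaceD(3)[OF M f(1,3)]] by (simp add: operators_diff[OF A M f(1,3)])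
    show "(\<lambda>n. C * norm (f n - x)) \<longlonglongrightarrow> 0"
      using tendsto_mult_right_zero[OF tendsto_norm_zero[OF LIM_zero[OF f(2)]]] .
  qed
  then show ?thesis by (rule LIM_zero_cancel)
qed

text \<open>
  To show that an operator maps a closed span into a closed subspace it suffices, by this
  lemma and \<open>closed_span_minimal\<close>, to look at the spanning vectors.
\<close>

lemma hilbert_space_preimage:
  assumes A: "A \<in> operators M N" and M: "hilbert_space M" and L: "hilbert_space L"
  shows "hilbert_space {x \<in> M. A x \<in> L}"
proof -
  have "closed {x \<in> M. A x \<in> L}"
    unfolding closed_sequential_limits
  proof (intro allI impI, elim conjE)
    fix f l assume f: "\<forall>n. f n \<in> {x \<in> M. A x \<in> L}" and l: "f \<longlonglongrightarrow> l"
    have "l \<in> M" using closed_sequentially[OF hilbert_spaceD(5)[OF M] _ l] f by blast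
    moreover have "A l \<in> L"
      using closed_sequentially[OF hilbert_spaceD(5)[OF L]
          _ operator_sequential_continuous[OF A M _ l \<open>l \<in> M\<close>]] f by blast
    ultimately show "l \<in> {x \<in> M. A x \<in> L}" by blast
  qed
  then show ?thesis
    using hilbert_spaceD[OF M] hilbert_spaceD[OF L] operatorsD[OF A] operators_zero[OF A M]
    unfolding hilbert_space_def complex_vector.subspace_def by simp
qed

lemma compose_operator:
  assumes A: "A \<in> operators L M" and B: "B \<in> operators M N" and L: "hilbert_space L"
  shows "compose L B A \<in> operators L N"
proof -
  obtain C where C: "C \<ge> 0" "\<And>x. x \<in> L \<Longrightarrow> norm (A x) \<le> C * norm x"
    using operators_bound[OF A] by metis
  obtain C' where C': "C' \<ge> 0" "\<And>x. x \<in> M \<Longrightarrow> norm (B x) \<le> C' * norm x"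
    using operators_bound[OF B] by metis
  have "norm (B (A x)) \<le> (C' * C) * norm x" if x: "x \<in> L" for x
    using C'(2)[OF operatorsD(1)[OF A x]] mult_left_mono[OF C(2)[OF x] C'(1)]
    by (simp add: mult.assoc)
  then have "\<exists>C. \<forall>x\<in>L. norm (compose L B A x) \<le> C * norm x"
    by (intro exI[of _ "C' * C"]) (simp add: compose_eq)
  then show ?thesis
    using operatorsD(1-3)[OF A] operatorsD(1-3)[OF B] hilbert_spaceD(2,4)[OF L]
    by (simp add: operators_def compose_eq PiE_iff)
qed

text \<open>
  The Riesz theorem yields the real part of the required identity; the imaginary part is the
  real part at \<open>\<i> x\<close>.
\<close>

lemma adjoint_op_ex1:
  assumes A: "A \<in> operators M N" and M: "hilbert_space M"
  shows "\<exists>!z. z \<in> M \<and> (\<forall>x\<in>M. cinner (A x) y = cinner x z)"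
proof -
  obtain C where C: "C \<ge> 0" "\<And>x. x \<in> M \<Longrightarrow> norm (A x) \<le> C * norm x"
    using operators_bound[OF A] by metis
  obtain z where z: "z \<in> M" "\<And>x. x \<in> M \<Longrightarrow> inner (A x) y = inner z x"
  proof (rule riesz_representation_real[of M "\<lambda>x. inner (A x) y" "C * norm y"])
    show "subspace M" "closed M" using hilbert_spaceD[OF M] by auto
    show "inner (A (u + v)) y = inner (A u) y + inner (A v) y" if "u \<in> M" "v \<in> M" for u v
      using operatorsD(2)[OF A that] by (simp add: inner_add_left)
    show "inner (A (r *\<^sub>R u)) y = r * inner (A u) y" if "u \<in> M" for r u
      using operatorsD(3)[OF A that, of "complex_of_real r"] by (simp add: scaleC_of_real)
    show "\<bar>inner (A u) y\<bar> \<le> C * norm y * norm u" if "u \<in> M" for u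
    proof -
      have "\<bar>inner (A u) y\<bar> \<le> norm (A u) * norm y" by (rule Cauchy_Schwarz_ineq2)
      also have "\<dots> \<le> C * norm u * norm y" using C(2)[OF that] by (simp add: mult_right_mono)
      finally show ?thesis by (simp add: mult_ac)
    qed
  qed blast
  have "cinner (A x) y = cinner x z" if x: "x \<in> M" for x
  proof -
    have "inner (\<i> *\<^sub>C A x) y = inner z (\<i> *\<^sub>C x)"
      using z(2)[of "\<i> *\<^sub>C x"] hilbert_spaceD(4)[OF M x] operatorsD(3)[OF A x] by simp
    then show ?thesis
      using z(2)[OF x] by (simp add: cinner_eq_Complex inner_commute)
  qed
  moreover have "z' = z" if "z' \<in> M" "\<forall>x\<in>M. cinner (A x) y = cinner x z'" for z'
  proof -
    have "z' - z \<in> M" using hilbert_spaceD(3)[OF M that(1) z(1)] .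
    then have "cinner (z' - z) (z' - z) = 0"
      using that(2) calculation by (metis cinner_diff_right diff_self)
    then show ?thesis by (simp add: cinner_self_eq_zero)
  qed
  ultimately show ?thesis using z(1) by blast
qed

lemma adjoint_op_props:
  assumes "A \<in> operators M N" "hilbert_space M" "y \<in> N"
  shows "adjoint_op M N A y \<in> M" "x \<in> M \<Longrightarrow> cinner (A x) y = cinner x (adjoint_op M N A y)"
  using theI'[OF adjoint_op_ex1[OF assms(1,2), of y]] assms(3) by (auto simp: adjoint_op_def)

lemma adjoint_op_eqI:
  assumes "A \<in> operators M N" "hilbert_space M" "y \<in> N" "z \<in> M"
    "\<And>x. x \<in> M \<Longrightarrow> cinner (A x) y = cinner x z"
  shows "adjoint_op M N A y = z"
  using the1_equality[OF adjoint_op_ex1[OF assms(1,2), of y]] assms(3-5) by (simp add: adjoint_op_def)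

lemma adjoint_operator:
  assumes A: "A \<in> operators M N" and M: "hilbert_space M" and N: "hilbert_space N"
  shows "adjoint_op M N A \<in> operators N M"
proof -
  let ?B = "adjoint_op M N A"
  note B = adjoint_op_props[OF A M]
  obtain C where C: "C \<ge> 0" "\<And>x. x \<in> M \<Longrightarrow> norm (A x) \<le> C * norm x"
    using operators_bound[OF A] by metis
  have "?B (x + y) = ?B x + ?B y" if "x \<in> N" "y \<in> N" for x y
    using that B hilbert_spaceD[OF M] hilbert_spaceD[OF N]
    by (intro adjoint_op_eqI[OF A M]) (auto simp: cinner_add_right)
  moreover have "?B (c *\<^sub>C x) = c *\<^sub>C ?B x" if "x \<in> N" for c x
    using that B hilbert_spaceD[OF M] hilbert_spaceD[OF N]
    by (intro adjoint_op_eqI[OF A M]) (auto simp: cinner_scaleC_right)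
  moreover have "norm (?B y) \<le> C * norm y" if y: "y \<in> N" for y
  proof (cases "?B y = 0")
    case False
    have "norm (?B y) * norm (?B y) = inner (A (?B y)) y"
      using B[OF y] by (metis Re_cinner power2_eq_square power2_norm_eq_inner)
    also have "\<dots> \<le> norm (A (?B y)) * norm y" by (rule norm_cauchy_schwarz)
    also have "\<dots> \<le> (C * norm (?B y)) * norm y"
      using C(2) B(1)[OF y] by (intro mult_right_mono) auto
    finally show ?thesis using False by (simp add: mult_ac)
  qed (use C(1) in simp)
  then have "\<exists>C. \<forall>y\<in>N. norm (?B y) \<le> C * norm y" by blast
  moreover have "?B \<in> extensional N" by (simp add: adjoint_op_def)
  ultimately show ?thesis
    using B(1) by (simp add: operators_def PiE_iff)
qed

text \<open>The orthogonal projection onto a closed subspace is the adjoint of its inclusion.\<close>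

definition orth_proj :: "'a::complex_hilbert set \<Rightarrow> 'a \<Rightarrow> 'a" where
  "orth_proj M = adjoint_op M UNIV (id_op M)"

lemma id_op_operator: "hilbert_space M \<Longrightarrow> M \<subseteq> N \<Longrightarrow> id_op M \<in> operators M N"
  unfolding id_op_def by (rule restrict_operator[where C = 1]) auto

lemma orth_proj_props:
  assumes "hilbert_space M"
  shows "orth_proj M y \<in> M" "x \<in> M \<Longrightarrow> cinner x (orth_proj M y) = cinner x y"
proof -
  note * = adjoint_op_props[OF id_op_operator[OF assms subset_UNIV] assms UNIV_I[of y]]
  show "orth_proj M y \<in> M" using *(1) by (simp add: orth_proj_def)
  show "cinner x (orth_proj M y) = cinner x y" if "x \<in> M"
    using *(2)[OF that] that by (simp add: orth_proj_def id_op_def)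
qed

lemma orth_proj_ident: "hilbert_space M \<Longrightarrow> x \<in> M \<Longrightarrow> orth_proj M x = x"
  unfolding orth_proj_def
  by (rule adjoint_op_eqI[OF id_op_operator]) (auto simp: id_op_def)

text \<open>
  On a whole space, a pair of mutually adjoint functions is automatically a pair of linear maps.
\<close>

definition adjoint_pair :: "('a::complex_inner \<Rightarrow> 'b::complex_inner) \<Rightarrow> ('b \<Rightarrow> 'a) \<Rightarrow> bool" where
  "adjoint_pair A B \<longleftrightarrow> (\<forall>x y. cinner (A x) y = cinner x (B y))"

lemma adjoint_pairD: "adjoint_pair A B \<Longrightarrow> cinner (A x) y = cinner x (B y)"
  by (simp add: adjoint_pair_def)

lemma adjoint_pair_sym: "adjoint_pair A B \<Longrightarrow> adjoint_pair B A"
  unfolding adjoint_pair_def by (subst (1 2) cinner_commute) simp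

lemma adjoint_pair_add:
  assumes "adjoint_pair A B"
  shows "A (x + y) = A x + A y"
  by (rule cinner_eqI) (simp add: adjoint_pairD[OF adjoint_pair_sym[OF assms], symmetric] cinner_add_right)

lemma adjoint_pair_scaleC:
  assumes "adjoint_pair A B"
  shows "A (c *\<^sub>C x) = c *\<^sub>C A x"
  by (rule cinner_eqI) (simp add: adjoint_pairD[OF adjoint_pair_sym[OF assms], symmetric] cinner_scaleC_right)

lemma adjoint_pair_diff:
  assumes "adjoint_pair A B"
  shows "A (x - y) = A x - A y"
  by (rule cinner_eqI) (simp add: adjoint_pairD[OF adjoint_pair_sym[OF assms], symmetric] cinner_diff_right)

lemma adjoint_pair_zero: "adjoint_pair A B \<Longrightarrow> A 0 = 0"
  using adjoint_pair_diff[of A B 0 0] by simp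

lemma adjoint_pair_sum:
  assumes "adjoint_pair A B"
  shows "A (sum f F) = (\<Sum>i\<in>F. A (f i))"
  by (induction F rule: infinite_finite_induct)
     (simp_all add: adjoint_pair_zero[OF assms] adjoint_pair_add[OF assms])

lemma adjoint_pair_linear:
  assumes "adjoint_pair A B"
  shows "linear A"
proof (rule linearI)
  show "A (x + y) = A x + A y" for x y by (rule adjoint_pair_add[OF assms])
  show "A (r *\<^sub>R x) = r *\<^sub>R A x" for r x
    using adjoint_pair_scaleC[OF assms, of "complex_of_real r" x] by (simp add: scaleC_of_real)
qed

lemma adjoint_pair_bounded_linear:
  assumes "adjoint_pair A B" "\<And>x. norm (A x) \<le> C * norm x"
  shows "bounded_linear A"
  using adjoint_pair_linear[OF assms(1)] assms(2)
  by (intro bounded_linear_intro[where K = C]) (simp_all add: linear_add linear_scale mult.commute)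

lemma adjoint_pair_exists:
  fixes A :: "'a::complex_hilbert \<Rightarrow> 'b::complex_hilbert"
  assumes "\<And>x y. A (x + y) = A x + A y" "\<And>c x. A (c *\<^sub>C x) = c *\<^sub>C A x" "\<And>x. norm (A x) \<le> C * norm x"
  obtains B where "adjoint_pair A B"
proof -
  have "restrict A UNIV \<in> operators UNIV (UNIV :: 'b set)"
    by (rule restrict_operator[where C = C]) (use assms hilbert_space_UNIV in auto)
  then have "adjoint_pair A (adjoint_op UNIV UNIV (restrict A UNIV))"
    using adjoint_op_props(2)[OF _ hilbert_space_UNIV UNIV_I, of "restrict A UNIV"]
    by (simp add: adjoint_pair_def)
  then show ?thesis by (rule that)
qed

lemma adjoint_pair_compose:
  "adjoint_pair A B \<Longrightarrow> adjoint_pair C D \<Longrightarrow> adjoint_pair (\<lambda>x. A (C x)) (\<lambda>x. D (B x))"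
  by (simp add: adjoint_pair_def)

lemma adjoint_pair_plus:
  "adjoint_pair A B \<Longrightarrow> adjoint_pair C D \<Longrightarrow> adjoint_pair (\<lambda>x. A x + C x) (\<lambda>x. B x + D x)"
  by (simp add: adjoint_pair_def cinner_add_left cinner_add_right)

lemma adjoint_pair_minus:
  "adjoint_pair A B \<Longrightarrow> adjoint_pair C D \<Longrightarrow> adjoint_pair (\<lambda>x. A x - C x) (\<lambda>x. B x - D x)"
  by (simp add: adjoint_pair_def cinner_diff_left cinner_diff_right)

lemma adjoint_pair_orth_proj:
  assumes "hilbert_space M"
  shows "adjoint_pair (orth_proj M) (orth_proj M)"
proof -
  have "cinner (orth_proj M x) y = cinner x (orth_proj M y)" for x y
    using orth_proj_props(2)[OF assms orth_proj_props(1)[OF assms], of x y]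
      orth_proj_props(2)[OF assms orth_proj_props(1)[OF assms], of y x]
      cinner_commute[of x "orth_proj M y"] cinner_commute[of "orth_proj M x" "orth_proj M y"]
    by simp
  then show ?thesis by (simp add: adjoint_pair_def)
qed

definition extend_op :: "'a::complex_hilbert set \<Rightarrow> ('a \<Rightarrow> 'b) \<Rightarrow> 'a \<Rightarrow> 'b" where
  "extend_op M A x = A (orth_proj M x)"

lemma adjoint_pair_extend_op:
  assumes A: "A \<in> operators M M" and M: "hilbert_space M"
  shows "adjoint_pair (extend_op M A) (extend_op M (adjoint_op M M A))"
proof -
  note B = adjoint_op_props[OF A M] and p = orth_proj_props[OF M]
  have "cinner (A (orth_proj M x)) y = cinner x (adjoint_op M M A (orth_proj M y))" for x y
  proof -
    have "cinner (A (orth_proj M x)) y = cinner (A (orth_proj M x)) (orth_proj M y)"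
      using p(2)[OF operatorsD(1)[OF A p(1)]] by simp
    also have "\<dots> = cinner (orth_proj M x) (adjoint_op M M A (orth_proj M y))"
      using B(2)[OF p(1) p(1)] .
    also have "\<dots> = cinner x (adjoint_op M M A (orth_proj M y))"
      using p(2)[OF B(1)[OF p(1)]] by (subst (1 2) cinner_commute) simp
    finally show ?thesis .
  qed
  then show ?thesis by (simp add: adjoint_pair_def extend_op_def)
qed

lemma cinner_projection:
  assumes "adjoint_pair P P" "P (P x) = P x"
  shows "cinner x (P x) = complex_of_real ((norm (P x))\<^sup>2)"
  using assms(2) adjoint_pairD[OF assms(1), of x "P x"] by (simp add: cinner_self del: of_real_power)

text \<open>The Cauchy--Schwarz inequality is applied to \<open>\<parallel>P x\<parallel>\<^sup>2 = \<langle>x, P x\<rangle>\<close>.\<close>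

lemma norm_projection_le:
  assumes "adjoint_pair P P" "P (P x) = P x"
  shows "norm (P x) \<le> norm x"
proof (cases "P x = 0")
  case False
  have "(norm (P x))\<^sup>2 = inner x (P x)"
    using cinner_projection[OF assms] by (metis Re_cinner Re_complex_of_real)
  also have "\<dots> \<le> norm x * norm (P x)" by (rule norm_cauchy_schwarz)
  finally show ?thesis using False by (simp add: power2_eq_square)
qed simp

text \<open>An instance of the \<open>C\<^sup>*\<close>-identity \<open>\<parallel>A\<parallel>\<^sup>2 = \<parallel>A\<^sup>* A\<parallel>\<close>, for a single vector.\<close>

lemma norm_le_of_star:
  assumes "adjoint_pair A B" "norm (B (A x)) \<le> norm x"
  shows "norm (A x) \<le> norm x"
proof -
  have "(norm (A x))\<^sup>2 = inner x (B (A x))"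
    using adjoint_pairD[OF assms(1), of x "A x"] by (metis Re_cinner power2_norm_eq_inner)
  also have "\<dots> \<le> norm x * norm (B (A x))" by (rule norm_cauchy_schwarz)
  also have "\<dots> \<le> norm x * norm x" using assms(2) by (simp add: mult_left_mono)
  finally show ?thesis by (simp add: power2_eq_square[symmetric])
qed

lemma norm_adjoint_le:
  assumes "adjoint_pair A B" "\<And>x. norm (A x) \<le> norm x"
  shows "norm (B y) \<le> norm y"
proof (cases "B y = 0")
  case False
  have "norm (B y) * norm (B y) = inner (A (B y)) y"
    using adjoint_pairD[OF assms(1), of "B y" y] by (metis Re_cinner power2_eq_square power2_norm_eq_inner)
  also have "\<dots> \<le> norm (A (B y)) * norm y" by (rule norm_cauchy_schwarz)
  also have "\<dots> \<le> norm (B y) * norm y" using assms(2) by (simp add: mult_right_mono)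
  finally show ?thesis using False by simp
qed simp

section \<open>Square roots of positive operators\<close>

text \<open>
  If \<open>\<parallel>1 - G\<parallel> \<le> 1\<close>, the square root is \<open>1 - B\<close> with \<open>B = (A + B\<^sup>2) / 2\<close>
  and \<open>A = 1 - G\<close>. The iterates of this fixed-point equation from \<open>0\<close> are dominated in norm by
  the scalar iteration \<open>b = (1 + b\<^sup>2) / 2\<close>, which increases to \<open>1\<close>, so that they converge in norm.
  Every iterate is a polynomial in \<open>G\<close>; hence the limit commutes with everything \<open>G\<close> commutes with.
\<close>

primrec sqrt_iter :: "('a::real_normed_vector \<Rightarrow>\<^sub>L 'a) \<Rightarrow> nat \<Rightarrow> 'a \<Rightarrow>\<^sub>L 'a" where
  "sqrt_iter A 0 = 0"
| "sqrt_iter A (Suc k) = (1/2) *\<^sub>R (A + (sqrt_iter A k o\<^sub>L sqrt_iter A k))"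

primrec sqrt_iter_bound :: "nat \<Rightarrow> real" where
  "sqrt_iter_bound 0 = 0"
| "sqrt_iter_bound (Suc k) = (1 + (sqrt_iter_bound k)\<^sup>2) / 2"

lemma sqrt_iter_bound_bounds: "0 \<le> sqrt_iter_bound k" "sqrt_iter_bound k \<le> 1"
proof -
  have "0 \<le> sqrt_iter_bound k \<and> sqrt_iter_bound k \<le> 1"
    by (induction k) (auto simp: power_le_one)
  then show "0 \<le> sqrt_iter_bound k" "sqrt_iter_bound k \<le> 1" by auto
qed

lemma sqrt_iter_bound_mono: "sqrt_iter_bound k \<le> sqrt_iter_bound (Suc k)"
proof -
  have "0 \<le> (1 - sqrt_iter_bound k)\<^sup>2" by simp
  then show ?thesis by (simp add: power2_diff)
qed

lemma norm_sqrt_iter: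
  assumes "norm A \<le> 1"
  shows "norm (sqrt_iter A k) \<le> sqrt_iter_bound k"
proof (induction k)
  case (Suc k)
  have "norm (A + (sqrt_iter A k o\<^sub>L sqrt_iter A k)) \<le> 1 + (sqrt_iter_bound k)\<^sup>2"
    using assms norm_blinfun_compose[of "sqrt_iter A k" "sqrt_iter A k"]
      mult_mono[OF Suc Suc sqrt_iter_bound_bounds(1) norm_ge_zero] norm_triangle_ineq[of A "sqrt_iter A k o\<^sub>L sqrt_iter A k"]
    by (simp add: power2_eq_square)
  then show ?case by simp
qed simp

text \<open>
  The difference of two squares \<open>X\<^sup>2 - Y\<^sup>2\<close> is split as \<open>X (X - Y) + (X - Y) Y\<close>, which takes no
  commutativity, and the same splitting of scalars gives exactly the increment of the bound.
\<close>

lemma norm_sqrt_iter_step: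
  assumes "norm A \<le> 1"
  shows "norm (sqrt_iter A (Suc k) - sqrt_iter A k) \<le> sqrt_iter_bound (Suc k) - sqrt_iter_bound k"
proof (induction k)
  case 0
  then show ?case using assms by simp
next
  case (Suc k)
  let ?B = "sqrt_iter A" and ?b = "sqrt_iter_bound"
  let ?D = "?B (Suc k) - ?B k"
  have "?B (Suc (Suc k)) - ?B (Suc k) = (1/2) *\<^sub>R ((?B (Suc k) o\<^sub>L ?B (Suc k)) - (?B k o\<^sub>L ?B k))"
    by (subst (1 2) sqrt_iter.simps(2)) (simp add: scaleR_diff_right[symmetric] del: sqrt_iter.simps(2))
  also have "\<dots> = (1/2) *\<^sub>R ((?B (Suc k) o\<^sub>L ?D) + (?D o\<^sub>L ?B k))"
    by (simp add: bounded_bilinear.diff_left[OF bounded_bilinear_blinfun_compose]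
        bounded_bilinear.diff_right[OF bounded_bilinear_blinfun_compose] del: sqrt_iter.simps(2))
  finally have "norm (?B (Suc (Suc k)) - ?B (Suc k)) = norm ((?B (Suc k) o\<^sub>L ?D) + (?D o\<^sub>L ?B k)) / 2"
    by simp
  also have "\<dots> \<le> (norm (?B (Suc k)) * norm ?D + norm ?D * norm (?B k)) / 2"
    by (intro divide_right_mono order_trans[OF norm_triangle_ineq] add_mono norm_blinfun_compose) simp
  also have "\<dots> \<le> (?b (Suc k) * (?b (Suc k) - ?b k) + (?b (Suc k) - ?b k) * ?b k) / 2"
    using sqrt_iter_bound_bounds(1) sqrt_iter_bound_mono[of k]
    by (intro divide_right_mono add_mono mult_mono norm_sqrt_iter[OF assms] Suc) (auto simp del: sqrt_iter.simps sqrt_iter_bound.simps)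
  also have "\<dots> = ((?b (Suc k))\<^sup>2 - (?b k)\<^sup>2) / 2"
    by (simp add: power2_eq_square algebra_simps del: sqrt_iter_bound.simps)
  also have "\<dots> = ?b (Suc (Suc k)) - ?b (Suc k)"
    using sqrt_iter_bound.simps(2)[of "Suc k"] sqrt_iter_bound.simps(2)[of k] by argo
  finally show ?case .
qed

lemma convergent_sqrt_iter:
  fixes A :: "'a::banach \<Rightarrow>\<^sub>L 'a"
  assumes "norm A \<le> 1"
  shows "convergent (sqrt_iter A)"
proof -
  have dist: "norm (sqrt_iter A (k + j) - sqrt_iter A k) \<le> sqrt_iter_bound (k + j) - sqrt_iter_bound k" for k j
  proof (induction j)
    case (Suc j)
    have "norm (sqrt_iter A (k + Suc j) - sqrt_iter A k) \<le>
        norm (sqrt_iter A (Suc (k + j)) - sqrt_iter A (k + j)) + norm (sqrt_iter A (k + j) - sqrt_iter A k)"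
      using norm_triangle_ineq[of "sqrt_iter A (Suc (k + j)) - sqrt_iter A (k + j)" "sqrt_iter A (k + j) - sqrt_iter A k"]
      by (simp del: sqrt_iter.simps)
    then show ?case using Suc norm_sqrt_iter_step[OF assms, of "k + j"] unfolding add_Suc_right by linarith
  qed simp
  have "incseq sqrt_iter_bound"
    by (intro incseq_SucI sqrt_iter_bound_mono)
  then obtain b where "sqrt_iter_bound \<longlonglongrightarrow> b"
    using incseq_convergent[of sqrt_iter_bound 1] sqrt_iter_bound_bounds(2) by blast
  then have C: "Cauchy sqrt_iter_bound" by (intro convergent_Cauchy convergentI)
  have "Cauchy (sqrt_iter A)"
  proof (rule metric_CauchyI)
    fix e :: real assume "0 < e"
    then obtain N where N: "\<And>m n. m \<ge> N \<Longrightarrow> n \<ge> N \<Longrightarrow> dist (sqrt_iter_bound m) (sqrt_iter_bound n) < e"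
      using metric_CauchyD[OF C] by metis
    have le: "dist (sqrt_iter A m) (sqrt_iter A n) < e" if "N \<le> n" "n \<le> m" for m n
      using dist[of n "m - n"] N[of m n] that by (simp add: dist_norm)
    then have "dist (sqrt_iter A m) (sqrt_iter A n) < e" if "N \<le> n" "N \<le> m" for m n
      using that dist_commute by (metis nat_le_linear)
    then show "\<exists>N. \<forall>m\<ge>N. \<forall>n\<ge>N. dist (sqrt_iter A m) (sqrt_iter A n) < e" by blast
  qed
  then show ?thesis by (rule Cauchy_convergent)
qed

lemma positive_operator_sqrt:
  fixes G :: "'a::{real_inner, banach} \<Rightarrow> 'a"
  assumes G: "bounded_linear G" and sym: "\<And>x y. inner (G x) y = inner x (G y)"
    and contr: "\<And>x. norm (x - G x) \<le> norm x"
  obtains D where "bounded_linear D" "\<And>x y. inner (D x) y = inner x (D y)" "\<And>x. D (D x) = G x"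
    "\<And>E x. bounded_linear E \<Longrightarrow> (\<And>x. E (G x) = G (E x)) \<Longrightarrow> E (D x) = D (E x)"
proof -
  define A where "A = Blinfun (\<lambda>x. x - G x)"
  have A: "blinfun_apply A x = x - G x" for x
    unfolding A_def using G by (simp add: bounded_linear_Blinfun_apply bounded_linear_sub)
  have nA: "norm A \<le> 1"
    by (rule norm_blinfun_bound) (use contr in \<open>simp_all add: A\<close>)
  obtain B where B: "sqrt_iter A \<longlonglongrightarrow> B"
    using convergent_sqrt_iter[OF nA] by (auto simp: convergent_def)
  have Bx: "(\<lambda>k. blinfun_apply (sqrt_iter A k) x) \<longlonglongrightarrow> blinfun_apply B x" for x
    using blinfun.tendsto[OF B tendsto_const] .
  have fix_pt: "B = (1/2) *\<^sub>R (A + (B o\<^sub>L B))"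
  proof (rule LIMSEQ_unique)
    show "(\<lambda>k. sqrt_iter A (Suc k)) \<longlonglongrightarrow> B" using B LIMSEQ_Suc by blast
    show "(\<lambda>k. sqrt_iter A (Suc k)) \<longlonglongrightarrow> (1/2) *\<^sub>R (A + (B o\<^sub>L B))"
      unfolding sqrt_iter.simps
      by (intro tendsto_intros bounded_bilinear.tendsto[OF bounded_bilinear_blinfun_compose] B)
  qed
  have "inner (blinfun_apply (sqrt_iter A k) x) y = inner x (blinfun_apply (sqrt_iter A k) y)" for k x y
    by (induction k arbitrary: x y)
       (simp_all add: blinfun.add_left blinfun.scaleR_left inner_add_left inner_add_right A
         inner_diff_left inner_diff_right sym)
  then have symB: "inner (blinfun_apply B x) y = inner x (blinfun_apply B y)" for x y
    by (intro LIMSEQ_unique[OF tendsto_inner[OF Bx tendsto_const]])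
       (simp add: tendsto_inner[OF tendsto_const Bx])
  have comm: "E (blinfun_apply B x) = blinfun_apply B (E x)"
    if E: "bounded_linear E" and EG: "\<And>x. E (G x) = G (E x)" for E x
  proof -
    interpret E: bounded_linear E by (rule E)
    have "E (blinfun_apply (sqrt_iter A k) x) = blinfun_apply (sqrt_iter A k) (E x)" for k x
      by (induction k arbitrary: x)
         (simp_all add: blinfun.add_left blinfun.scaleR_left A E.zero E.add E.diff E.scaleR EG)
    then show ?thesis
      by (intro LIMSEQ_unique[OF E.tendsto[OF Bx]]) (simp add: Bx)
  qed
  define D where "D x = x - blinfun_apply B x" for x
  have "D (D x) = G x" for x
  proof -
    have "2 *\<^sub>R blinfun_apply B x = (x - G x) + blinfun_apply B (blinfun_apply B x)"
      using arg_cong[OF fix_pt, of "\<lambda>B. 2 *\<^sub>R blinfun_apply B x"]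
      by (simp add: blinfun.scaleR_left blinfun.add_left A)
    then show ?thesis unfolding D_def blinfun.diff_right scaleR_2 by (simp add: algebra_simps)
  qed
  moreover have "bounded_linear D"
    unfolding D_def by (intro bounded_linear_sub bounded_linear_ident blinfun.bounded_linear_right)
  moreover have "inner (D x) y = inner x (D y)" for x y
    by (simp add: D_def inner_diff_left inner_diff_right symB)
  moreover have "E (D x) = D (E x)" if "bounded_linear E" "\<And>x. E (G x) = G (E x)" for E x
    using comm[OF that] bounded_linear.linear[OF that(1)] by (simp add: D_def linear_diff)
  ultimately show ?thesis using that by blast
qed

section \<open>Sums of orthogonal projections\<close>

text \<open>A finite sum of mutually orthogonal projections is a projection, hence a contraction.\<close>

lemma norm_sum_projections_le:
  assumes E: "\<And>i. i \<in> F \<Longrightarrow> adjoint_pair (E i) (E i)"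
    and orth: "\<And>i j x. i \<in> F \<Longrightarrow> j \<in> F \<Longrightarrow> E i (E j x) = (if i = j then E i x else 0)"
    and "finite F"
  shows "norm (\<Sum>i\<in>F. E i x) \<le> norm x"
proof (rule norm_projection_le[where P = "\<lambda>x. \<Sum>i\<in>F. E i x"])
  have cs: "cinner (sum f A) z = (\<Sum>i\<in>A. cinner (f i) z)" for f and A :: "'a set" and z :: 'b
    by (induction A rule: infinite_finite_induct) (simp_all add: cinner_add_left)
  have cs': "cinner z (sum f A) = (\<Sum>i\<in>A. cinner z (f i))" for f and A :: "'a set" and z :: 'b
    by (induction A rule: infinite_finite_induct) (simp_all add: cinner_add_right)
  show "adjoint_pair (\<lambda>x. \<Sum>i\<in>F. E i x) (\<lambda>x. \<Sum>i\<in>F. E i x)"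
    unfolding adjoint_pair_def cs cs' using adjoint_pairD[OF E] by (intro allI sum.cong) auto
  have "E i (\<Sum>j\<in>F. E j x) = E i x" if "i \<in> F" for i
    unfolding adjoint_pair_sum[OF E[OF that]] using that orth \<open>finite F\<close> by simp
  then show "(\<Sum>i\<in>F. E i (\<Sum>i\<in>F. E i x)) = (\<Sum>i\<in>F. E i x)" by simp
qed

text \<open>
  Closedness uses that the partial sums, being projections themselves, are contractions.
  Consequently convergence of the partial sums to the identity need only be checked on vectors
  that span a dense subspace.
\<close>

lemma hilbert_space_projections_sum:
  fixes E :: "'i \<Rightarrow> 'b::complex_hilbert \<Rightarrow> 'b"
  assumes E: "\<And>i. i \<in> I \<Longrightarrow> adjoint_pair (E i) (E i)"
    and orth: "\<And>i j x. i \<in> I \<Longrightarrow> j \<in> I \<Longrightarrow> E i (E j x) = (if i = j then E i x else 0)"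
  shows "hilbert_space {x. ((\<lambda>i. E i x) has_sum x) I}"
proof -
  let ?N = "{x. ((\<lambda>i. E i x) has_sum x) I}"
  have "complex_vector.subspace ?N"
    unfolding complex_vector.subspace_def
  proof (intro conjI ballI allI)
    show "0 \<in> ?N"
      using adjoint_pair_zero[OF E] by (simp add: has_sum_0)
    fix x y c assume x: "x \<in> ?N"
    have "((\<lambda>i. c *\<^sub>C E i x) has_sum c *\<^sub>C x) I"
      using x has_sum_bounded_linear[OF bounded_linear_scaleC] by blast
    then show "c *\<^sub>C x \<in> ?N"
      using has_sum_cong[of I "\<lambda>i. c *\<^sub>C E i x" "\<lambda>i. E i (c *\<^sub>C x)"] adjoint_pair_scaleC[OF E] by simp
    assume "y \<in> ?N"
    then have "((\<lambda>i. E i x + E i y) has_sum x + y) I"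
      using x has_sum_add by blast
    then show "x + y \<in> ?N"
      using has_sum_cong[of I "\<lambda>i. E i x + E i y" "\<lambda>i. E i (x + y)"] adjoint_pair_add[OF E] by simp
  qed
  moreover have "closed ?N"
    unfolding closed_sequential_limits
  proof (intro allI impI, elim conjE)
    fix f x assume f: "\<forall>n. f n \<in> ?N" and lim: "f \<longlonglongrightarrow> x"
    have "((\<lambda>F. \<Sum>i\<in>F. E i x) \<longlongrightarrow> x) (finite_subsets_at_top I)"
    proof (rule tendstoI)
      fix e :: real assume e: "0 < e"
      obtain n where n: "dist (f n) x < e / 3"
        using metric_LIMSEQ_D[OF lim, of "e / 3"] e by auto
      have "((\<lambda>F. \<Sum>i\<in>F. E i (f n)) \<longlongrightarrow> f n) (finite_subsets_at_top I)"
        using f by (simp add: has_sum_def)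
      then have "\<forall>\<^sub>F F in finite_subsets_at_top I. dist (\<Sum>i\<in>F. E i (f n)) (f n) < e / 3"
        using e by (intro tendstoD) auto
      moreover have "\<forall>\<^sub>F F in finite_subsets_at_top I. dist (\<Sum>i\<in>F. E i x) (\<Sum>i\<in>F. E i (f n)) \<le> dist (f n) x"
      proof (rule eventually_finite_subsets_at_top_weakI)
        fix F assume F: "finite F" "F \<subseteq> I"
        have "(\<Sum>i\<in>F. E i x) - (\<Sum>i\<in>F. E i (f n)) = (\<Sum>i\<in>F. E i (x - f n))"
          unfolding sum_subtractf[symmetric] using adjoint_pair_diff[OF E] F(2)
          by (intro sum.cong) auto
        also have "norm \<dots> \<le> norm (x - f n)"
          using F by (intro norm_sum_projections_le E orth) auto
        finally show "dist (\<Sum>i\<in>F. E i x) (\<Sum>i\<in>F. E i (f n)) \<le> dist (f n) x"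
          by (simp add: dist_norm norm_minus_commute)
      qed
      ultimately show "\<forall>\<^sub>F F in finite_subsets_at_top I. dist (\<Sum>i\<in>F. E i x) x < e"
      proof eventually_elim
        case (elim F)
        then show ?case
          using n dist_triangle[of "\<Sum>i\<in>F. E i x" x "\<Sum>i\<in>F. E i (f n)"]
            dist_triangle[of "\<Sum>i\<in>F. E i (f n)" x "f n"] by linarith
      qed
    qed
    then show "x \<in> ?N" by (simp add: has_sum_def)
  qed
  ultimately show ?thesis by (simp add: hilbert_space_def)
qed

text \<open>
  The sum of a vector \<open>x\<close> is found without estimating Cauchy sums: if \<open>N\<close> is the closed subspace
  on which the projections add up to the identity, they vanish on its orthogonal complement.
\<close>

lemma projections_has_sum_orth_proj:
  fixes E :: "'i \<Rightarrow> 'b::complex_hilbert \<Rightarrow> 'b"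
  assumes E: "\<And>i. i \<in> I \<Longrightarrow> adjoint_pair (E i) (E i)"
    and orth: "\<And>i j x. i \<in> I \<Longrightarrow> j \<in> I \<Longrightarrow> E i (E j x) = (if i = j then E i x else 0)"
  shows "((\<lambda>i. E i x) has_sum orth_proj {x. ((\<lambda>i. E i x) has_sum x) I} x) I"
proof -
  let ?N = "{x. ((\<lambda>i. E i x) has_sum x) I}"
  note N = hilbert_space_projections_sum[of I E, OF E orth]
  have ran: "E i y \<in> ?N" if i: "i \<in> I" for i y
  proof -
    have "((\<lambda>j. if j = i then E i y else 0) has_sum E i y) I"
      using has_sum_finite_neutralI[of "{i}" I "\<lambda>j. if j = i then E i y else 0"] i by auto
    moreover have "(if j = i then E i y else 0) = E j (E i y)" if "j \<in> I" for j
      using orth[OF that i] by simp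
    ultimately show ?thesis
      using has_sum_cong[of I "\<lambda>j. if j = i then E i y else 0" "\<lambda>j. E j (E i y)"] by simp
  qed
  have "E i (orth_proj ?N x) = E i x" if i: "i \<in> I" for i
  proof (rule cinner_eqI)
    fix y
    have "cinner (E i y) (orth_proj ?N x) = cinner (E i y) x"
      by (rule orth_proj_props(2)[OF N ran[OF i]])
    then show "cinner y (E i (orth_proj ?N x)) = cinner y (E i x)"
      by (simp only: adjoint_pairD[OF E[OF i]])
  qed
  then show ?thesis
    using orth_proj_props(1)[OF N, of x] has_sum_cong[of I "\<lambda>i. E i (orth_proj ?N x)" "\<lambda>i. E i x"] by simp
qed

text \<open>
  Apply the sum to a vector \<open>y = E\<^sub>j y\<close>: the single term \<open>\<parallel>E\<^sub>j y\<parallel>\<^sup>2\<close> already exhausts the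
  bound \<open>\<parallel>y\<parallel>\<^sup>2\<close>, so all the other terms vanish.
\<close>

lemma orthogonal_of_sum_le_one:
  fixes M :: "'b::complex_hilbert set"
  assumes maps: "\<And>i x. i \<in> I \<Longrightarrow> x \<in> M \<Longrightarrow> E i x \<in> M"
    and idem: "\<And>i x. i \<in> I \<Longrightarrow> x \<in> M \<Longrightarrow> E i (E i x) = E i x"
    and pos: "\<And>i x. i \<in> I \<Longrightarrow> x \<in> M \<Longrightarrow> cinner x (E i x) = complex_of_real ((norm (E i x))\<^sup>2)"
    and sum: "\<And>x. x \<in> M \<Longrightarrow> ((\<lambda>i. E i x) has_sum A x) I" and le: "op_le M A (id_op M)"
    and ij: "i \<in> I" "j \<in> I" "i \<noteq> j" and x: "x \<in> M"
  shows "E i (E j x) = 0"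
proof -
  let ?y = "E j x"
  have y: "?y \<in> M" "E j ?y = ?y" using maps idem ij x by auto
  have "((\<lambda>k. inner ?y (E k ?y)) has_sum inner ?y (A ?y)) I"
    by (rule has_sum_bounded_linear[OF bounded_linear_inner_right sum[OF y(1)]])
  moreover have "inner ?y (E k ?y) = (norm (E k ?y))\<^sup>2" if "k \<in> I" for k
    using pos[OF that y(1)] by (metis Re_cinner Re_complex_of_real)
  ultimately have "((\<lambda>k. (norm (E k ?y))\<^sup>2) has_sum inner ?y (A ?y)) I"
    using has_sum_cong[of I "\<lambda>k. inner ?y (E k ?y)" "\<lambda>k. (norm (E k ?y))\<^sup>2"] by simp
  then have "(\<Sum>k\<in>{i, j}. (norm (E k ?y))\<^sup>2) \<le> inner ?y (A ?y)"
    by (rule finite_sum_le_has_sum) (use ij in auto)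
  then have "(norm (E i ?y))\<^sup>2 + (norm ?y)\<^sup>2 \<le> inner ?y (A ?y)"
    using ij(3) y(2) by simp
  moreover have "inner ?y (A ?y) \<le> (norm ?y)\<^sup>2"
  proof -
    have "cinner ?y (?y - A ?y) \<in> \<real>\<^sub>\<ge>\<^sub>0"
      using le y(1) unfolding op_le_def id_op_def by fastforce
    then have "0 \<le> inner ?y (?y - A ?y)"
      by (simp add: complex_nonneg_Reals_iff Re_cinner)
    then show ?thesis by (simp add: inner_diff_right power2_norm_eq_inner)
  qed
  ultimately have "(norm (E i ?y))\<^sup>2 \<le> 0" by linarith
  then show ?thesis by simp
qed

section \<open>Products of Hilbert spaces and unitary operators\<close>

instantiation prod :: (complex_inner, complex_inner) complex_inner
begin

definition scaleC_prod :: "complex \<Rightarrow> 'a \<times> 'b \<Rightarrow> 'a \<times> 'b" where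
  "scaleC_prod c p = (c *\<^sub>C fst p, c *\<^sub>C snd p)"

definition cinner_prod :: "'a \<times> 'b \<Rightarrow> 'a \<times> 'b \<Rightarrow> complex" where
  "cinner_prod p q = cinner (fst p) (fst q) + cinner (snd p) (snd q)"

instance
proof
  fix p q :: "'a \<times> 'b"
  show "cinner p q = cnj (cinner q p)"
    unfolding cinner_prod_def complex_cnj_add by (simp add: cinner_commute[symmetric])
qed (auto simp: scaleC_prod_def cinner_prod_def scaleC_add_right scaleC_add_left scaleC_scaleC
      scaleC_of_real cinner_add_left cinner_scaleC_left Re_cinner inner_prod_def algebra_simps
      prod_eq_iff)

end

instance prod :: (complex_hilbert, complex_hilbert) complex_hilbert ..

lemma hilbert_space_Times:
  assumes "hilbert_space M" "hilbert_space N"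
  shows "hilbert_space (M \<times> N)"
  using hilbert_spaceD[OF assms(1)] hilbert_spaceD[OF assms(2)]
  unfolding hilbert_space_def[of "M \<times> N"] complex_vector.subspace_def
  by (auto simp: closed_Times scaleC_prod_def zero_prod_def)

text \<open>A linear map that is bounded below has closed range.\<close>

lemma hilbert_space_image:
  fixes f :: "'a::complex_hilbert \<Rightarrow> 'b::complex_hilbert"
  assumes M: "hilbert_space M" and f: "bounded_linear f" "\<And>c x. f (c *\<^sub>C x) = c *\<^sub>C f x"
    and e: "0 < e" "\<And>x. x \<in> M \<Longrightarrow> e * norm x \<le> norm (f x)"
  shows "hilbert_space (f ` M)"
proof -
  interpret f: bounded_linear f by (rule f(1))
  have "complete (f ` M)"
    using complete_isometric_image[OF e(1) hilbert_spaceD(7)[OF M] f(1)] e(2) hilbert_spaceD(5)[OF M]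
    by (simp add: complete_eq_closed)
  moreover have "complex_vector.subspace (f ` M)"
    unfolding complex_vector.subspace_def
  proof (intro conjI ballI allI)
    show "0 \<in> f ` M" using hilbert_spaceD(1)[OF M] f.zero by (metis imageI)
    show "x + y \<in> f ` M" if "x \<in> f ` M" "y \<in> f ` M" for x y
      using that hilbert_spaceD(2)[OF M] by (auto simp: f.add[symmetric])
    show "c *\<^sub>C x \<in> f ` M" if "x \<in> f ` M" for c x
      using that hilbert_spaceD(4)[OF M] by (auto simp: f(2)[symmetric])
  qed
  ultimately show ?thesis by (simp add: hilbert_space_def complete_eq_closed)
qed

lemma unitary_op_isometryI:
  assumes M: "hilbert_space M" and U: "U \<in> operators M N" and surj: "U ` M = N"
    and iso: "\<And>x y. x \<in> M \<Longrightarrow> y \<in> M \<Longrightarrow> cinner (U x) (U y) = cinner x y"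
  shows "unitary_op M N U" and "\<And>x. x \<in> M \<Longrightarrow> adjoint_op M N U (U x) = x"
proof -
  show adj: "adjoint_op M N U (U x) = x" if "x \<in> M" for x
    using that iso operatorsD(1)[OF U] by (intro adjoint_op_eqI[OF U M]) auto
  have "compose M (adjoint_op M N U) U = id_op M"
    by (auto simp: compose_def id_op_def adj)
  moreover have "compose N U (adjoint_op M N U) = id_op N"
  proof
    show "compose N U (adjoint_op M N U) y = id_op N y" for y
      using surj adj by (cases "y \<in> N") (auto simp: compose_def id_op_def)
  qed
  ultimately show "unitary_op M N U" using U by (simp add: unitary_op_def)
qed

text \<open>
  The graph of the unitary is the closed span \<open>\<Gamma>\<close> of the pairs \<open>(x\<^sub>i, y\<^sub>i)\<close>. Equality of the
  Gram matrices extends to \<open>\<Gamma>\<close>, so that both coordinate maps are injective on \<open>\<Gamma>\<close> with closed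
  range; the ranges contain the spanning families and hence are the whole spaces.
\<close>

lemma unitary_of_equal_gram:
  fixes x :: "'i \<Rightarrow> 'b::complex_hilbert" and y :: "'i \<Rightarrow> 'c::complex_hilbert"
  assumes gram: "\<And>i j. i \<in> I \<Longrightarrow> j \<in> I \<Longrightarrow> cinner (x i) (x j) = cinner (y i) (y j)"
    and K: "K = closure (complex_vector.span (x ` I))"
    and K': "K' = closure (complex_vector.span (y ` I))"
  obtains U where "unitary_op K K' U" "\<And>i. i \<in> I \<Longrightarrow> U (x i) = y i"
    "\<And>u. u \<in> K \<Longrightarrow> adjoint_op K K' U (U u) = u"
proof -
  define \<Gamma> where "\<Gamma> = closure (complex_vector.span ((\<lambda>i. (x i, y i)) ` I))"
  have \<Gamma>: "hilbert_space \<Gamma>" unfolding \<Gamma>_def by (rule hilbert_space_closed_span)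
  have hK: "hilbert_space K" "hilbert_space K'" unfolding K K' by (rule hilbert_space_closed_span)+
  have gen: "(x i, y i) \<in> \<Gamma>" "x i \<in> K" "y i \<in> K'" if "i \<in> I" for i
    using that unfolding \<Gamma>_def K K' by (auto intro: subsetD[OF subset_closed_span])
  have sub: "\<Gamma> \<subseteq> K \<times> K'"
    unfolding \<Gamma>_def by (rule closed_span_minimal[OF _ hilbert_space_Times[OF hK]]) (use gen in auto)
  \<comment> \<open>A relation \<open>\<langle>q\<^sub>1, p\<^sub>1\<rangle> = \<langle>q\<^sub>2, p\<^sub>2\<rangle>\<close> is orthogonality to \<open>(q\<^sub>1, - q\<^sub>2)\<close>,
    hence passes from the generating pairs to \<open>\<Gamma>\<close>; it is extended in one argument at a time.\<close>
  have ext: "\<Gamma> \<subseteq> {p. cinner (fst q, - snd q) p = 0}"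
    if "\<And>i. i \<in> I \<Longrightarrow> cinner (fst q) (x i) = cinner (snd q) (y i)" for q
    unfolding \<Gamma>_def by (rule closed_span_minimal[OF _ hilbert_space_orth]) (auto simp: cinner_prod_def that)
  have gen_inner: "cinner (fst p) (x i) = cinner (snd p) (y i)" if "p \<in> \<Gamma>" "i \<in> I" for p i
  proof -
    have "cinner (x i) (fst p) = cinner (y i) (snd p)"
      using ext[of "(x i, y i)"] gram that by (auto simp: cinner_prod_def)
    then show ?thesis using cinner_commute by metis
  qed
  have inner: "cinner (fst p) (fst q) = cinner (snd p) (snd q)" if "p \<in> \<Gamma>" "q \<in> \<Gamma>" for p q
    using ext[of p] gen_inner[OF that(1)] that(2) by (auto simp: cinner_prod_def)
  have norms: "norm (fst p) = norm (snd p)" if "p \<in> \<Gamma>" for p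
  proof -
    have "complex_of_real ((norm (fst p))\<^sup>2) = complex_of_real ((norm (snd p))\<^sup>2)"
      using inner[OF that that] unfolding cinner_self .
    then have "(norm (fst p))\<^sup>2 = (norm (snd p))\<^sup>2" unfolding of_real_eq_iff .
    then show ?thesis by simp
  qed
  have lower: "(1/2) * norm p \<le> norm (fst p)" "(1/2) * norm p \<le> norm (snd p)" if "p \<in> \<Gamma>" for p
    using norms[OF that] norm_Pair_le[of "fst p" "snd p"] by simp_all
  have "hilbert_space (fst ` \<Gamma>)" "hilbert_space (snd ` \<Gamma>)"
    by (rule hilbert_space_image[OF \<Gamma>, where e = "1/2"];
        use lower in \<open>simp add: bounded_linear_fst bounded_linear_snd scaleC_prod_def\<close>)+
  then have "K \<subseteq> fst ` \<Gamma>" "K' \<subseteq> snd ` \<Gamma>"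
    unfolding K K' by (intro closed_span_minimal; use gen(1) in force)+
  then have onto: "\<And>u. u \<in> K \<Longrightarrow> \<exists>v. (u, v) \<in> \<Gamma>" "\<And>v. v \<in> K' \<Longrightarrow> \<exists>u. (u, v) \<in> \<Gamma>"
    by force+
  have unique: "v = v'" if "(u, v) \<in> \<Gamma>" "(u, v') \<in> \<Gamma>" for u v v'
    using norms[OF hilbert_spaceD(3)[OF \<Gamma> that]] by simp
  define U where "U = (\<lambda>u\<in>K. THE v. (u, v) \<in> \<Gamma>)"
  have U_eq: "U u = v" if "(u, v) \<in> \<Gamma>" for u v
    using sub that unique unfolding U_def by (auto intro!: the_equality)
  have U_graph: "(u, U u) \<in> \<Gamma>" if "u \<in> K" for u
    using onto(1)[OF that] U_eq by blast
  have op: "U \<in> operators K K'"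
  proof -
    have "U (u + v) = U u + U v" if "u \<in> K" "v \<in> K" for u v
      using hilbert_spaceD(2)[OF \<Gamma> U_graph U_graph, OF that] by (intro U_eq) simp
    moreover have "U (c *\<^sub>C u) = c *\<^sub>C U u" if "u \<in> K" for c u
      using hilbert_spaceD(4)[OF \<Gamma> U_graph, OF that, of c] by (intro U_eq) (simp add: scaleC_prod_def)
    moreover have "U \<in> K \<rightarrow>\<^sub>E K'"
      using U_graph sub by (auto simp: PiE_iff U_def)
    moreover have "\<forall>u\<in>K. norm (U u) \<le> 1 * norm u"
      using norms[OF U_graph] by simp
    ultimately show ?thesis unfolding operators_def by blast
  qed
  have surj: "U ` K = K'"
  proof
    show "U ` K \<subseteq> K'" using operatorsD(1)[OF op] by blast
    show "K' \<subseteq> U ` K" using onto(2) U_eq sub by blast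
  qed
  have iso: "cinner (U u) (U v) = cinner u v" if "u \<in> K" "v \<in> K" for u v
    using inner[OF U_graph U_graph, OF that] by simp
  show ?thesis
    by (rule that[OF unitary_op_isometryI(1)[OF hK(1) op surj iso] U_eq[OF gen(1)]
          unitary_op_isometryI(2)[OF hK(1) op surj iso]])
qed

text \<open>The vectors on which two bounded operators agree form a closed subspace.\<close>

lemma operators_eq_on_closed_span:
  assumes A: "A \<in> operators K N" and B: "B \<in> operators K N'" and K: "K = closure (complex_vector.span X)"
    and eq: "\<And>x. x \<in> X \<Longrightarrow> A x = B x" and x: "x \<in> K"
  shows "A x = B x"
proof -
  have hK: "hilbert_space K" unfolding K by (rule hilbert_space_closed_span)
  let ?D = "\<lambda>x\<in>K. A x - B x"
  obtain C where C: "C \<ge> 0" "\<And>x. x \<in> K \<Longrightarrow> norm (A x) \<le> C * norm x"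
    using operators_bound[OF A] by metis
  obtain C' where C': "C' \<ge> 0" "\<And>x. x \<in> K \<Longrightarrow> norm (B x) \<le> C' * norm x"
    using operators_bound[OF B] by metis
  have "norm (A x - B x) \<le> (C + C') * norm x" if "x \<in> K" for x
    using norm_triangle_ineq4[of "A x" "B x"] C(2)[OF that] C'(2)[OF that]
    by (simp add: distrib_right)
  then have bd: "\<exists>C. \<forall>x\<in>K. norm (?D x) \<le> C * norm x"
    by (intro exI[of _ "C + C'"]) simp
  have sc: "c *\<^sub>C u - c *\<^sub>C v = c *\<^sub>C (u - v)" for c and u v :: 'b
    using scaleC_add_right[of c "u - v" v] by simp
  have "?D \<in> operators K UNIV"
    unfolding operators_def using bd hilbert_spaceD(2,4)[OF hK] operatorsD(2,3)[OF A] operatorsD(2,3)[OF B]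
    by (simp add: sc)
  then have "hilbert_space {x \<in> K. ?D x \<in> {0}}"
    using hilbert_space_preimage hK hilbert_space_zero by blast
  then have "K \<subseteq> {x \<in> K. ?D x \<in> {0}}"
    using subset_closed_span[of X] eq unfolding K by (intro closed_span_minimal) auto
  then show ?thesis using x by auto
qed

section \<open>Sources and targets of a stabilized tuple\<close>

locale stabilized_tuple =
  fixes n :: enat
    and H :: "'a::complex_hilbert set"
    and T :: "nat \<Rightarrow> 'a \<Rightarrow> 'a"
    and J :: "'k set"
    and P :: "'k \<Rightarrow> 'a \<Rightarrow> 'a"
  assumes H: "hilbert_space H"
    and tuple: "operator_tuple n H T"
    and contraction: "row_contraction n H T"
    and stab: "stabilizes n H T J P"
    and effective: "\<forall>k\<in>J. \<exists>i\<in>tuple_index n. compose H (T i) (P k) \<noteq> zero_op H"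
begin

abbreviation "I \<equiv> tuple_index n"
abbreviation "Tadj i \<equiv> adjoint_op H H (T i)"

lemma T_op: "i \<in> I \<Longrightarrow> T i \<in> operators H H"
  using tuple by (simp add: operator_tuple_def)

lemma Tadj_op: "i \<in> I \<Longrightarrow> Tadj i \<in> operators H H"
  by (rule adjoint_operator[OF T_op H H])

lemma T_H [simp]: "i \<in> I \<Longrightarrow> h \<in> H \<Longrightarrow> T i h \<in> H"
  using operatorsD(1)[OF T_op] .

lemma Tadj_H [simp]: "i \<in> I \<Longrightarrow> h \<in> H \<Longrightarrow> Tadj i h \<in> H"
  using operatorsD(1)[OF Tadj_op] .

lemma T_adjoint: "i \<in> I \<Longrightarrow> g \<in> H \<Longrightarrow> h \<in> H \<Longrightarrow> cinner (T i g) h = cinner g (Tadj i h)"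
  using adjoint_op_props(2)[OF T_op H] .

lemma T_nonzero:
  assumes "i \<in> I"
  obtains h where "h \<in> H" "T i h \<noteq> 0"
proof -
  have "\<exists>h\<in>H. T i h \<noteq> 0"
  proof (rule ccontr)
    assume "\<not> ?thesis"
    then have "T i = zero_op H"
      using operatorsD(4)[OF T_op[OF assms]]
      by (intro extensionalityI[of _ H]) (auto simp: zero_op_def)
    then show False using tuple assms by (simp add: operator_tuple_def)
  qed
  then show ?thesis using that by blast
qed

lemma P_op: "k \<in> J \<Longrightarrow> P k \<in> operators H H"
  using stab by (simp add: stabilizes_def projection_def)

lemma P_H [simp]: "k \<in> J \<Longrightarrow> h \<in> H \<Longrightarrow> P k h \<in> H"
  using operatorsD(1)[OF P_op] .

lemma P_adjoint_op: "k \<in> J \<Longrightarrow> adjoint_op H H (P k) = P k"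
  using stab by (simp add: stabilizes_def projection_def)

lemma P_adjoint:
  assumes "k \<in> J" "g \<in> H" "h \<in> H"
  shows "cinner (P k g) h = cinner g (P k h)"
  using adjoint_op_props(2)[OF P_op[OF assms(1)] H assms(3,2)] P_adjoint_op[OF assms(1)] by simp

lemma P_idem:
  assumes "k \<in> J" "h \<in> H"
  shows "P k (P k h) = P k h"
proof -
  have "compose H (P k) (P k) = P k"
    using stab assms(1) by (simp add: stabilizes_def projection_def)
  then show ?thesis using assms(2) by (metis compose_eq)
qed

lemma P_sum: "h \<in> H \<Longrightarrow> ((\<lambda>k. P k h) has_sum h) J"
  using stab by (simp add: stabilizes_def sot_sum_def id_op_def)

lemma P_orth:
  assumes kl: "k \<in> J" "l \<in> J" "k \<noteq> l" and h: "h \<in> H"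
  shows "P k (P l h) = 0"
proof (rule orthogonal_of_sum_le_one[where I = J and M = H and E = P and A = "id_op H", OF _ _ _ _ _ kl h])
  show "cinner x (P i x) = complex_of_real ((norm (P i x))\<^sup>2)" if "i \<in> J" "x \<in> H" for i x
    using P_adjoint[of i x "P i x"] P_idem[of i x] that by (simp add: cinner_self del: of_real_power)
  show "op_le H (id_op H) (id_op H)" by (simp add: op_le_def)
  show "((\<lambda>i. P i x) has_sum id_op H x) J" if "x \<in> H" for x
    using P_sum[OF that] that by (simp add: id_op_def)
qed (auto simp: P_idem)

text \<open>
  Every \<open>T\<^sub>i\<close> starts and ends in exactly one of the subspaces \<open>P\<^sub>k H\<close>, because the \<open>P\<^sub>k\<close> are
  orthogonal and add up to the identity. Thus the tuple is a representation of a directed graph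
  with vertex set \<open>J\<close> and edges \<open>i\<close>.
\<close>

definition src :: "nat \<Rightarrow> 'k" where
  "src i = (THE k. k \<in> J \<and> (\<forall>h\<in>H. T i (P k h) = T i h))"

definition tgt :: "nat \<Rightarrow> 'k" where
  "tgt i = (THE k. k \<in> J \<and> (\<forall>h\<in>H. P k (T i h) = T i h))"

lemma compose_alternatives:
  assumes "k \<in> J" "i \<in> I"
  shows "(\<forall>h\<in>H. T i (P k h) = T i h) \<or> (\<forall>h\<in>H. T i (P k h) = 0)"
    and "(\<forall>h\<in>H. P k (T i h) = T i h) \<or> (\<forall>h\<in>H. P k (T i h) = 0)"
proof -
  have "compose H (T i) (P k) = T i \<or> compose H (T i) (P k) = zero_op H"
    "compose H (P k) (T i) = T i \<or> compose H (P k) (T i) = zero_op H"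
    using stab assms unfolding stabilizes_def by blast+
  moreover have "(\<forall>h\<in>H. f (g h) = F h) \<or> (\<forall>h\<in>H. f (g h) = 0)"
    if "compose H f g = F \<or> compose H f g = zero_op H" for f g F :: "'a \<Rightarrow> 'a"
    using that
  proof
    assume "compose H f g = F"
    then have "\<forall>h\<in>H. f (g h) = F h" by (auto simp: compose_eq[of _ H f g, symmetric])
    then show ?thesis ..
  next
    assume "compose H f g = zero_op H"
    then have "\<forall>h\<in>H. f (g h) = 0" by (auto simp: compose_eq[of _ H f g, symmetric] zero_op_def)
    then show ?thesis ..
  qed
  ultimately show "(\<forall>h\<in>H. T i (P k h) = T i h) \<or> (\<forall>h\<in>H. T i (P k h) = 0)"
    "(\<forall>h\<in>H. P k (T i h) = T i h) \<or> (\<forall>h\<in>H. P k (T i h) = 0)"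
    by blast+
qed

text \<open>
  If all the \<open>T\<^sub>i P\<^sub>k\<close> vanished, then so would \<open>T\<^sub>i = T\<^sub>i (\<Sum>\<^sub>k P\<^sub>k)\<close>; two different \<open>k\<close> would give
  \<open>T\<^sub>i = T\<^sub>i P\<^sub>k P\<^sub>l = 0\<close>.
\<close>

lemma src_ex1:
  assumes i: "i \<in> I"
  shows "\<exists>!k. k \<in> J \<and> (\<forall>h\<in>H. T i (P k h) = T i h)"
proof -
  obtain h where h: "h \<in> H" "T i h \<noteq> 0" by (rule T_nonzero[OF i])
  have "\<exists>k\<in>J. \<forall>h\<in>H. T i (P k h) = T i h"
  proof (rule ccontr)
    assume "\<not> ?thesis"
    then have *: "T i (P k h) = 0" if "k \<in> J" for k
      using compose_alternatives(1)[OF that i] h(1) that by blast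
    let ?g = "T i h"
    \<comment> \<open>The sum is pushed through \<open>T\<^sub>i\<close> by pairing with \<open>T\<^sub>i\<^sup>* g\<close>.\<close>
    have "cinner (Tadj i ?g) (P k h) = 0" if k: "k \<in> J" for k
    proof -
      have "cinner (P k h) (Tadj i ?g) = 0"
        using T_adjoint[OF i P_H[OF k h(1)] T_H[OF i h(1)]] *[OF k] by simp
      then show ?thesis by (subst cinner_commute) simp
    qed
    then have "((\<lambda>k. 0) has_sum cinner (Tadj i ?g) h) J"
      using has_sum_cong[of J "\<lambda>k. cinner (Tadj i ?g) (P k h)" "\<lambda>k. 0"]
        has_sum_bounded_linear[OF bounded_linear_cinner_right P_sum[OF h(1)], of "Tadj i ?g"] by simp
    then have "cinner (Tadj i ?g) h = 0" using has_sum_unique[OF _ has_sum_0] by blast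
    then have "cinner h (Tadj i ?g) = 0" by (subst cinner_commute) simp
    then have "cinner ?g ?g = 0" using T_adjoint[OF i h(1) T_H[OF i h(1)]] by simp
    then show False using h(2) cinner_self_eq_zero by blast
  qed
  moreover have "k = l" if "k \<in> J" "\<forall>h\<in>H. T i (P k h) = T i h" "l \<in> J" "\<forall>h\<in>H. T i (P l h) = T i h" for k l
  proof (rule ccontr)
    assume "k \<noteq> l"
    then have "T i (P k (P l h)) = 0"
      using P_orth[OF that(1,3) _ h(1)] operators_zero[OF T_op[OF i] H] by simp
    moreover have "T i (P k (P l h)) = T i h" using that P_H[OF that(3) h(1)] h(1) by simp
    ultimately show False using h(2) by simp
  qed
  ultimately show ?thesis by blast
qed

lemma tgt_ex1:
  assumes i: "i \<in> I"
  shows "\<exists>!k. k \<in> J \<and> (\<forall>h\<in>H. P k (T i h) = T i h)"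
proof -
  obtain h where h: "h \<in> H" "T i h \<noteq> 0" by (rule T_nonzero[OF i])
  have "\<exists>k\<in>J. \<forall>h\<in>H. P k (T i h) = T i h"
  proof (rule ccontr)
    assume "\<not> ?thesis"
    then have *: "P k (T i h) = 0" if "k \<in> J" for k
      using compose_alternatives(2)[OF that i] h(1) that by blast
    then have "((\<lambda>k. 0) has_sum T i h) J"
      using has_sum_cong[of J "\<lambda>k. P k (T i h)" "\<lambda>k. 0"] P_sum[OF T_H[OF i h(1)]] by simp
    then show False using h(2) has_sum_unique[OF _ has_sum_0] by blast
  qed
  moreover have "k = l" if "k \<in> J" "\<forall>h\<in>H. P k (T i h) = T i h" "l \<in> J" "\<forall>h\<in>H. P l (T i h) = T i h" for k l
  proof (rule ccontr)
    assume "k \<noteq> l"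
    then have "P k (P l (T i h)) = 0"
      using P_orth[OF that(1,3) _ T_H[OF i h(1)]] by simp
    then show False using that h by simp
  qed
  ultimately show ?thesis by blast
qed

lemma src_J [simp]: "i \<in> I \<Longrightarrow> src i \<in> J"
  using theI'[OF src_ex1] by (simp add: src_def)

lemma tgt_J [simp]: "i \<in> I \<Longrightarrow> tgt i \<in> J"
  using theI'[OF tgt_ex1] by (simp add: tgt_def)

lemma src_eqI:
  assumes "i \<in> I" "k \<in> J" "\<And>h. h \<in> H \<Longrightarrow> T i (P k h) = T i h"
  shows "k = src i"
  using the1_equality[OF src_ex1[OF assms(1)], of k] assms(2,3) by (simp add: src_def)

lemma tgt_eqI:
  assumes "i \<in> I" "k \<in> J" "\<And>h. h \<in> H \<Longrightarrow> P k (T i h) = T i h"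
  shows "k = tgt i"
  using the1_equality[OF tgt_ex1[OF assms(1)], of k] assms(2,3) by (simp add: tgt_def)

lemma T_P:
  assumes i: "i \<in> I" and k: "k \<in> J" and h: "h \<in> H"
  shows "T i (P k h) = (if k = src i then T i h else 0)"
proof (cases "k = src i")
  case True
  then show ?thesis using theI'[OF src_ex1[OF i]] h by (simp add: src_def)
next
  case False
  then have "\<not> (\<forall>h\<in>H. T i (P k h) = T i h)" using src_eqI[OF i k] by blast
  then have "\<forall>h\<in>H. T i (P k h) = 0" using compose_alternatives(1)[OF k i] by blast
  then show ?thesis using h False by simp
qed

lemma P_T:
  assumes i: "i \<in> I" and k: "k \<in> J" and h: "h \<in> H"
  shows "P k (T i h) = (if k = tgt i then T i h else 0)"
proof (cases "k = tgt i")
  case True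
  then show ?thesis using theI'[OF tgt_ex1[OF i]] h by (simp add: tgt_def)
next
  case False
  then have "\<not> (\<forall>h\<in>H. P k (T i h) = T i h)" using tgt_eqI[OF i k] by blast
  then have "\<forall>h\<in>H. P k (T i h) = 0" using compose_alternatives(2)[OF k i] by blast
  then show ?thesis using h False by simp
qed

lemma H_eqI:
  assumes "g \<in> H" "h \<in> H" "\<And>x. x \<in> H \<Longrightarrow> cinner x g = cinner x h"
  shows "g = h"
  using assms(3)[OF hilbert_spaceD(3)[OF H assms(1,2)]] cinner_self_eq_zero[of "g - h"]
  by (simp add: cinner_diff_right)

lemma P_Tadj:
  assumes i: "i \<in> I" and k: "k \<in> J" and h: "h \<in> H"
  shows "P k (Tadj i h) = (if k = src i then Tadj i h else 0)"
proof (rule H_eqI)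
  show "P k (Tadj i h) \<in> H" using i k h by simp
  show "(if k = src i then Tadj i h else 0) \<in> H" using i h hilbert_spaceD(1)[OF H] by simp
  fix x assume x: "x \<in> H"
  have "cinner x (P k (Tadj i h)) = cinner (T i (P k x)) h"
    using P_adjoint[OF k x] T_adjoint[OF i _ h] i k h x by simp
  also have "\<dots> = cinner x (if k = src i then Tadj i h else 0)"
    using T_P[OF i k x] T_adjoint[OF i x h] by simp
  finally show "cinner x (P k (Tadj i h)) = cinner x (if k = src i then Tadj i h else 0)" .
qed

lemma Tadj_P:
  assumes i: "i \<in> I" and k: "k \<in> J" and h: "h \<in> H"
  shows "Tadj i (P k h) = (if k = tgt i then Tadj i h else 0)"
proof (rule H_eqI)
  show "Tadj i (P k h) \<in> H" using i k h by simp
  show "(if k = tgt i then Tadj i h else 0) \<in> H" using i h hilbert_spaceD(1)[OF H] by simp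
  fix x assume x: "x \<in> H"
  have "cinner x (Tadj i (P k h)) = cinner (P k (T i x)) h"
    using P_adjoint[OF k _ h] T_adjoint[OF i x] i k h x by simp
  also have "\<dots> = cinner x (if k = tgt i then Tadj i h else 0)"
    using P_T[OF i k x] T_adjoint[OF i x h] by simp
  finally show "cinner x (Tadj i (P k h)) = cinner x (if k = tgt i then Tadj i h else 0)" .
qed

lemma src_onto:
  assumes k: "k \<in> J"
  obtains i where "i \<in> I" "src i = k"
proof -
  obtain i where i: "i \<in> I" "compose H (T i) (P k) \<noteq> zero_op H"
    using effective k by blast
  have "src i = k"
  proof (rule ccontr)
    assume "src i \<noteq> k"
    then have "compose H (T i) (P k) = zero_op H"
      using T_P[OF i(1) k] by (auto simp: compose_def zero_op_def fun_eq_iff)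
    then show False using i(2) by contradiction
  qed
  then show ?thesis using that i(1) by blast
qed

lemma P_nonzero:
  assumes k: "k \<in> J"
  obtains h where "h \<in> H" "P k h \<noteq> 0"
proof -
  obtain i where i: "i \<in> I" "src i = k" by (rule src_onto[OF k])
  obtain h where h: "h \<in> H" "T i h \<noteq> 0" by (rule T_nonzero[OF i(1)])
  then have "T i (P k h) \<noteq> 0" using T_P[OF i(1) k h(1)] i(2) by simp
  then have "P k h \<noteq> 0" using operators_zero[OF T_op[OF i(1)] H] by auto
  then show ?thesis using that h(1) by blast
qed

lemma P_eq_iff:
  assumes "k \<in> J" "l \<in> J"
  shows "(\<forall>h\<in>H. P k h = P l h) \<longleftrightarrow> k = l"
proof
  assume eq: "\<forall>h\<in>H. P k h = P l h"
  show "k = l"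
  proof (rule ccontr)
    assume "k \<noteq> l"
    obtain h where h: "h \<in> H" "P k h \<noteq> 0" by (rule P_nonzero[OF assms(1)])
    have "P k h = P k (P l h)" using eq h(1) P_idem[OF assms(1) h(1)] by simp
    then show False using P_orth[OF assms \<open>k \<noteq> l\<close> h(1)] h(2) by simp
  qed
qed simp

end

section \<open>Uniqueness: the Gram matrix of a dilation\<close>

locale pi_dilation = stabilized_tuple n H T J P
  for n :: enat and H :: "'a::complex_hilbert set" and T :: "nat \<Rightarrow> 'a \<Rightarrow> 'a"
    and J :: "'k set" and P :: "'k \<Rightarrow> 'a \<Rightarrow> 'a" +
  fixes K :: "'b::complex_hilbert set" and V :: "'a \<Rightarrow> 'b" and S :: "nat \<Rightarrow> 'b \<Rightarrow> 'b"
  assumes dilation: "minimal_pi_dilation n H T K V S"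
    and induces: "induces_family n H J P K V S"
begin

abbreviation "Sadj i \<equiv> adjoint_op K K (S i)"
abbreviation "Q i \<equiv> star_left K (S i)"

lemma K: "hilbert_space K"
  using dilation unfolding minimal_pi_dilation_def by blast

lemma dagger: "dagger_relations n K S"
  using dilation unfolding minimal_pi_dilation_def by blast

lemma V_op: "V \<in> operators H K"
  using dilation unfolding minimal_pi_dilation_def isometric_embedding_def by blast

lemma V_K [simp]: "h \<in> H \<Longrightarrow> V h \<in> K"
  using operatorsD(1)[OF V_op] .

lemma V_inner: "g \<in> H \<Longrightarrow> h \<in> H \<Longrightarrow> cinner (V g) (V h) = cinner g h"
  using dilation unfolding minimal_pi_dilation_def isometric_embedding_def by blast

lemma V_eq_zero: "h \<in> H \<Longrightarrow> V h = 0 \<longleftrightarrow> h = 0"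
  using V_inner[of h h] cinner_self_eq_zero[of h] cinner_self_eq_zero[of "V h"] by simp

lemma V_inj:
  assumes "g \<in> H" "h \<in> H" "V g = V h"
  shows "g = h"
  using V_eq_zero[OF hilbert_spaceD(3)[OF H assms(1,2)]] operators_diff[OF V_op H assms(1,2)] assms(3)
  by simp

lemma S_op: "i \<in> I \<Longrightarrow> S i \<in> operators K K"
  using dagger by (simp add: dagger_relations_def operator_tuple_def)

lemma S_K [simp]: "i \<in> I \<Longrightarrow> x \<in> K \<Longrightarrow> S i x \<in> K"
  using operatorsD(1)[OF S_op] .

lemma Sadj_op: "i \<in> I \<Longrightarrow> Sadj i \<in> operators K K"
  by (rule adjoint_operator[OF S_op K K])

lemma Sadj_K [simp]: "i \<in> I \<Longrightarrow> x \<in> K \<Longrightarrow> Sadj i x \<in> K"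
  using operatorsD(1)[OF Sadj_op] .

lemma S_adjoint: "i \<in> I \<Longrightarrow> x \<in> K \<Longrightarrow> y \<in> K \<Longrightarrow> cinner (S i x) y = cinner x (Sadj i y)"
  using adjoint_op_props(2)[OF S_op K] .

lemma Sadj_adjoint: "i \<in> I \<Longrightarrow> x \<in> K \<Longrightarrow> y \<in> K \<Longrightarrow> cinner (Sadj i x) y = cinner x (S i y)"
  using S_adjoint[of i y x] cinner_commute[of "Sadj i x" y] cinner_commute[of x "S i y"] by simp

lemma Sadj_V: "i \<in> I \<Longrightarrow> h \<in> H \<Longrightarrow> Sadj i (V h) = V (Tadj i h)"
  using dilation unfolding minimal_pi_dilation_def by blast

lemma Q_eq: "x \<in> K \<Longrightarrow> Q i x = Sadj i (S i x)"
  by (simp add: star_left_def compose_eq)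

lemma Q_K [simp]: "i \<in> I \<Longrightarrow> x \<in> K \<Longrightarrow> Q i x \<in> K"
  by (simp add: Q_eq)

lemma Q_idem:
  assumes "i \<in> I" "x \<in> K"
  shows "Q i (Q i x) = Q i x"
proof -
  have "compose K (Q i) (Q i) = Q i"
    using dagger assms(1) by (simp add: dagger_relations_def)
  then have "compose K (Q i) (Q i) x = Q i x" by simp
  then show ?thesis using assms(2) by (simp add: compose_eq)
qed

text \<open>An operator with idempotent \<open>S\<^sup>* S\<close> is a partial isometry.\<close>

lemma S_Q:
  assumes i: "i \<in> I" and x: "x \<in> K"
  shows "S i (Q i x) = S i x"
proof -
  let ?z = "x - Q i x"
  have z: "?z \<in> K" using hilbert_spaceD(3)[OF K x Q_K[OF i x]] .
  have "S i ?z = S i x - S i (Q i x)" by (rule operators_diff[OF S_op[OF i] K x Q_K[OF i x]])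
  then have "Sadj i (S i ?z) = Sadj i (S i x) - Sadj i (S i (Q i x))"
    using operators_diff[OF Sadj_op[OF i] K] S_K[OF i] x Q_K[OF i x] by simp
  also have "\<dots> = Q i x - Q i (Q i x)" using x Q_K[OF i x] by (simp add: Q_eq)
  finally have "Sadj i (S i ?z) = 0" using Q_idem[OF i x] by simp
  then have "cinner (S i ?z) (S i ?z) = 0"
    using S_adjoint[OF i z S_K[OF i z]] by simp
  then have "S i ?z = 0" by (simp add: cinner_self_eq_zero)
  then show ?thesis using operators_diff[OF S_op[OF i] K x Q_K[OF i x]] by simp
qed

text \<open>
  The range projections \<open>S\<^sub>i S\<^sub>i\<^sup>*\<close> have a sum bounded by the identity and are therefore mutually
  orthogonal.
\<close>

lemma Sadj_S_distinct:
  assumes ij: "i \<in> I" "j \<in> I" "i \<noteq> j" and x: "x \<in> K"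
  shows "Sadj i (S j x) = 0"
proof -
  obtain A where A: "sot_sum K (\<lambda>i. star_right K (S i)) I A" "op_le K A (id_op K)"
    using dagger by (auto simp: dagger_relations_def row_contraction_def)
  have E: "star_right K (S i) y = S i (Sadj i y)" if "y \<in> K" for i y
    using that by (simp add: star_right_def compose_eq)
  have part: "S i (Sadj i (S i y)) = S i y" if "i \<in> I" "y \<in> K" for i y
    using S_Q[OF that] Q_eq[OF that(2)] by simp
  have "star_right K (S i) (star_right K (S j) (S j x)) = 0"
  proof (rule orthogonal_of_sum_le_one[where I = I and M = K and E = "\<lambda>i. star_right K (S i)",
        OF _ _ _ _ A(2) ij])
    show "star_right K (S i) y \<in> K" if "i \<in> I" "y \<in> K" for i y
      using that by (simp add: E)
    show "star_right K (S i) (star_right K (S i) y) = star_right K (S i) y" if "i \<in> I" "y \<in> K" for i y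
      using that part by (simp add: E)
    show "((\<lambda>i. star_right K (S i) y) has_sum A y) I" if "y \<in> K" for y
      using A(1) that by (simp add: sot_sum_def)
    show "cinner y (star_right K (S i) y) = complex_of_real ((norm (star_right K (S i) y))\<^sup>2)"
      if "i \<in> I" "y \<in> K" for i y
    proof -
      have "cinner (S i (Sadj i y)) (S i (Sadj i y)) = cinner (Sadj i y) (Sadj i (S i (Sadj i y)))"
        using that by (simp add: S_adjoint)
      also have "\<dots> = cinner y (S i (Sadj i y))"
        using that part by (simp add: Sadj_adjoint)
      finally show ?thesis using that by (simp add: E cinner_self del: of_real_power)
    qed
    show "S j x \<in> K" using ij x by simp
  qed
  then have zero: "S i (Sadj i (S j x)) = 0" using part[OF ij(2) x] ij x by (simp add: E)
  let ?u = "Sadj i (S j x)"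
  have "cinner ?u ?u = cinner (S j x) (S i ?u)"
    using ij x by (simp add: Sadj_adjoint)
  then show ?thesis using zero by (simp add: cinner_self_eq_zero)
qed

text \<open>
  Compressing \<open>S\<^sub>i = S\<^sub>i Q\<^sub>i\<close> to \<open>H\<close> gives \<open>T\<^sub>i = T\<^sub>i P\<^sub>k\<close> for the \<open>k\<close> with \<open>Q\<^sub>i|\<^sub>H = P\<^sub>k\<close>.
\<close>

lemma Q_V:
  assumes i: "i \<in> I" and h: "h \<in> H"
  shows "Q i (V h) = V (P (src i) h)"
proof -
  have "compose H (Q i) V \<in> (\<lambda>k. compose H V (P k)) ` J"
    using induces i unfolding induces_family_def by blast
  then obtain k where k: "k \<in> J" and eq: "compose H (Q i) V = compose H V (P k)" by blast
  have QV: "Q i (V g) = V (P k g)" if "g \<in> H" for g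
    using fun_cong[OF eq, of g] that by (simp add: compose_eq)
  have comp: "cinner (T i g) h' = cinner (S i (V g)) (V h')" if "g \<in> H" "h' \<in> H" for g h'
    using that i by (simp add: S_adjoint Sadj_V V_inner T_adjoint)
  have "k = src i"
  proof (rule src_eqI[OF i k])
    fix g assume g: "g \<in> H"
    have "cinner (T i (P k g)) h' = cinner (T i g) h'" if h': "h' \<in> H" for h'
      using comp[OF P_H[OF k g] h'] comp[OF g h'] S_Q[OF i V_K[OF g]] QV[OF g] by simp
    then have "cinner h' (T i (P k g)) = cinner h' (T i g)" if "h' \<in> H" for h'
      using that cinner_commute[of h' "T i g"] cinner_commute[of h' "T i (P k g)"] by simp
    then show "T i (P k g) = T i g"
      using i k g by (intro H_eqI) auto
  qed
  then show ?thesis using QV[OF h] by simp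
qed

lemma Q_self_adjoint: "i \<in> I \<Longrightarrow> x \<in> K \<Longrightarrow> y \<in> K \<Longrightarrow> cinner (Q i x) y = cinner x (Q i y)"
  by (simp add: Q_eq S_adjoint Sadj_adjoint)

text \<open>
  Any two of the \<open>Q\<^sub>i\<close> are equal or orthogonal, and their restrictions to \<open>H\<close>, which are non-zero,
  tell which of the two is the case.
\<close>

lemma src_eq_imp_Q_eq:
  assumes "i \<in> I" "j \<in> I" "src i = src j" "x \<in> K"
  shows "Q i x = Q j x"
proof -
  obtain h where h: "h \<in> H" "P (src i) h \<noteq> 0" by (rule P_nonzero[OF src_J[OF assms(1)]])
  have "Q i (Q j (V h)) = V (P (src i) h)"
    using assms h Q_V P_idem by simp
  then have "Q i (Q j (V h)) \<noteq> 0"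
    using V_eq_zero[of "P (src i) h"] assms(1) h by simp
  then have "compose K (Q i) (Q j) (V h) \<noteq> zero_op K (V h)"
    using h(1) by (simp add: compose_eq zero_op_def)
  then have "compose K (Q i) (Q j) \<noteq> zero_op K" by auto
  moreover have "compose K (Q i) (Q j) = zero_op K \<or> Q i = Q j"
    using dagger assms(1,2) unfolding dagger_relations_def by blast
  ultimately show ?thesis by simp
qed

lemma src_ne_imp_Q_orth:
  assumes "i \<in> I" "j \<in> I" "src i \<noteq> src j" "x \<in> K"
  shows "Q i (Q j x) = 0"
proof -
  have "Q i \<noteq> Q j"
  proof
    assume eq: "Q i = Q j"
    have "P (src i) h = P (src j) h" if h: "h \<in> H" for h
      using V_inj[of "P (src i) h" "P (src j) h"] Q_V[OF assms(1) h] Q_V[OF assms(2) h] eq assms(1,2) h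
      by simp
    then show False using P_eq_iff[of "src i" "src j"] assms by simp
  qed
  then have "compose K (Q i) (Q j) = zero_op K"
    using dagger assms(1,2) unfolding dagger_relations_def by blast
  then have "compose K (Q i) (Q j) x = 0" using assms(4) by (simp add: zero_op_def)
  then show ?thesis using assms(4) by (simp add: compose_eq)
qed

text \<open>
  The range of \<open>S\<^sub>j\<close> lies under some \<open>Q\<^sub>l\<close>. Compressing \<open>S\<^sub>j = Q\<^sub>l S\<^sub>j\<close> to \<open>H\<close> identifies the
  source of \<open>l\<close> as the target of \<open>j\<close>.
\<close>

lemma Q_S:
  assumes i: "i \<in> I" and j: "j \<in> I" and x: "x \<in> K"
  shows "Q i (S j x) = (if src i = tgt j then S j x else 0)"
proof -
  obtain l where l: "l \<in> I" and le: "op_le K (star_right K (S j)) (Q l)"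
    using dagger j unfolding dagger_relations_def by blast
  \<comment> \<open>\<open>S\<^sub>j S\<^sub>j\<^sup>* \<le> Q\<^sub>l\<close> at the vector \<open>z = y - Q\<^sub>l y\<close> reads \<open>\<parallel>S\<^sub>j\<^sup>* z\<parallel>\<^sup>2 \<le> \<langle>z, Q\<^sub>l z\<rangle> = 0\<close>.\<close>
  have Sadj_kill: "Sadj j (y - Q l y) = 0" if y: "y \<in> K" for y
  proof -
    let ?z = "y - Q l y"
    have z: "?z \<in> K" using hilbert_spaceD(3)[OF K y Q_K[OF l y]] .
    have Qlin: "Q l ?z = Q l y - Q l (Q l y)"
      using operators_diff[OF S_op[OF l] K y Q_K[OF l y]]
        operators_diff[OF Sadj_op[OF l] K S_K[OF l y] S_K[OF l Q_K[OF l y]]] z y l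
      by (simp add: Q_eq)
    then have "Q l ?z = 0" using Q_idem[OF l y] by simp
    then have "cinner ?z (0 - S j (Sadj j ?z)) \<in> \<real>\<^sub>\<ge>\<^sub>0"
      using le z unfolding op_le_def by (auto simp: star_right_def compose_eq dest: bspec[of _ _ ?z])
    then have "- cinner ?z (S j (Sadj j ?z)) \<in> \<real>\<^sub>\<ge>\<^sub>0" by simp
    moreover have "cinner ?z (S j (Sadj j ?z)) = complex_of_real ((norm (Sadj j ?z))\<^sup>2)"
      using Sadj_adjoint[OF j z Sadj_K[OF j z]] by (simp add: cinner_self del: of_real_power)
    ultimately have "- complex_of_real ((norm (Sadj j ?z))\<^sup>2) \<in> \<real>\<^sub>\<ge>\<^sub>0" by simp
    then show ?thesis by (simp add: complex_nonneg_Reals_iff del: of_real_power)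
  qed
  have SQ: "Sadj j (Q l y) = Sadj j y" if "y \<in> K" for y
    using Sadj_kill[OF that] operators_diff[OF Sadj_op[OF j] K that Q_K[OF l that]] by simp
  have QS: "Q l (S j y) = S j y" if y: "y \<in> K" for y
  proof -
    let ?d = "S j y - Q l (S j y)"
    have Sy: "S j y \<in> K" "Q l (S j y) \<in> K" using j l y by auto
    have d: "?d \<in> K" using hilbert_spaceD(3)[OF K Sy] .
    have "cinner ?d (S j y) = cinner (Sadj j ?d) y" using Sadj_adjoint[OF j d y] by simp
    then have "cinner ?d (S j y) = 0" using Sadj_kill[OF Sy(1)] by simp
    moreover have "cinner ?d (Q l (S j y)) = cinner (Q l ?d) (S j y)"
      using Q_self_adjoint[OF l d Sy(1)] by simp
    moreover have "Sadj j (Q l ?d) = 0" using SQ[OF d] Sadj_kill[OF Sy(1)] by simp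
    then have "cinner (Q l ?d) (S j y) = 0"
      using Sadj_adjoint[OF j Q_K[OF l d] y] by simp
    ultimately have "cinner ?d ?d = 0" by (simp add: cinner_diff_right)
    then show ?thesis by (simp add: cinner_self_eq_zero)
  qed
  have "src l = tgt j"
  proof (rule tgt_eqI[OF j src_J[OF l]])
    fix h assume h: "h \<in> H"
    have "Tadj j (P (src l) g) = Tadj j g" if g: "g \<in> H" for g
    proof (rule V_inj)
      show "V (Tadj j (P (src l) g)) = V (Tadj j g)"
        using SQ[OF V_K[OF g]] j l g by (simp add: Q_V Sadj_V)
    qed (use j l g in auto)
    then have "cinner (P (src l) (T j h)) g = cinner (T j h) g" if "g \<in> H" for g
      using that j l h by (simp add: P_adjoint T_adjoint)
    then have "cinner g (P (src l) (T j h)) = cinner g (T j h)" if "g \<in> H" for g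
      using that cinner_commute[of g "P (src l) (T j h)"] cinner_commute[of g "T j h"] by simp
    then show "P (src l) (T j h) = T j h"
      using j l h by (intro H_eqI) auto
  qed
  then show ?thesis
    using src_eq_imp_Q_eq[OF i l _ S_K[OF j x]] src_ne_imp_Q_orth[OF i l _ S_K[OF j x]] QS[OF x]
    by auto
qed

lemma word_K [simp]: "set w \<subseteq> I \<Longrightarrow> h \<in> H \<Longrightarrow> foldr S w (V h) \<in> K"
  by (induction w) auto

lemma K_closed_span:
  "K = closure (complex_vector.span ((\<lambda>(w, h). foldr S w (V h)) ` {(w, h). set w \<subseteq> I \<and> h \<in> H}))"
proof -
  have eq: "(\<lambda>(w, h). foldr S w (V h)) ` {(w, h). set w \<subseteq> I \<and> h \<in> H} =
      V ` H \<union> {foldr S w (V h) | w h. w \<noteq> [] \<and> set w \<subseteq> I \<and> h \<in> H}" (is "?L = ?R")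
  proof
    show "?L \<subseteq> ?R"
    proof
      fix x assume "x \<in> ?L"
      then obtain w h where wh: "x = foldr S w (V h)" "set w \<subseteq> I" "h \<in> H" by auto
      then show "x \<in> ?R" by (cases "w = []") auto
    qed
    show "?R \<subseteq> ?L"
    proof
      fix x assume "x \<in> ?R"
      then obtain w h where wh: "x = foldr S w (V h)" "set w \<subseteq> I" "h \<in> H"
        by (auto intro: that[of "[]"])
      then show "x \<in> ?L" by (auto intro!: image_eqI[of _ _ "(w, h)"])
    qed
  qed
  show ?thesis
    unfolding eq using dilation unfolding minimal_pi_dilation_def by blast
qed

end

text \<open>
  The relations reduce the inner product of two words to that of shorter ones, and eventually
  to inner products in \<open>H\<close>, by steps that depend on \<open>T\<close> and on the source and target maps only.
\<close>

lemma (in stabilized_tuple) gram_unique: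
  assumes "pi_dilation n H T J P K V S" "pi_dilation n H T J P K' V' S'"
    and "set w \<subseteq> I" "set v \<subseteq> I" "g \<in> H" "h \<in> H"
  shows "cinner (foldr S w (V g)) (foldr S v (V h)) = cinner (foldr S' w (V' g)) (foldr S' v (V' h))"
proof -
  interpret D: pi_dilation n H T J P K V S by (rule assms(1))
  interpret D': pi_dilation n H T J P K' V' S' by (rule assms(2))
  show ?thesis
    using assms(3-)
  proof (induction w arbitrary: v g h)
    case Nil
    then show ?case
    proof (induction v arbitrary: g)
      case Nil
      then show ?case by (simp add: D.V_inner D'.V_inner)
    next
      case (Cons j v)
      have "cinner (V g) (S j (foldr S v (V h))) = cinner (V (Tadj j g)) (foldr S v (V h))"
        using Cons.prems by (simp add: D.Sadj_adjoint[symmetric] D.Sadj_V)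
      moreover have "cinner (V' g) (S' j (foldr S' v (V' h))) = cinner (V' (Tadj j g)) (foldr S' v (V' h))"
        using Cons.prems by (simp add: D'.Sadj_adjoint[symmetric] D'.Sadj_V)
      ultimately show ?case using Cons.IH[of "Tadj j g"] Cons.prems by simp
    qed
  next
    case (Cons i w)
    then have i: "i \<in> I" and w: "set w \<subseteq> I" by auto
    show ?case
    proof (cases v)
      case Nil
      then show ?thesis
        using Cons.IH[of "[]" g "Tadj i h"] Cons.prems
        by (simp add: D.S_adjoint D'.S_adjoint D.Sadj_V D'.Sadj_V)
    next
      case (Cons j v')
      then have j: "j \<in> I" and v': "set v' \<subseteq> I" using \<open>set v \<subseteq> I\<close> by auto
      show ?thesis
      proof (cases "i = j")
        case False
        then show ?thesis
          using Cons i j w v' \<open>g \<in> H\<close> \<open>h \<in> H\<close>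
          by (simp add: D.S_adjoint D'.S_adjoint D.Sadj_S_distinct D'.Sadj_S_distinct)
      next
        case True
        have "cinner (foldr S (i # w) (V g)) (foldr S v (V h)) =
            cinner (foldr S w (V g)) (D.Q i (foldr S v' (V h)))"
          using Cons True i w v' \<open>g \<in> H\<close> \<open>h \<in> H\<close> by (simp add: D.S_adjoint D.Q_eq)
        moreover have "cinner (foldr S' (i # w) (V' g)) (foldr S' v (V' h)) =
            cinner (foldr S' w (V' g)) (D'.Q i (foldr S' v' (V' h)))"
          using Cons True i w v' \<open>g \<in> H\<close> \<open>h \<in> H\<close> by (simp add: D'.S_adjoint D'.Q_eq)
        moreover have "cinner (foldr S w (V g)) (D.Q i (foldr S v' (V h))) =
            cinner (foldr S' w (V' g)) (D'.Q i (foldr S' v' (V' h)))"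
        proof (cases v')
          case Nil
          then show ?thesis
            using Cons.IH[of "[]" g "P (src i) h"] i w \<open>g \<in> H\<close> \<open>h \<in> H\<close>
            by (simp add: D.Q_V D'.Q_V)
        next
          case (Cons l u)
          then show ?thesis
            using Cons.IH[of v' g h] i w v' \<open>g \<in> H\<close> \<open>h \<in> H\<close>
            by (simp add: D.Q_S D'.Q_S)
        qed
        ultimately show ?thesis by simp
      qed
    qed
  qed
qed

theorem (in stabilized_tuple) dilation_unique:
  assumes "pi_dilation n H T J P K V S" "pi_dilation n H T J P K' V' S'"
  shows "\<exists>U. unitary_op K K' U \<and> (\<forall>h\<in>H. U (V h) = V' h) \<and>
    (\<forall>i\<in>I. compose K (adjoint_op K K' U) (compose K (S' i) U) = S i)"
proof -
  interpret D: pi_dilation n H T J P K V S by (rule assms(1))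
  interpret D': pi_dilation n H T J P K' V' S' by (rule assms(2))
  let ?W = "{(w, h). set w \<subseteq> I \<and> h \<in> H}"
  let ?x = "\<lambda>(w, h). foldr S w (V h)" and ?y = "\<lambda>(w, h). foldr S' w (V' h)"
  obtain U where U: "unitary_op K K' U" "\<And>p. p \<in> ?W \<Longrightarrow> U (?x p) = ?y p"
    and inv: "\<And>u. u \<in> K \<Longrightarrow> adjoint_op K K' U (U u) = u"
  proof (rule unitary_of_equal_gram[OF _ D.K_closed_span D'.K_closed_span])
    show "cinner (?x p) (?x q) = cinner (?y p) (?y q)" if "p \<in> ?W" "q \<in> ?W" for p q
      using gram_unique[OF assms, of "fst p" "fst q" "snd p" "snd q"] that by (auto simp: case_prod_beta)
  qed blast
  have Uop: "U \<in> operators K K'" using U(1) by (simp add: unitary_op_def)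
  have word: "U (foldr S w (V h)) = foldr S' w (V' h)" if "set w \<subseteq> I" "h \<in> H" for w h
    using U(2)[of "(w, h)"] that by simp
  have "compose K (adjoint_op K K' U) (compose K (S' i) U) = S i" if i: "i \<in> I" for i
  proof -
    have eq: "compose K U (S i) x = compose K (S' i) U x" if "x \<in> K" for x
    proof (rule operators_eq_on_closed_span[OF _ _ D.K_closed_span _ that])
      show "compose K U (S i) \<in> operators K K'"
        by (rule compose_operator[OF D.S_op[OF i] Uop D.K])
      show "compose K (S' i) U \<in> operators K K'"
        by (rule compose_operator[OF Uop D'.S_op[OF i] D.K])
      fix z assume "z \<in> ?x ` ?W"
      then obtain w h where wh: "set w \<subseteq> I" "h \<in> H" and z: "z = foldr S w (V h)" by auto
      show "compose K U (S i) z = compose K (S' i) U z"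
        unfolding z using word[of "i # w" h] word[of w h] wh i by (simp add: compose_eq)
    qed
    show ?thesis
    proof (rule extensionalityI[of _ K])
      show "compose K (adjoint_op K K' U) (compose K (S' i) U) x = S i x" if "x \<in> K" for x
        using eq[OF that] inv[OF D.S_K[OF i that]] that by (simp add: compose_eq)
    qed (use operatorsD(4)[OF D.S_op[OF i]] in simp_all)
  qed
  moreover have "\<forall>h\<in>H. U (V h) = V' h" using word[of "[]"] by simp
  ultimately show ?thesis using U(1) by blast
qed

section \<open>Existence: from relations between operators to a dilation\<close>

lemma image_comp_onto:
  assumes "\<And>k. k \<in> J \<Longrightarrow> \<exists>i\<in>I. f i = k" "\<And>i. i \<in> I \<Longrightarrow> f i \<in> J"
  shows "(\<lambda>i. g (f i)) ` I = g ` J"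
  using assms by (auto simp: image_iff)

context stabilized_tuple
begin

text \<open>
  The relations satisfied by a dilation determine how the operators act on the words
  \<open>S\<^bsub>w\<^esub> V h\<close>: the closed span of these vectors is invariant under all \<open>S\<^sub>i\<close>, \<open>S\<^sub>i\<^sup>*\<close> and
  \<open>Q\<^sub>k\<close>, so that restricting to it turns any solution of the relations into a minimal one.
\<close>

lemma dilation_of_relations:
  fixes S Sa :: "nat \<Rightarrow> 'b::complex_hilbert \<Rightarrow> 'b" and Q :: "'k \<Rightarrow> 'b \<Rightarrow> 'b"
    and V :: "'a \<Rightarrow> 'b" and Va :: "'b \<Rightarrow> 'a"
  assumes S_adj: "\<And>i. i \<in> I \<Longrightarrow> adjoint_pair (S i) (Sa i)"
    and Q_adj: "\<And>k. k \<in> J \<Longrightarrow> adjoint_pair (Q k) (Q k)"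
    and V_adj: "adjoint_pair V Va" and Va_V: "\<And>h. Va (V h) = h"
    and Sa_S: "\<And>i j x. i \<in> I \<Longrightarrow> j \<in> I \<Longrightarrow> Sa i (S j x) = (if i = j then Q (src i) x else 0)"
    and Q_Q: "\<And>k l x. k \<in> J \<Longrightarrow> l \<in> J \<Longrightarrow> Q k (Q l x) = (if k = l then Q k x else 0)"
    and Q_S: "\<And>k i x. k \<in> J \<Longrightarrow> i \<in> I \<Longrightarrow> Q k (S i x) = (if k = tgt i then S i x else 0)"
    and Q_V: "\<And>k h. k \<in> J \<Longrightarrow> h \<in> H \<Longrightarrow> Q k (V h) = V (P k h)"
    and Sa_V: "\<And>i h. i \<in> I \<Longrightarrow> h \<in> H \<Longrightarrow> Sa i (V h) = V (Tadj i h)"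
  shows "\<exists>(K :: 'b set) V S. minimal_pi_dilation n H T K V S \<and> induces_family n H J P K V S"
proof -
  have V_inner: "cinner (V g) (V h) = cinner g h" for g h
    using adjoint_pairD[OF V_adj, of g "V h"] Va_V by simp
  have V_norm: "norm (V h) = norm h" for h
    using V_inner[of h h] unfolding cinner_self of_real_eq_iff by simp
  have V_linear: "bounded_linear V"
    using adjoint_pair_linear[OF V_adj] V_norm
    by (intro bounded_linear_intro[where K = 1]) (simp_all add: linear_add linear_scale)
  have V_zero: "V h = 0 \<longleftrightarrow> h = 0" for h
    using V_norm[of h] by (metis norm_eq_zero)
  have Q_norm: "norm (Q k x) \<le> norm x" if "k \<in> J" for k x
    using that by (intro norm_projection_le Q_adj) (simp_all add: Q_Q)
  have S_norm: "norm (S i x) \<le> norm x" if "i \<in> I" for i x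
    using that by (intro norm_le_of_star[OF S_adj]) (simp_all add: Sa_S Q_norm)
  have Sa_norm: "norm (Sa i x) \<le> norm x" if "i \<in> I" for i x
    by (rule norm_adjoint_le[OF S_adj[OF that] S_norm[OF that]])
  have S_Q: "S i (Q (src i) x) = S i x" if i: "i \<in> I" for i x
  proof -
    have "Sa i (S i (Q (src i) x - x)) = 0"
      using i by (simp add: Sa_S adjoint_pair_diff[OF Q_adj] Q_Q)
    then have "cinner (S i (Q (src i) x - x)) (S i (Q (src i) x - x)) = 0"
      using adjoint_pairD[OF S_adj[OF i]] by simp
    then show ?thesis
      by (simp add: cinner_self_eq_zero adjoint_pair_diff[OF S_adj[OF i]])
  qed
  have Sa_tgt: "Sa i (Q (tgt i) x) = Sa i x" if i: "i \<in> I" for i x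
  proof (rule cinner_eqI)
    fix y
    have "cinner y (Sa i (Q (tgt i) x)) = cinner (Q (tgt i) (S i y)) x"
      using adjoint_pairD[OF S_adj[OF i]] adjoint_pairD[OF Q_adj[OF tgt_J[OF i]]] by simp
    then show "cinner y (Sa i (Q (tgt i) x)) = cinner y (Sa i x)"
      using adjoint_pairD[OF S_adj[OF i]] Q_S[OF tgt_J[OF i] i] by simp
  qed

  let ?X = "V ` H \<union> {foldr S w (V h) | w h. w \<noteq> [] \<and> set w \<subseteq> I \<and> h \<in> H}"
  define K where "K = closure (complex_vector.span ?X)"
  have K: "hilbert_space K" unfolding K_def by (rule hilbert_space_closed_span)
  have gen: "x \<in> K" if "x \<in> ?X" for x
    using subsetD[OF subset_closed_span that] by (simp add: K_def)
  have VK: "V h \<in> K" if "h \<in> H" for h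
    using gen that by blast
  have wordK: "foldr S w (V h) \<in> K" if "set w \<subseteq> I" "h \<in> H" for w h
  proof (cases "w = []")
    case True
    then show ?thesis using VK that(2) by simp
  next
    case False
    then have "\<exists>w' h'. foldr S w (V h) = foldr S w' (V h') \<and> w' \<noteq> [] \<and> set w' \<subseteq> I \<and> h' \<in> H"
      using that by (intro exI[of _ w] exI[of _ h]) simp
    then show ?thesis by (intro gen UnI2 CollectI)
  qed
  have X_cases: "(\<exists>h\<in>H. x = V h) \<or> (\<exists>i w h. i \<in> I \<and> set w \<subseteq> I \<and> h \<in> H \<and> x = S i (foldr S w (V h)))"
    if "x \<in> ?X" for x
  proof -
    from that consider h where "h \<in> H" "x = V h"
      | w h where "w \<noteq> []" "set w \<subseteq> I" "h \<in> H" "x = foldr S w (V h)"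
      by (elim UnE imageE CollectE exE conjE) (rule that(1), simp_all)
    then show ?thesis
    proof cases
      case (2 w h)
      then obtain i u where "w = i # u" by (cases w) auto
      then have "i \<in> I" "set u \<subseteq> I" "x = S i (foldr S u (V h))" using 2 by simp_all
      then show ?thesis using 2(3) by blast
    qed blast
  qed
  have K_zero: "0 \<in> K" by (rule hilbert_spaceD(1)[OF K])
  have invariant: "f x \<in> K"
    if f: "adjoint_pair f g" "\<And>x. norm (f x) \<le> norm x" and fX: "\<And>x. x \<in> ?X \<Longrightarrow> f x \<in> K" and x: "x \<in> K"
    for f g x
  proof -
    have "restrict f UNIV \<in> operators UNIV UNIV"
      by (rule restrict_operator[where C = 1])
         (use f adjoint_pair_add[OF f(1)] adjoint_pair_scaleC[OF f(1)] hilbert_space_UNIV in auto)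
    then have "hilbert_space {x \<in> UNIV. restrict f UNIV x \<in> K}"
      by (rule hilbert_space_preimage[OF _ hilbert_space_UNIV K])
    then have "K \<subseteq> {x \<in> UNIV. restrict f UNIV x \<in> K}"
      unfolding K_def using fX by (intro closed_span_minimal) (auto simp: K_def)
    then show ?thesis using x by auto
  qed
  have SK: "S i x \<in> K" if i: "i \<in> I" and x: "x \<in> K" for i x
  proof (rule invariant[OF S_adj[OF i] S_norm[OF i] _ x])
    fix y assume "y \<in> ?X"
    then show "S i y \<in> K"
      using X_cases[of y] wordK[of "[i]"] wordK[of "i # j # w" for j w] i by auto
  qed
  have QK: "Q k x \<in> K" if k: "k \<in> J" and x: "x \<in> K" for k x
  proof (rule invariant[OF Q_adj[OF k] Q_norm[OF k] _ x])
    fix y assume "y \<in> ?X"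
    then show "Q k y \<in> K"
      using X_cases[of y] wordK VK SK k K_zero by (auto simp: Q_V Q_S)
  qed
  have SaK: "Sa i x \<in> K" if i: "i \<in> I" and x: "x \<in> K" for i x
  proof (rule invariant[OF adjoint_pair_sym[OF S_adj[OF i]] Sa_norm[OF i] _ x])
    fix y assume "y \<in> ?X"
    then show "Sa i y \<in> K"
      using X_cases[of y] wordK VK QK i K_zero by (auto simp: Sa_V Sa_S)
  qed

  \<comment> \<open>The minimal dilation: \<open>R\<^sub>i\<close> is \<open>S\<^sub>i\<close> cut down to \<open>K\<close>, and \<open>W\<close> is the embedding of \<open>H\<close>.\<close>
  define R where "R i = restrict (S i) K" for i
  define W where "W = restrict V H"
  have R_op: "R i \<in> operators K K" if i: "i \<in> I" for i
    unfolding R_def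
    by (rule restrict_operator[where C = 1])
       (use SK[OF i] S_norm[OF i] K adjoint_pair_add[OF S_adj[OF i]] adjoint_pair_scaleC[OF S_adj[OF i]] in auto)
  have Q_op: "restrict (Q k) K \<in> operators K K" if k: "k \<in> J" for k
    by (rule restrict_operator[where C = 1])
       (use QK[OF k] Q_norm[OF k] K adjoint_pair_add[OF Q_adj[OF k]] adjoint_pair_scaleC[OF Q_adj[OF k]] in auto)
  have W_op: "W \<in> operators H K"
    unfolding W_def
    by (rule restrict_operator[where C = 1])
       (use VK V_norm H adjoint_pair_add[OF V_adj] adjoint_pair_scaleC[OF V_adj] in auto)
  have R_adj: "adjoint_op K K (R i) y = Sa i y" if i: "i \<in> I" and y: "y \<in> K" for i y
    using adjoint_pairD[OF S_adj[OF i]] SaK[OF i y]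
    by (intro adjoint_op_eqI[OF R_op[OF i] K y]) (simp_all add: R_def)
  have left: "star_left K (R i) = restrict (Q (src i)) K" if i: "i \<in> I" for i
  proof
    fix x
    have "R i x = S i x" if "x \<in> K" using that by (simp add: R_def)
    then show "star_left K (R i) x = restrict (Q (src i)) K x"
      using i by (cases "x \<in> K") (simp_all add: star_left_def compose_def R_adj SK Sa_S)
  qed
  have right: "star_right K (R i) x = S i (Sa i x)" if "i \<in> I" "x \<in> K" for i x
  proof -
    have "star_right K (R i) x = R i (Sa i x)"
      using that by (simp add: star_right_def compose_eq R_adj)
    then show ?thesis using SaK[OF that] by (simp add: R_def)
  qed
  have foldr_R: "foldr R w (W h) = foldr S w (V h)" if "set w \<subseteq> I" "h \<in> H" for w h
    using that(1)
  proof (induction w)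
    case (Cons i w)
    then show ?case using wordK[of w h] that(2) by (simp add: R_def)
  qed (simp add: W_def that(2))

  have src_tuple: "\<exists>i\<in>I. src i = k" if "k \<in> J" for k
    using src_onto[OF that] by blast
  have Q_distinct: "inj_on (\<lambda>k. restrict (Q k) K) J"
  proof (rule inj_onI)
    fix k l assume kl: "k \<in> J" "l \<in> J" and eq: "restrict (Q k) K = restrict (Q l) K"
    have "P k h = P l h" if h: "h \<in> H" for h
    proof -
      have "V (P k h) = V (P l h)"
        using fun_cong[OF eq, of "V h"] VK[OF h] Q_V[OF _ h] kl by simp
      then show ?thesis using Va_V by metis
    qed
    then show "k = l" using P_eq_iff[OF kl] by blast
  qed

  have op_tuple: "operator_tuple n K R"
    unfolding operator_tuple_def
  proof (intro ballI conjI)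
    fix i assume i: "i \<in> I"
    show "R i \<in> operators K K" by (rule R_op[OF i])
    show "R i \<noteq> zero_op K"
    proof
      assume eq: "R i = zero_op K"
      obtain h where h: "h \<in> H" "P (src i) h \<noteq> 0" by (rule P_nonzero[OF src_J[OF i]])
      have "S i (V h) = 0"
        using fun_cong[OF eq, of "V h"] VK[OF h(1)] by (simp add: R_def zero_op_def)
      then have "Q (src i) (V h) = 0"
        using Sa_S[OF i i, of "V h"] adjoint_pair_zero[OF adjoint_pair_sym[OF S_adj[OF i]]] by simp
      then show False using Q_V[OF src_J[OF i] h(1)] V_zero h(2) by simp
    qed
  qed

  have row: "row_contraction n K R"
  proof -
    let ?E = "\<lambda>i x. S i (Sa i x)"
    let ?N = "{x. ((\<lambda>i. ?E i x) has_sum x) I}"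
    have E: "adjoint_pair (?E i) (?E i)" if "i \<in> I" for i
      using adjoint_pair_compose[OF S_adj[OF that] adjoint_pair_sym[OF S_adj[OF that]]] .
    have orth: "?E i (?E j x) = (if i = j then ?E i x else 0)" if "i \<in> I" "j \<in> I" for i j x
      using that S_Q adjoint_pair_zero[OF S_adj[OF that(1)]] by (simp add: Sa_S)
    note N = hilbert_space_projections_sum[of I ?E, OF E orth]
    note proj = adjoint_pair_orth_proj[OF N]
    have proj_idem: "orth_proj ?N (orth_proj ?N x) = orth_proj ?N x" for x
      by (rule orth_proj_ident[OF N orth_proj_props(1)[OF N]])
    have sum: "((\<lambda>i. ?E i x) has_sum orth_proj ?N x) I" for x
      by (rule projections_has_sum_orth_proj[OF E orth])
    have projK: "orth_proj ?N x \<in> K" if x: "x \<in> K" for x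
    proof -
      have "((\<lambda>F. \<Sum>i\<in>F. ?E i x) \<longlongrightarrow> orth_proj ?N x) (finite_subsets_at_top I)"
        using sum by (simp add: has_sum_def)
      moreover have "\<forall>\<^sub>F F in finite_subsets_at_top I. (\<Sum>i\<in>F. ?E i x) \<in> K"
      proof (rule eventually_finite_subsets_at_top_weakI)
        show "(\<Sum>i\<in>F. ?E i x) \<in> K" if "finite F" "F \<subseteq> I" for F
          using that SK SaK x K_zero hilbert_spaceD(2)[OF K]
          by (induction F rule: finite_induct) auto
      qed
      ultimately show ?thesis
        by (intro Lim_in_closed_set[OF hilbert_spaceD(5)[OF K]]) auto
    qed
    have "restrict (orth_proj ?N) K \<in> operators K K"
    proof (rule restrict_operator[where C = 1])
      show "norm (orth_proj ?N x) \<le> 1 * norm x" for x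
        using norm_projection_le[OF proj proj_idem] by simp
    qed (use projK K adjoint_pair_add[OF proj] adjoint_pair_scaleC[OF proj] in auto)
    moreover have "((\<lambda>i. star_right K (R i) x) has_sum restrict (orth_proj ?N) K x) I" if "x \<in> K" for x
      using sum[of x] that right has_sum_cong[of I "\<lambda>i. star_right K (R i) x" "\<lambda>i. ?E i x"] by simp
    moreover have "op_le K (restrict (orth_proj ?N) K) (id_op K)"
      unfolding op_le_def
    proof
      fix x assume x: "x \<in> K"
      have "cinner x (x - orth_proj ?N x) = complex_of_real ((norm x)\<^sup>2 - (norm (orth_proj ?N x))\<^sup>2)"
        using cinner_projection[OF proj proj_idem] by (simp add: cinner_diff_right cinner_self)
      moreover have "(norm (orth_proj ?N x))\<^sup>2 \<le> (norm x)\<^sup>2"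
        using norm_projection_le[OF proj proj_idem] by (intro power_mono) auto
      ultimately have "cinner x (x - orth_proj ?N x) \<in> \<real>\<^sub>\<ge>\<^sub>0"
        by (simp only: nonneg_Reals_of_real_iff diff_ge_0_iff_ge)
      then show "cinner x (id_op K x - restrict (orth_proj ?N) K x) \<in> \<real>\<^sub>\<ge>\<^sub>0"
        using x by (simp add: id_op_def)
    qed
    ultimately show ?thesis
      unfolding row_contraction_def sot_sum_def by blast
  qed

  \<comment> \<open>\<open>S\<^sub>i\<^sup>* = S\<^sub>i\<^sup>* Q\<^bsub>tgt i\<^esub>\<close> and contractivity give \<open>\<parallel>S\<^sub>i\<^sup>* x\<parallel> \<le> \<parallel>Q\<^bsub>tgt i\<^esub> x\<parallel>\<close>.\<close>
  have dom: "op_le K (star_right K (R i)) (star_left K (R j))"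
    if i: "i \<in> I" and j: "j \<in> I" and eq: "src j = tgt i" for i j
    unfolding op_le_def
  proof
    fix x assume x: "x \<in> K"
    let ?k = "tgt i"
    have "cinner x (S i (Sa i x)) = cinner (Sa i x) (Sa i x)"
      using adjoint_pairD[OF adjoint_pair_sym[OF S_adj[OF i]], of x "Sa i x"] by simp
    moreover have "cinner x (Q ?k x) = complex_of_real ((norm (Q ?k x))\<^sup>2)"
      using i by (intro cinner_projection Q_adj) (simp_all add: Q_Q)
    ultimately have "cinner x (Q ?k x - S i (Sa i x)) =
        complex_of_real ((norm (Q ?k x))\<^sup>2 - (norm (Sa i x))\<^sup>2)"
      by (simp add: cinner_diff_right cinner_self)
    moreover have "(norm (Sa i x))\<^sup>2 \<le> (norm (Q ?k x))\<^sup>2"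
      using Sa_norm[OF i, of "Q ?k x"] Sa_tgt[OF i] by (intro power_mono) auto
    ultimately have "cinner x (Q ?k x - S i (Sa i x)) \<in> \<real>\<^sub>\<ge>\<^sub>0"
      by (simp only: nonneg_Reals_of_real_iff diff_ge_0_iff_ge)
    then show "cinner x (star_left K (R j) x - star_right K (R i) x) \<in> \<real>\<^sub>\<ge>\<^sub>0"
      using x i j eq by (simp add: left right)
  qed

  have left_image: "(\<lambda>i. star_left K (R i)) ` I = (\<lambda>k. restrict (Q k) K) ` J"
  proof -
    have "(\<lambda>i. star_left K (R i)) ` I = (\<lambda>i. restrict (Q (src i)) K) ` I"
      using left by (intro image_cong) auto
    also have "\<dots> = (\<lambda>k. restrict (Q k) K) ` J"
      using src_tuple by (intro image_comp_onto) auto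
    finally show ?thesis .
  qed

  have Q_sum: "((\<lambda>k. Q k x) has_sum x) J" if "x \<in> K" for x
  proof -
    have "?X \<subseteq> {x. ((\<lambda>k. Q k x) has_sum x) J}"
    proof
      fix x assume "x \<in> ?X"
      then consider h where "h \<in> H" "x = V h"
        | i y where "i \<in> I" "x = S i y"
        using X_cases[of x] by blast
      then show "x \<in> {x. ((\<lambda>k. Q k x) has_sum x) J}"
      proof cases
        case (1 h)
        have "((\<lambda>k. V (P k h)) has_sum V h) J"
          by (rule has_sum_bounded_linear[OF V_linear P_sum[OF 1(1)]])
        then show ?thesis
          using 1 Q_V has_sum_cong[of J "\<lambda>k. V (P k h)" "\<lambda>k. Q k (V h)"] by simp
      next
        case (2 i y)
        have "((\<lambda>k. if k = tgt i then x else 0) has_sum x) J"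
          using 2 by (intro has_sum_finite_neutralI[of "{tgt i}"]) auto
        then show ?thesis
          using 2 Q_S has_sum_cong[of J "\<lambda>k. if k = tgt i then x else 0" "\<lambda>k. Q k x"] by simp
      qed
    qed
    then have "K \<subseteq> {x. ((\<lambda>k. Q k x) has_sum x) J}"
      unfolding K_def by (rule closed_span_minimal[OF _ hilbert_space_projections_sum[OF Q_adj Q_Q]])
    then show ?thesis using that by blast
  qed

  have dagger: "dagger_relations n K R"
    unfolding dagger_relations_def
  proof (intro conjI ballI)
    show "operator_tuple n K R" "row_contraction n K R" by fact+
    show "compose K (star_left K (R i)) (star_left K (R i)) = star_left K (R i)" if i: "i \<in> I" for i
      using i by (auto simp: left compose_def fun_eq_iff QK Q_Q)
    show "compose K (star_left K (R i)) (star_left K (R j)) = zero_op K \<or> star_left K (R i) = star_left K (R j)"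
      if "i \<in> I" "j \<in> I" for i j
    proof (cases "src i = src j")
      case False
      then have "compose K (star_left K (R i)) (star_left K (R j)) = zero_op K"
        using that by (auto simp: left compose_def zero_op_def fun_eq_iff QK Q_Q)
      then show ?thesis ..
    qed (use that left in simp)
    show "\<exists>j\<in>I. op_le K (star_right K (R i)) (star_left K (R j))" if i: "i \<in> I" for i
      using src_tuple[OF tgt_J[OF i]] dom[OF i] by blast
    show "sot_sum K (\<lambda>Q. Q) ((\<lambda>i. star_left K (R i)) ` I) (id_op K)"
      unfolding sot_sum_def left_image
    proof (intro conjI ballI)
      show "id_op K \<in> operators K K" by (rule id_op_operator[OF K order_refl])
      fix x assume x: "x \<in> K"
      have "((\<lambda>k. restrict (Q k) K x) has_sum x) J" using Q_sum[OF x] x by simp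
      then show "((\<lambda>Q. Q x) has_sum id_op K x) ((\<lambda>k. restrict (Q k) K) ` J)"
        using x by (simp add: has_sum_reindex[OF Q_distinct] o_def id_op_def)
    qed
  qed

  have WH: "W ` H = V ` H" by (auto simp: W_def)
  have red: "reduces K (W ` H) (star_left K (R i))" if i: "i \<in> I" for i
    unfolding reduces_def WH
  proof
    show "star_left K (R i) ` V ` H \<subseteq> V ` H"
      using i VK by (auto simp: left Q_V)
    show "star_left K (R i) ` orthocomplement_in K (V ` H) \<subseteq> orthocomplement_in K (V ` H)"
    proof
      fix y assume "y \<in> star_left K (R i) ` orthocomplement_in K (V ` H)"
      then obtain x where x: "x \<in> K" "\<And>h. h \<in> H \<Longrightarrow> cinner (V h) x = 0" and y: "y = Q (src i) x"
        using i by (auto simp: orthocomplement_in_def left)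
      have "cinner (V h) y = 0" if h: "h \<in> H" for h
        using adjoint_pairD[OF Q_adj[OF src_J[OF i]], of "V h" x] x(2) h i by (simp add: y Q_V)
      then show "y \<in> orthocomplement_in K (V ` H)"
        using QK[OF src_J[OF i] x(1)] y by (auto simp: orthocomplement_in_def)
    qed
  qed
  have coext: "adjoint_op K K (R i) (W h) = W (Tadj i h)" if "i \<in> I" "h \<in> H" for i h
    using that VK by (simp add: W_def R_adj Sa_V)
  have span: "K = closure (complex_vector.span
      (W ` H \<union> {foldr R w (W h) | w h. w \<noteq> [] \<and> set w \<subseteq> I \<and> h \<in> H}))"
  proof -
    have "{foldr R w (W h) | w h. w \<noteq> [] \<and> set w \<subseteq> I \<and> h \<in> H} =
        {foldr S w (V h) | w h. w \<noteq> [] \<and> set w \<subseteq> I \<and> h \<in> H}"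
      using foldr_R by (intro Collect_cong) metis
    then show ?thesis unfolding K_def WH by simp
  qed
  have "isometric_embedding H K W"
    using W_op V_inner by (simp add: isometric_embedding_def W_def)
  then have "minimal_pi_dilation n H T K W R"
    unfolding minimal_pi_dilation_def using K dagger red coext span by fastforce
  moreover have "induces_family n H J P K W R"
  proof -
    have "compose H (star_left K (R i)) W = compose H W (P (src i))" if i: "i \<in> I" for i
      using i VK by (auto simp: compose_def fun_eq_iff W_def left Q_V)
    then have "(\<lambda>i. compose H (star_left K (R i)) W) ` I = (\<lambda>i. compose H W (P (src i))) ` I"
      by (intro image_cong) auto
    also have "\<dots> = (\<lambda>k. compose H W (P k)) ` J"
      using src_tuple by (intro image_comp_onto) auto
    finally show ?thesis by (simp add: induces_family_def)
  qed
  ultimately show ?thesis by blast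
qed

end

section \<open>Operators on direct sums that act on the coordinates\<close>

lemma ell2_eqI:
  assumes "\<And>w. ell2_nth f w = ell2_nth g w"
  shows "f = g"
  using assms ell2_nth_inject[of f g] by (simp add: fun_eq_iff)

lemma ell2_nth_Abs: "(\<lambda>w. (norm (f w))\<^sup>2) summable_on UNIV \<Longrightarrow> ell2_nth (Abs_ell2 f) = f"
  by (rule Abs_ell2_inverse) simp

lemma summable_sq_ell2: "(\<lambda>w. (norm (ell2_nth f w))\<^sup>2) summable_on UNIV"
  using ell2_nth[of f] by simp

lemma summable_sq_dominated:
  assumes "\<And>w. norm (g w) \<le> norm (ell2_nth f w)"
  shows "(\<lambda>w. (norm (g w))\<^sup>2) summable_on UNIV"
  by (rule summable_on_comparison_test[OF summable_sq_ell2[of f]]) (simp_all add: assms power_mono)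

lemma norm_ell2_le:
  assumes "\<And>w. norm (ell2_nth g w) \<le> norm (ell2_nth f w)"
  shows "norm g \<le> norm f"
proof (rule power2_le_imp_le)
  show "(norm g)\<^sup>2 \<le> (norm f)\<^sup>2"
    unfolding norm_ell2_sq
    by (rule infsum_mono[OF summable_sq_ell2 summable_sq_ell2]) (simp add: assms power_mono)
qed simp

definition delta :: "'i \<Rightarrow> 'a::complex_inner \<Rightarrow> ('i, 'a) ell2" where
  "delta w x = Abs_ell2 (\<lambda>v. if v = w then x else 0)"

lemma delta_nth [simp]: "ell2_nth (delta w x) v = (if v = w then x else 0)"
proof -
  have "(\<lambda>v. (norm (if v = w then x else 0))\<^sup>2) summable_on UNIV"
    by (rule has_sum_imp_summable[OF has_sum_finite_neutralI[of "{w}"]]) auto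
  then show ?thesis by (simp add: delta_def ell2_nth_Abs)
qed

lemma adjoint_pair_delta: "adjoint_pair (delta w) (\<lambda>f. ell2_nth f w)"
  unfolding adjoint_pair_def
proof (intro allI)
  fix x :: 'a and f :: "('b, 'a) ell2"
  have "((\<lambda>v. cinner (ell2_nth (delta w x) v) (ell2_nth f v)) has_sum cinner x (ell2_nth f w)) UNIV"
    by (rule has_sum_finite_neutralI[of "{w}"]) auto
  then show "cinner (delta w x) f = cinner x (ell2_nth f w)"
    unfolding cinner_ell2.rep_eq by (rule infsumI)
qed

definition mask :: "'i set \<Rightarrow> ('i, 'a::complex_inner) ell2 \<Rightarrow> ('i, 'a) ell2" where
  "mask A f = Abs_ell2 (\<lambda>w. if w \<in> A then ell2_nth f w else 0)"

lemma mask_nth [simp]: "ell2_nth (mask A f) w = (if w \<in> A then ell2_nth f w else 0)"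
proof -
  have "(\<lambda>w. (norm (if w \<in> A then ell2_nth f w else 0))\<^sup>2) summable_on UNIV"
    by (rule summable_sq_dominated[of _ f]) simp
  then show ?thesis by (simp add: mask_def ell2_nth_Abs)
qed

lemma adjoint_pair_mask: "adjoint_pair (mask A) (mask A)"
  unfolding adjoint_pair_def cinner_ell2.rep_eq by (intro allI infsum_cong) simp

lemma norm_mask_le: "norm (mask A f) \<le> norm f"
  by (rule norm_ell2_le) simp

text \<open>For \<open>m\<close> injective on \<open>A\<close>, these are a partial isometry that moves coordinates and its adjoint.\<close>

definition push :: "('i \<Rightarrow> 'i) \<Rightarrow> 'i set \<Rightarrow> ('i, 'a::complex_inner) ell2 \<Rightarrow> ('i, 'a) ell2" where
  "push m A f = Abs_ell2 (\<lambda>v. if v \<in> m ` A then ell2_nth f (inv_into A m v) else 0)"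

definition pull :: "('i \<Rightarrow> 'i) \<Rightarrow> 'i set \<Rightarrow> ('i, 'a::complex_inner) ell2 \<Rightarrow> ('i, 'a) ell2" where
  "pull m A f = Abs_ell2 (\<lambda>u. if u \<in> A then ell2_nth f (m u) else 0)"

lemma push_nth:
  assumes m: "inj_on m A"
  shows "ell2_nth (push m A f) v = (if v \<in> m ` A then ell2_nth f (inv_into A m v) else 0)"
proof -
  let ?g = "\<lambda>v. if v \<in> m ` A then ell2_nth f (inv_into A m v) else 0"
  have "(\<lambda>u. (norm (ell2_nth f u))\<^sup>2) summable_on A"
    by (rule summable_on_subset_banach[OF summable_sq_ell2 subset_UNIV])
  moreover have "(norm (ell2_nth f u))\<^sup>2 = ((\<lambda>v. (norm (?g v))\<^sup>2) \<circ> m) u" if "u \<in> A" for u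
    using that m by simp
  ultimately have "((\<lambda>v. (norm (?g v))\<^sup>2) \<circ> m) summable_on A"
    using summable_on_cong[of A "\<lambda>u. (norm (ell2_nth f u))\<^sup>2" "(\<lambda>v. (norm (?g v))\<^sup>2) \<circ> m"] by blast
  then have "(\<lambda>v. (norm (?g v))\<^sup>2) summable_on m ` A"
    by (simp only: summable_on_reindex[OF m])
  moreover have "(\<lambda>v. (norm (?g v))\<^sup>2) summable_on UNIV \<longleftrightarrow> (\<lambda>v. (norm (?g v))\<^sup>2) summable_on m ` A"
    by (rule summable_on_cong_neutral) auto
  ultimately have "(\<lambda>v. (norm (?g v))\<^sup>2) summable_on UNIV" by blast
  then show ?thesis by (simp add: push_def ell2_nth_Abs)
qed

lemma push_nth_image: "inj_on m A \<Longrightarrow> u \<in> A \<Longrightarrow> ell2_nth (push m A f) (m u) = ell2_nth f u"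
  by (simp add: push_nth)

lemma push_nth_outside: "inj_on m A \<Longrightarrow> v \<notin> m ` A \<Longrightarrow> ell2_nth (push m A f) v = 0"
  by (simp add: push_nth)

lemma pull_nth:
  assumes m: "inj_on m A"
  shows "ell2_nth (pull m A f) u = (if u \<in> A then ell2_nth f (m u) else 0)"
proof -
  let ?g = "\<lambda>u. if u \<in> A then ell2_nth f (m u) else 0"
  have "(\<lambda>v. (norm (ell2_nth f v))\<^sup>2) summable_on m ` A"
    by (rule summable_on_subset_banach[OF summable_sq_ell2 subset_UNIV])
  then have "((\<lambda>v. (norm (ell2_nth f v))\<^sup>2) \<circ> m) summable_on A"
    by (simp only: summable_on_reindex[OF m])
  moreover have "(\<lambda>u. (norm (?g u))\<^sup>2) summable_on UNIV \<longleftrightarrow> ((\<lambda>v. (norm (ell2_nth f v))\<^sup>2) \<circ> m) summable_on A"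
    by (rule summable_on_cong_neutral) auto
  ultimately have "(\<lambda>u. (norm (?g u))\<^sup>2) summable_on UNIV" by blast
  then show ?thesis by (simp add: pull_def ell2_nth_Abs)
qed

lemma adjoint_pair_push:
  assumes m: "inj_on m A"
  shows "adjoint_pair (push m A) (pull m A)"
  unfolding adjoint_pair_def cinner_ell2.rep_eq
proof (intro allI)
  fix f g :: "('a, 'b) ell2"
  let ?c = "\<lambda>v. cinner (ell2_nth (push m A f) v) (ell2_nth g v)"
  have "(\<Sum>\<^sub>\<infinity>v. ?c v) = (\<Sum>\<^sub>\<infinity>v\<in>m ` A. ?c v)"
    by (rule infsum_cong_neutral) (auto simp: push_nth_outside[OF m])
  also have "\<dots> = (\<Sum>\<^sub>\<infinity>u\<in>A. (?c \<circ> m) u)"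
    by (rule infsum_reindex[OF m])
  also have "\<dots> = (\<Sum>\<^sub>\<infinity>u\<in>A. cinner (ell2_nth f u) (ell2_nth g (m u)))"
    by (rule infsum_cong) (simp add: push_nth_image[OF m])
  also have "\<dots> = (\<Sum>\<^sub>\<infinity>u. cinner (ell2_nth f u) (ell2_nth (pull m A g) u))"
    by (rule infsum_cong_neutral) (auto simp: pull_nth[OF m])
  finally show "(\<Sum>\<^sub>\<infinity>v. ?c v) = (\<Sum>\<^sub>\<infinity>u. cinner (ell2_nth f u) (ell2_nth (pull m A g) u))" .
qed

section \<open>Existence: the dilation on words\<close>

context stabilized_tuple
begin

abbreviation "Tx i \<equiv> extend_op H (T i)"
abbreviation "Txadj i \<equiv> extend_op H (Tadj i)"
abbreviation "Px k \<equiv> extend_op H (P k)"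

lemma proj_H [simp]: "orth_proj H x \<in> H"
  by (rule orth_proj_props(1)[OF H])

lemma proj_ident [simp]: "x \<in> H \<Longrightarrow> orth_proj H x = x"
  by (rule orth_proj_ident[OF H])

lemma Tx_adj: "i \<in> I \<Longrightarrow> adjoint_pair (Tx i) (Txadj i)"
  by (rule adjoint_pair_extend_op[OF T_op H])

lemma Px_adj: "k \<in> J \<Longrightarrow> adjoint_pair (Px k) (Px k)"
  using adjoint_pair_extend_op[OF P_op H, of k] P_adjoint_op[of k] by simp

lemma Px_Px: "k \<in> J \<Longrightarrow> l \<in> J \<Longrightarrow> Px k (Px l x) = (if k = l then Px k x else 0)"
  by (simp add: extend_op_def P_idem P_orth)

lemma Px_Tx: "k \<in> J \<Longrightarrow> i \<in> I \<Longrightarrow> Px k (Tx i x) = (if k = tgt i then Tx i x else 0)"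
  by (simp add: extend_op_def P_T)

lemma Px_Txadj: "k \<in> J \<Longrightarrow> i \<in> I \<Longrightarrow> Px k (Txadj i x) = (if k = src i then Txadj i x else 0)"
  by (simp add: extend_op_def P_Tadj)

lemma Txadj_Px: "k \<in> J \<Longrightarrow> i \<in> I \<Longrightarrow> Txadj i (Px k x) = (if k = tgt i then Txadj i x else 0)"
  by (simp add: extend_op_def Tadj_P)

lemma Px_norm: "k \<in> J \<Longrightarrow> norm (Px k x) \<le> norm x"
  by (rule norm_projection_le[OF Px_adj]) (simp_all add: Px_Px)

text \<open>
  Vectors of \<open>\<Oplus>\<^sub>i H\<close> are placed on the words of length one. The Tcolumn \<open>h \<mapsto> (T\<^sub>i\<^sup>* h)\<^sub>i\<close>
  is a contraction, and its adjoint is the row operator \<open>(T\<^sub>1, T\<^sub>2, \<dots>)\<close>.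
\<close>

definition letters :: "nat list set" where
  "letters = (\<lambda>i. [i]) ` I"

definition letters_to :: "'k \<Rightarrow> nat list set" where
  "letters_to k = (\<lambda>i. [i]) ` {i \<in> I. tgt i = k}"

definition Tcolumn :: "'a \<Rightarrow> (nat list, 'a) ell2" where
  "Tcolumn x = Abs_ell2 (\<lambda>w. if w \<in> letters then Txadj (hd w) x else 0)"

lemma Tcolumn_sum: "\<exists>s \<le> (norm x)\<^sup>2. ((\<lambda>w. (norm (if w \<in> letters then Txadj (hd w) x else 0))\<^sup>2) has_sum s) UNIV"
proof -
  let ?h = "orth_proj H x" and ?f = "\<lambda>w. (norm (if w \<in> letters then Txadj (hd w) x else 0))\<^sup>2"
  obtain A where A: "sot_sum H (\<lambda>i. star_right H (T i)) I A" "op_le H A (id_op H)"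
    using contraction by (auto simp: row_contraction_def)
  have "((\<lambda>i. inner ?h (star_right H (T i) ?h)) has_sum inner ?h (A ?h)) I"
    using A(1) by (intro has_sum_bounded_linear[OF bounded_linear_inner_right]) (simp add: sot_sum_def)
  moreover have "inner ?h (star_right H (T i) ?h) = (?f \<circ> (\<lambda>i. [i])) i" if i: "i \<in> I" for i
  proof -
    have "cinner (T i (Tadj i ?h)) ?h = cinner (Tadj i ?h) (Tadj i ?h)"
      using i by (simp add: T_adjoint)
    then have "inner (T i (Tadj i ?h)) ?h = (norm (Tadj i ?h))\<^sup>2"
      by (metis Re_cinner power2_norm_eq_inner)
    then show ?thesis
      using i by (simp add: star_right_def compose_eq inner_commute letters_def extend_op_def)
  qed
  ultimately have "((?f \<circ> (\<lambda>i. [i])) has_sum inner ?h (A ?h)) I"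
    using has_sum_cong[of I "\<lambda>i. inner ?h (star_right H (T i) ?h)" "?f \<circ> (\<lambda>i. [i])"] by simp
  then have "(?f has_sum inner ?h (A ?h)) letters"
    unfolding letters_def by (subst has_sum_reindex) (simp_all add: letters_def inj_on_def)
  then have "(?f has_sum inner ?h (A ?h)) UNIV"
    by (subst has_sum_cong_neutral[of letters _ _ ?f]) auto
  moreover have "inner ?h (A ?h) \<le> (norm x)\<^sup>2"
  proof -
    have "cinner ?h (?h - A ?h) \<in> \<real>\<^sub>\<ge>\<^sub>0"
      using A(2) unfolding op_le_def id_op_def by fastforce
    then have "0 \<le> inner ?h (?h - A ?h)"
      by (simp add: complex_nonneg_Reals_iff Re_cinner)
    then have "inner ?h (A ?h) \<le> (norm ?h)\<^sup>2" by (simp add: inner_diff_right power2_norm_eq_inner)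
    also have "\<dots> \<le> (norm x)\<^sup>2"
      using norm_projection_le[OF adjoint_pair_orth_proj[OF H], of x] by (intro power_mono) auto
    finally show ?thesis .
  qed
  ultimately show ?thesis by blast
qed

lemma Tcolumn_nth: "ell2_nth (Tcolumn x) w = (if w \<in> letters then Txadj (hd w) x else 0)"
proof -
  let ?f = "\<lambda>w. (norm (if w \<in> letters then Txadj (hd w) x else 0))\<^sup>2"
  obtain s where "(?f has_sum s) UNIV" using Tcolumn_sum[of x] by blast
  then have "?f summable_on UNIV" by (rule has_sum_imp_summable)
  then show ?thesis by (simp add: Tcolumn_def ell2_nth_Abs)
qed

lemma Tcolumn_norm: "norm (Tcolumn x) \<le> norm x"
proof -
  obtain s where s: "s \<le> (norm x)\<^sup>2" "((\<lambda>w. (norm (ell2_nth (Tcolumn x) w))\<^sup>2) has_sum s) UNIV"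
    using Tcolumn_sum[of x] unfolding Tcolumn_nth by blast
  then have "(norm (Tcolumn x))\<^sup>2 \<le> (norm x)\<^sup>2"
    unfolding norm_ell2_sq using infsumI[OF s(2)] by simp
  then show ?thesis by (rule power2_le_imp_le) simp
qed

lemma letters_hd: "w \<in> letters \<Longrightarrow> hd w \<in> I"
  by (auto simp: letters_def)

lemma Trow_exists: "\<exists>R. adjoint_pair Tcolumn R"
proof (rule adjoint_pair_exists[of Tcolumn 1])
  show "Tcolumn (x + y) = Tcolumn x + Tcolumn y" for x y
    by (rule ell2_eqI)
       (simp add: Tcolumn_nth plus_ell2.rep_eq adjoint_pair_add[OF adjoint_pair_sym[OF Tx_adj[OF letters_hd]]])
  show "Tcolumn (c *\<^sub>C x) = c *\<^sub>C Tcolumn x" for c x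
    by (rule ell2_eqI)
       (simp add: Tcolumn_nth scaleC_ell2.rep_eq adjoint_pair_scaleC[OF adjoint_pair_sym[OF Tx_adj[OF letters_hd]]])
  show "norm (Tcolumn x) \<le> 1 * norm x" for x
    using Tcolumn_norm by simp
qed blast

definition Trow :: "(nat list, 'a) ell2 \<Rightarrow> 'a" where
  "Trow = (SOME R. adjoint_pair Tcolumn R)"

lemma Tcolumn_adj: "adjoint_pair Tcolumn Trow"
  unfolding Trow_def by (rule someI_ex[OF Trow_exists])

lemma Trow_delta: "i \<in> I \<Longrightarrow> Trow (delta [i] x) = Tx i x"
proof (rule cinner_eqI)
  fix y assume i: "i \<in> I"
  have "cinner (delta [i] x) (Tcolumn y) = cinner x (Txadj i y)"
    using i adjoint_pairD[OF adjoint_pair_delta, of "[i]" x "Tcolumn y"]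
    by (simp add: Tcolumn_nth letters_def)
  then have "cinner (Trow (delta [i] x)) y = cinner (Tx i x) y"
    using adjoint_pairD[OF adjoint_pair_sym[OF Tcolumn_adj]] adjoint_pairD[OF Tx_adj[OF i]] by simp
  then show "cinner y (Trow (delta [i] x)) = cinner y (Tx i x)"
    using cinner_commute[of y "Trow (delta [i] x)"] cinner_commute[of y "Tx i x"] by simp
qed

lemma Trow_norm: "norm (Trow f) \<le> norm f"
  by (rule norm_adjoint_le[OF Tcolumn_adj Tcolumn_norm])

text \<open>
  The projection onto the direct sum of the initial spaces \<open>P\<^bsub>src i\<^esub> H\<close>, through which the row and
  the column operator factor.
\<close>

definition initial :: "(nat list, 'a) ell2 \<Rightarrow> (nat list, 'a) ell2" where
  "initial f = Abs_ell2 (\<lambda>w. if w \<in> letters then Px (src (hd w)) (ell2_nth f w) else 0)"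

lemma initial_nth: "ell2_nth (initial f) w = (if w \<in> letters then Px (src (hd w)) (ell2_nth f w) else 0)"
proof -
  have "(\<lambda>w. (norm (if w \<in> letters then Px (src (hd w)) (ell2_nth f w) else 0))\<^sup>2) summable_on UNIV"
    by (rule summable_sq_dominated[of _ f]) (simp add: Px_norm letters_hd)
  then show ?thesis by (simp add: initial_def ell2_nth_Abs)
qed

lemma initial_adj: "adjoint_pair initial initial"
  unfolding adjoint_pair_def cinner_ell2.rep_eq
proof (intro allI infsum_cong)
  fix f g :: "(nat list, 'a) ell2" and w
  show "cinner (ell2_nth (initial f) w) (ell2_nth g w) = cinner (ell2_nth f w) (ell2_nth (initial g) w)"
    using adjoint_pairD[OF Px_adj[OF src_J[OF letters_hd[of w]]]] by (simp add: initial_nth)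
qed

lemma initial_idem: "initial (initial f) = initial f"
  by (rule ell2_eqI) (simp add: initial_nth Px_Px letters_hd)

lemma initial_Tcolumn: "initial (Tcolumn x) = Tcolumn x"
  by (rule ell2_eqI) (simp add: initial_nth Tcolumn_nth Px_Txadj letters_hd)

lemma Trow_initial: "Trow (initial f) = Trow f"
proof (rule cinner_eqI)
  show "cinner x (Trow (initial f)) = cinner x (Trow f)" for x
    using adjoint_pairD[OF Tcolumn_adj, of x "initial f"] adjoint_pairD[OF Tcolumn_adj, of x f]
      adjoint_pairD[OF initial_adj, of "Tcolumn x" f] initial_Tcolumn by simp
qed

text \<open>The matrix \<open>(\<delta>\<^sub>i\<^sub>j P\<^bsub>src i\<^esub> - T\<^sub>i\<^sup>* T\<^sub>j)\<close>, whose square root is the defect operator.\<close>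

definition gap :: "(nat list, 'a) ell2 \<Rightarrow> (nat list, 'a) ell2" where
  "gap f = initial f - Tcolumn (Trow f)"

lemma gap_adj: "adjoint_pair gap gap"
  unfolding gap_def
  by (rule adjoint_pair_minus[OF initial_adj adjoint_pair_compose[OF Tcolumn_adj adjoint_pair_sym[OF Tcolumn_adj]]])

text \<open>
  With \<open>E\<close> for the projection \<open>initial\<close> and \<open>T\<close> for the row operator,
  \<open>1 - gap = (1 - E) + T\<^sup>* T\<close>, where \<open>T\<^sup>* T\<close> is a contraction of the range of \<open>E\<close>; so
  Pythagoras' theorem applies.
\<close>

lemma gap_contraction: "norm (f - gap f) \<le> norm f"
proof -
  let ?u = "f - initial f" and ?v = "Tcolumn (Trow f)"
  have "initial ?u = 0"
    by (simp add: adjoint_pair_diff[OF initial_adj] initial_idem)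
  then have kill: "cinner ?u (initial z) = 0" for z
    using adjoint_pairD[OF initial_adj, of ?u z] by simp
  have orth: "inner ?u (initial z) = 0" for z
    using arg_cong[OF kill[of z], of Re] by (simp add: Re_cinner)
  have pyth: "(norm (?u + initial z))\<^sup>2 = (norm ?u)\<^sup>2 + (norm (initial z))\<^sup>2" for z
  proof -
    have "inner (?u + initial z) (?u + initial z) =
        inner ?u ?u + 2 * inner ?u (initial z) + inner (initial z) (initial z)"
      unfolding inner_add_left inner_add_right using inner_commute[of "initial z" ?u] by linarith
    then show ?thesis unfolding power2_norm_eq_inner orth by linarith
  qed
  have "f - gap f = ?u + initial ?v"
    by (simp add: gap_def initial_Tcolumn)
  then have "(norm (f - gap f))\<^sup>2 = (norm ?u)\<^sup>2 + (norm ?v)\<^sup>2"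
    using pyth[of ?v] unfolding initial_Tcolumn by metis
  moreover have "norm ?v \<le> norm (initial f)"
  proof -
    have "?v = Tcolumn (Trow (initial f))" by (simp only: Trow_initial)
    also have "norm \<dots> \<le> norm (initial f)"
      by (rule order_trans[OF Tcolumn_norm Trow_norm])
    finally show ?thesis .
  qed
  then have "(norm ?v)\<^sup>2 \<le> (norm (initial f))\<^sup>2" by (rule power_mono) simp
  moreover have "(norm f)\<^sup>2 = (norm ?u)\<^sup>2 + (norm (initial f))\<^sup>2"
    using pyth[of f] unfolding diff_add_cancel .
  ultimately have "(norm (f - gap f))\<^sup>2 \<le> (norm f)\<^sup>2" by linarith
  then show ?thesis by (rule power2_le_imp_le) simp
qed

lemma gap_bounded_linear: "bounded_linear gap"
proof (rule adjoint_pair_bounded_linear[OF gap_adj])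
  show "norm (gap f) \<le> 2 * norm f" for f
    using norm_triangle_ineq4[of f "f - gap f"] gap_contraction[of f] by simp
qed

lemma mask_Tcolumn:
  assumes k: "k \<in> J"
  shows "Trow (mask (letters_to k) f) = Px k (Trow f)" and "mask (letters_to k) (Tcolumn x) = Tcolumn (Px k x)"
proof -
  show col: "mask (letters_to k) (Tcolumn x) = Tcolumn (Px k x)" for x
    by (rule ell2_eqI) (use k in \<open>auto simp: Tcolumn_nth letters_def letters_to_def Txadj_Px\<close>)
  show "Trow (mask (letters_to k) f) = Px k (Trow f)"
  proof (rule cinner_eqI)
    fix x
    have "cinner x (Trow (mask (letters_to k) f)) = cinner (mask (letters_to k) (Tcolumn x)) f"
      by (simp only: adjoint_pairD[OF Tcolumn_adj] adjoint_pairD[OF adjoint_pair_mask])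
    also have "\<dots> = cinner x (Px k (Trow f))"
      by (simp only: col adjoint_pairD[OF Tcolumn_adj] adjoint_pairD[OF Px_adj[OF k]])
    finally show "cinner x (Trow (mask (letters_to k) f)) = cinner x (Px k (Trow f))" .
  qed
qed

text \<open>
  The entry \<open>T\<^sub>i\<^sup>* T\<^sub>j\<close> vanishes unless \<open>i\<close> and \<open>j\<close> have the same target, so the matrix is
  block diagonal with respect to targets.
\<close>

lemma gap_mask_letters_to:
  assumes k: "k \<in> J"
  shows "mask (letters_to k) (gap f) = gap (mask (letters_to k) f)"
proof -
  have "mask (letters_to k) (initial f) = initial (mask (letters_to k) f)"
    by (rule ell2_eqI)
       (auto simp: initial_nth letters_def letters_to_def adjoint_pair_zero[OF Px_adj])
  then show ?thesis
    by (simp add: gap_def adjoint_pair_diff[OF adjoint_pair_mask] mask_Tcolumn[OF k])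
qed

lemma mask_letters_gap: "mask letters (gap f) = gap f"
  by (rule ell2_eqI) (auto simp: gap_def minus_ell2.rep_eq initial_nth Tcolumn_nth)

lemma gap_mask_letters: "gap (mask letters f) = gap f"
proof (rule cinner_eqI)
  show "cinner g (gap (mask letters f)) = cinner g (gap f)" for g
    using adjoint_pairD[OF gap_adj, of g "mask letters f"] adjoint_pairD[OF gap_adj, of g f]
      adjoint_pairD[OF adjoint_pair_mask, of letters "gap g" f] mask_letters_gap[of g] by simp
qed

text \<open>
  The square root inherits the block structure, and complex linearity, from what commutes with
  the matrix. It vanishes wherever the matrix does, because \<open>\<parallel>D x\<parallel>\<^sup>2 = \<langle>x, D\<^sup>2 x\<rangle>\<close>.
\<close>

lemma defect_exists:
  obtains D where "adjoint_pair D D" "\<And>f. D (D f) = gap f"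
    "\<And>k f. k \<in> J \<Longrightarrow> mask (letters_to k) (D f) = D (mask (letters_to k) f)"
    "\<And>f. mask letters (D f) = D f" "\<And>f. D (mask letters f) = D f"
proof -
  have sym: "inner (gap x) y = inner x (gap y)" for x y
    using adjoint_pairD[OF gap_adj, of x y] by (metis Re_cinner)
  obtain D where D: "bounded_linear D" "\<And>x y. inner (D x) y = inner x (D y)" "\<And>x. D (D x) = gap x"
    and comm: "\<And>E x. bounded_linear E \<Longrightarrow> (\<And>x. E (gap x) = gap (E x)) \<Longrightarrow> E (D x) = D (E x)"
    using positive_operator_sqrt[OF gap_bounded_linear sym gap_contraction] by blast
  have "\<i> *\<^sub>C D x = D (\<i> *\<^sub>C x)" for x
    by (rule comm[OF bounded_linear_scaleC]) (simp add: adjoint_pair_scaleC[OF gap_adj])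
  then have "cinner (D x) y = cinner x (D y)" for x y
    using D(2)[of x y] D(2)[of "\<i> *\<^sub>C x" y] by (simp add: cinner_eq_Complex)
  then have adj: "adjoint_pair D D" by (simp add: adjoint_pair_def)
  have lin: "bounded_linear (mask A)" for A :: "nat list set"
    by (rule adjoint_pair_bounded_linear[OF adjoint_pair_mask, where C = 1]) (simp add: norm_mask_le)
  have to: "mask (letters_to k) (D f) = D (mask (letters_to k) f)" if "k \<in> J" for k f
    by (rule comm[OF lin gap_mask_letters_to[OF that]])
  have letters: "D (mask letters f) = D f" for f
  proof -
    have "D (D (f - mask letters f)) = 0"
      by (simp add: D(3) adjoint_pair_diff[OF gap_adj] gap_mask_letters)
    then have "cinner (D (f - mask letters f)) (D (f - mask letters f)) = 0"
      using adjoint_pairD[OF adj, of "f - mask letters f" "D (f - mask letters f)"] by simp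
    then show ?thesis by (simp add: cinner_self_eq_zero adjoint_pair_diff[OF adj])
  qed
  moreover have "mask letters (D f) = D (mask letters f)" for f
    by (rule comm[OF lin]) (simp add: mask_letters_gap gap_mask_letters)
  ultimately show ?thesis using that[OF adj D(3) to] by simp
qed

text \<open>
  A word \<open>j # i\<^sub>r # \<dots> # i\<^sub>1\<close> carries the \<open>j\<close>-th coordinate of a defect vector to which the path
  \<open>i\<^sub>1, \<dots>, i\<^sub>r\<close> has been applied in this order. New letters go to the second place, and it is
  the letter applied last (\<open>j\<close> itself for a word of length one) that determines the vertex.
  Words that are not paths only enlarge the ambient space.
\<close>

definition words_to :: "'k \<Rightarrow> nat list set" where
  "words_to k = letters_to k \<union> {j # i # w | j i w. i \<in> I \<and> tgt i = k}"

definition insert_letter :: "nat \<Rightarrow> nat list \<Rightarrow> nat list" where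
  "insert_letter i w = hd w # i # tl w"

lemma Nil_notin_words_to: "[] \<notin> words_to k"
  by (auto simp: words_to_def letters_to_def)

lemma inj_insert_letter: "inj_on (insert_letter i) (words_to k)"
proof (rule inj_onI)
  fix u v assume "u \<in> words_to k" "v \<in> words_to k" "insert_letter i u = insert_letter i v"
  then show "u = v"
    using Nil_notin_words_to[of k] by (cases u; cases v) (auto simp: insert_letter_def)
qed

text \<open>
  In the product \<open>S\<^sub>i\<^sup>* S\<^sub>j\<close> the contribution \<open>T\<^sub>i\<^sup>* T\<^sub>j\<close> of the component in \<open>H\<close> cancels against
  the same term in the \<open>(i, j)\<close> entry of \<open>D\<^sup>2\<close>. The shifts have orthogonal ranges, made of words
  of length at least two, which \<open>D\<close> does not see.
\<close>

theorem dilation_exists: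
  "\<exists>(K :: (nat list, 'a) ell2 set) V S. minimal_pi_dilation n H T K V S \<and> induces_family n H J P K V S"
proof -
  obtain D where D_adj: "adjoint_pair D D" and D_D: "\<And>f. D (D f) = gap f"
    and D_to: "\<And>k f. k \<in> J \<Longrightarrow> mask (letters_to k) (D f) = D (mask (letters_to k) f)"
    and letters_D: "\<And>f. mask letters (D f) = D f" and D_letters: "\<And>f. D (mask letters f) = D f"
    using defect_exists by blast
  have D_zero: "D 0 = 0" by (rule adjoint_pair_zero[OF D_adj])
  have D_nth: "ell2_nth (D f) w = 0" if "w \<notin> letters" for f w
    using arg_cong[OF letters_D[of f], of "\<lambda>g. ell2_nth g w"] that by simp
  have D_kill: "D f = 0" if "\<And>w. w \<in> letters \<Longrightarrow> ell2_nth f w = 0" for f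
  proof -
    have "mask letters f = 0" by (rule ell2_eqI) (simp add: that zero_ell2.rep_eq)
    then show ?thesis using D_letters[of f] D_zero by simp
  qed
  let ?shift = "\<lambda>i. push (insert_letter i) (words_to (src i))"
  define S where "S i f = delta [] (Tx i (ell2_nth f [])) + D (delta [i] (ell2_nth f [])) + ?shift i f" for i f
  define Sa where "Sa i f = delta [] (Txadj i (ell2_nth f [])) + delta [] (ell2_nth (D f) [i]) +
    pull (insert_letter i) (words_to (src i)) f" for i f
  define Q where "Q k f = delta [] (Px k (ell2_nth f [])) + mask (words_to k) f" for k f
  note shift_in = push_nth_image[OF inj_insert_letter] and shift_out = push_nth_outside[OF inj_insert_letter]
    and unshift = pull_nth[OF inj_insert_letter]
  have short: "w \<notin> insert_letter i ` A" if "w = [] \<or> w \<in> letters" for w i A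
    using that by (auto simp: insert_letter_def letters_def)
  have shift_letters: "ell2_nth (?shift i f) w = 0" if "w = [] \<or> w \<in> letters" for i f w
    using shift_out[OF short[OF that]] .
  have long: "insert_letter i w \<noteq> []" "insert_letter i w \<notin> letters" for i w
    by (auto simp: insert_letter_def letters_def)
  note ell2_simps = plus_ell2.rep_eq zero_ell2.rep_eq

  show ?thesis
  proof (rule dilation_of_relations[where S = S and Sa = Sa and Q = Q and V = "delta []" and Va = "\<lambda>f. ell2_nth f []"])
    fix i assume i: "i \<in> I"
    note ev = adjoint_pair_sym[OF adjoint_pair_delta]
    show "adjoint_pair (S i) (Sa i)"
      unfolding S_def Sa_def
      by (rule adjoint_pair_plus[OF adjoint_pair_plus[OF
            adjoint_pair_compose[OF adjoint_pair_delta adjoint_pair_compose[OF Tx_adj[OF i] ev]]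
            adjoint_pair_compose[OF D_adj adjoint_pair_compose[OF adjoint_pair_delta ev]]]
          adjoint_pair_push[OF inj_insert_letter]])
    show "Sa i (delta [] h) = delta [] (Tadj i h)" if h: "h \<in> H" for h
    proof -
      have "D (delta [] h) = 0" by (rule D_kill) (auto simp: letters_def)
      then show ?thesis
        by (intro ell2_eqI) (use h in \<open>auto simp: Sa_def ell2_simps unshift long extend_op_def\<close>)
    qed
    fix k assume k: "k \<in> J"
    show "Q k (S i f) = (if k = tgt i then S i f else 0)" for f
    proof -
      let ?d = "delta [i] (ell2_nth f [])"
      have "mask (words_to k) (D ?d) = mask (letters_to k) (D ?d)"
        by (rule ell2_eqI) (auto simp: words_to_def D_nth letters_def image_iff)
      also have "\<dots> = D (mask (letters_to k) ?d)" by (rule D_to[OF k])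
      also have "mask (letters_to k) ?d = (if k = tgt i then ?d else 0)"
        using i by (intro ell2_eqI) (auto simp: letters_to_def ell2_simps)
      finally have defect: "mask (words_to k) (D ?d) = (if k = tgt i then D ?d else 0)"
        using D_zero by simp
      have "mask (words_to k) (?shift i f) = (if k = tgt i then ?shift i f else 0)"
      proof (rule ell2_eqI)
        fix w
        show "ell2_nth (mask (words_to k) (?shift i f)) w = ell2_nth (if k = tgt i then ?shift i f else 0) w"
        proof (cases "w \<in> insert_letter i ` words_to (src i)")
          case True
          then have "w \<in> words_to k \<longleftrightarrow> k = tgt i"
            using i by (auto simp: words_to_def insert_letter_def letters_to_def)
          then show ?thesis by (simp add: ell2_simps)
        qed (simp add: shift_out ell2_simps)
      qed
      moreover have "mask (words_to k) (delta [] x) = 0" for x :: 'a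
        by (rule ell2_eqI) (simp add: Nil_notin_words_to ell2_simps)
      moreover have "ell2_nth (S i f) [] = Tx i (ell2_nth f [])"
        by (simp add: S_def ell2_simps shift_letters D_nth letters_def image_iff)
      moreover have "delta [] 0 = (0 :: (nat list, 'a) ell2)"
        by (rule ell2_eqI) (simp add: ell2_simps)
      ultimately show ?thesis
        using defect Px_Tx[OF k i] by (simp add: Q_def S_def adjoint_pair_add[OF adjoint_pair_mask])
    qed
  next
    fix i j and f :: "(nat list, 'a) ell2" assume i: "i \<in> I" and j: "j \<in> I"
    let ?x = "ell2_nth f []"
    have at_Nil: "ell2_nth (S j f) [] = Tx j ?x"
      by (simp add: S_def ell2_simps shift_letters D_nth letters_def image_iff)
    have "D (delta [] (Tx j ?x)) = 0" "D (?shift j f) = 0"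
      by (rule D_kill; use shift_letters in \<open>auto simp: letters_def\<close>)+
    then have "D (S j f) = gap (delta [j] ?x)"
      by (simp add: S_def adjoint_pair_add[OF D_adj] D_D)
    then have defect: "ell2_nth (D (S j f)) [i] = (if i = j then Px (src i) ?x else 0) - Txadj i (Tx j ?x)"
      using i j adjoint_pair_zero[OF Px_adj[OF src_J[OF i]]]
      by (simp add: gap_def minus_ell2.rep_eq initial_nth Tcolumn_nth Trow_delta letters_def)
    have "ell2_nth (S j f) (insert_letter i u) = (if i = j then ell2_nth f u else 0)"
      if u: "u \<in> words_to (src i)" for u
    proof (cases "i = j")
      case True
      then show ?thesis
        using shift_in[OF u] long[of i u] by (simp add: S_def ell2_simps D_nth)
    next
      case False
      then have "insert_letter i u \<notin> insert_letter j ` words_to (src j)"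
        by (auto simp: insert_letter_def)
      then show ?thesis
        using False shift_out long[of i u] by (simp add: S_def ell2_simps D_nth)
    qed
    then have pull: "pull (insert_letter i) (words_to (src i)) (S j f) = (if i = j then mask (words_to (src i)) f else 0)"
      by (intro ell2_eqI) (simp add: unshift ell2_simps)
    show "Sa i (S j f) = (if i = j then Q (src i) f else 0)"
      by (rule ell2_eqI) (simp add: Sa_def Q_def at_Nil defect pull ell2_simps)
  next
    fix k l and f :: "(nat list, 'a) ell2" assume k: "k \<in> J" and l: "l \<in> J"
    have "words_to k \<inter> words_to l = {}" if "k \<noteq> l"
      using that by (auto simp: words_to_def letters_to_def)
    then show "Q k (Q l f) = (if k = l then Q k f else 0)"
      by (intro ell2_eqI) (auto simp: Q_def ell2_simps Nil_notin_words_to Px_Px[OF k l])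
  next
    fix k assume k: "k \<in> J"
    show "adjoint_pair (Q k) (Q k)"
      unfolding Q_def
      by (rule adjoint_pair_plus[OF
            adjoint_pair_compose[OF adjoint_pair_delta adjoint_pair_compose[OF Px_adj[OF k] adjoint_pair_sym[OF adjoint_pair_delta]]]
            adjoint_pair_mask])
    show "Q k (delta [] h) = delta [] (P k h)" if "h \<in> H" for h
      by (rule ell2_eqI) (use that in \<open>auto simp: Q_def ell2_simps Nil_notin_words_to extend_op_def\<close>)
  qed (simp_all add: adjoint_pair_delta)
qed

end

theorem theorem3p2:
  fixes n :: enat
    and H :: "'a::complex_hilbert set"
    and T :: "nat \<Rightarrow> 'a \<Rightarrow> 'a"
    and J :: "'k set"
    and P :: "'k \<Rightarrow> 'a \<Rightarrow> 'a"
  assumes "n \<ge> 1"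
    and "hilbert_space H"
    and "operator_tuple n H T"
    and "row_contraction n H T"
    and "stabilizes n H T J P"
    and "\<forall>k\<in>J. \<exists>i\<in>tuple_index n. compose H (T i) (P k) \<noteq> zero_op H"
  shows "(\<exists>(K :: (nat list, 'a) ell2 set) V S.
            minimal_pi_dilation n H T K V S \<and> induces_family n H J P K V S) \<and>
         (\<forall>(K :: 'b::complex_hilbert set) V S (K' :: 'c::complex_hilbert set) V' S'.
            minimal_pi_dilation n H T K V S \<and> induces_family n H J P K V S \<and>
            minimal_pi_dilation n H T K' V' S' \<and> induces_family n H J P K' V' S' \<longrightarrow>
            (\<exists>U. unitary_op K K' U \<and> (\<forall>h\<in>H. U (V h) = V' h) \<and>
                 (\<forall>i\<in>tuple_index n.
                    compose K (adjoint_op K K' U) (compose K (S' i) U) = S i)))"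
proof -
  interpret stabilized_tuple n H T J P
    using assms by unfold_locales
  show ?thesis
  proof (intro conjI allI impI, goal_cases)
    case 1
    show ?case by (rule dilation_exists)
  next
    case (2 K V S K' V' S')
    then have "pi_dilation n H T J P K V S" "pi_dilation n H T J P K' V' S'"
      by (simp_all add: pi_dilation_def pi_dilation_axioms_def stabilized_tuple_axioms)
    then show ?case by (rule dilation_unique)
  qed
qed

end
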